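(* Let $G$ be a locally compact group. For each $E\in\mathscr E_1(G)$, there exists a trivolution of $L_0^\infty(G)^*$ onto $E\,L_0^\infty(G)^*$.
   Context: $L^\infty(G)^*=L^1(G)^{**}$ carries the first Arens product: for $\lambda\in L^\infty(G)=L^1(G)^*$, $a,b\in L^1(G)$, $\Phi,\Psi\in L^\infty(G)^*$, $\langle\lambda\cdot a,b\rangle=\langle\lambda,a*b\rangle$, $\langle\Psi\cdot\lambda,a\rangle=\langle\Psi,\lambda\cdot a\rangle$, $\langle\Phi\Box\Psi,\lambda\rangle=\langle\Phi,\Psi\cdot\lambda\rangle$; write $\Phi\Psi$ for $\Phi\Box\Psi$. $L_0^\infty(G)$ is the closed ideal of $L^\infty(G)$ of all $f$ such that for every $\epsilon>0$ there is a compact $K\subset G$ with $\operatorname{ess\,sup}\{|f(x)|\colon x\in G\setminus K\}<\epsilon$. $L_0^\infty(G)^*$ is identified with the closed subalgebra of $L^\infty(G)^*$ that is the norm closure of the elements with compact carrier, $F\in L^\infty(G)^*$ having compact carrier if for some compact $K\subset G$, $F(f)=F(\chi_Kf)$ for every $f\in L^\infty(G)$. $\mathscr E_1(G)$ is the set of right identities of $L^\infty(G)^*$ of norm one (it is known that $\mathscr E_1(G)\subset L_0^\infty(G)^*$). A trivolution on a complex algebra $X$ is a non-zero conjugate-linear anti-homomorphism $\tau\colon X\to X$ (so $\tau(xy)=\tau(y)\tau(x)$) with $\tau^3=\tau\circ\tau\circ\tau=\tau$; on a normed algebra it is additionally assumed that $\|\tau\|=1$. A trivolution of $X$ onto $Y\subset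 X$ is a trivolution $\tau$ on $X$ with $\tau(X)=Y$. *)

theory Defs
  imports "HOL-Analysis.Analysis"
begin

text \<open>
  The group \<open>G\<close> is a type of class \<^class>\<open>topological_group_add\<close>, whose group operation,
  although written additively, need not be commutative: \<open>x + y\<close> is the product \<open>xy\<close>,
  \<open>- x\<close> is the inverse of \<open>x\<close>, and \<open>0\<close> is the identity.  Elements of \<open>L\<^sup>1(G)\<close> and
  \<open>L\<^sup>\<infinity>(G)\<close> are represented by functions, without passing to the quotients.
\<close>

definition left_haar_measure :: "'g::{topological_group_add,t2_space} measure \<Rightarrow> bool" where
  "left_haar_measure \<mu> \<longleftrightarrow>
     sets \<mu> = sets borel \<and>
     emeasure \<mu> UNIV \<noteq> 0 \<and>
     (\<forall>K. compact K \<longrightarrow> emeasure \<mu> K < \<infinity>) \<and>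
     (\<forall>A\<in>sets borel. emeasure \<mu> A = (INF U\<in>{U. open U \<and> A \<subseteq> U}. emeasure \<mu> U)) \<and>
     (\<forall>U. open U \<longrightarrow> emeasure \<mu> U = (SUP K\<in>{K. compact K \<and> K \<subseteq> U}. emeasure \<mu> K)) \<and>
     (\<forall>x. \<forall>A\<in>sets borel. emeasure \<mu> ((\<lambda>y. x + y) ` A) = emeasure \<mu> A)"

definition L1 :: "'g measure \<Rightarrow> ('g \<Rightarrow> complex) set" where
  "L1 \<mu> = {a. integrable \<mu> a}"

definition convolution ::
    "'g::{topological_group_add,t2_space} measure \<Rightarrow> ('g \<Rightarrow> complex) \<Rightarrow> ('g \<Rightarrow> complex) \<Rightarrow> 'g \<Rightarrow> complex" where
  "convolution \<mu> a b = (\<lambda>x. LINT y|\<mu>. a y * b (- y + x))"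

text \<open>
  A Haar measure need not be \<open>\<sigma>\<close>-finite.  As usual, \<open>L\<^sup>\<infinity>(G)\<close> therefore consists of the
  locally measurable functions that are bounded off a locally null set, functions being
  identified when they agree locally almost everywhere; this is what makes
  \<open>L\<^sup>1(G)\<^sup>* = L\<^sup>\<infinity>(G)\<close> true for every \<open>G\<close>.
\<close>

definition locally_measurable_set :: "'g measure \<Rightarrow> 'g set \<Rightarrow> bool" where
  "locally_measurable_set \<mu> A \<longleftrightarrow> (\<forall>B\<in>sets \<mu>. emeasure \<mu> B < \<infinity> \<longrightarrow> A \<inter> B \<in> sets \<mu>)"

definition locally_null :: "'g measure \<Rightarrow> 'g set \<Rightarrow> bool" where
  "locally_null \<mu> A \<longleftrightarrow> locally_measurable_set \<mu> A \<and>
     (\<forall>B\<in>sets \<mu>. emeasure \<mu> B < \<infinity> \<longrightarrow> emeasure \<mu> (A \<inter> B) = 0)"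

definition locally_measurable_fun :: "'g measure \<Rightarrow> ('g \<Rightarrow> complex) \<Rightarrow> bool" where
  "locally_measurable_fun \<mu> f \<longleftrightarrow> (\<forall>V\<in>sets borel. locally_measurable_set \<mu> (f -` V))"

definition Linf :: "'g measure \<Rightarrow> ('g \<Rightarrow> complex) set" where
  "Linf \<mu> = {f. locally_measurable_fun \<mu> f \<and> (\<exists>c. locally_null \<mu> {x. c < cmod (f x)})}"

definition Linf_norm :: "'g measure \<Rightarrow> ('g \<Rightarrow> complex) \<Rightarrow> real" where
  "Linf_norm \<mu> f = Inf {c. 0 \<le> c \<and> locally_null \<mu> {x. c < cmod (f x)}}"

definition pairing :: "'g measure \<Rightarrow> ('g \<Rightarrow> complex) \<Rightarrow> ('g \<Rightarrow> complex) \<Rightarrow> complex" where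
  "pairing \<mu> f a = (LINT x|\<mu>. f x * a x)"

text \<open>
  The identification \<open>L\<^sup>1(G)\<^sup>* = L\<^sup>\<infinity>(G)\<close>: a function representing the bounded functional \<open>\<phi>\<close>
  on \<open>L\<^sup>1(G)\<close>.  It is unique only up to a locally null set, to which the elements of
  \<open>Linf_dual\<close> below are insensitive.
\<close>

definition Linf_rep :: "'g measure \<Rightarrow> (('g \<Rightarrow> complex) \<Rightarrow> complex) \<Rightarrow> 'g \<Rightarrow> complex" where
  "Linf_rep \<mu> \<phi> = (SOME h. h \<in> Linf \<mu> \<and> (\<forall>a\<in>L1 \<mu>. pairing \<mu> h a = \<phi> a))"

text \<open>
  \<open>L\<^sup>\<infinity>(G)\<^sup>*\<close>.  Boundedness with respect to the seminorm \<open>Linf_norm\<close> makes a functional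
  constant on classes modulo locally null sets.  The value \<open>0\<close> outside \<open>Linf \<mu>\<close> is a
  normalization which makes equality of functionals coincide with equality in HOL.
\<close>

definition Linf_dual :: "'g measure \<Rightarrow> (('g \<Rightarrow> complex) \<Rightarrow> complex) set" where
  "Linf_dual \<mu> = {F.
     (\<forall>f\<in>Linf \<mu>. \<forall>g\<in>Linf \<mu>. F (\<lambda>x. f x + g x) = F f + F g) \<and>
     (\<forall>c. \<forall>f\<in>Linf \<mu>. F (\<lambda>x. c * f x) = c * F f) \<and>
     (\<exists>C. \<forall>f\<in>Linf \<mu>. cmod (F f) \<le> C * Linf_norm \<mu> f) \<and>
     (\<forall>f. f \<notin> Linf \<mu> \<longrightarrow> F f = 0)}"

definition dual_norm :: "'g measure \<Rightarrow> (('g \<Rightarrow> complex) \<Rightarrow> complex) \<Rightarrow> real" where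
  "dual_norm \<mu> F = Sup {cmod (F f) | f. f \<in> Linf \<mu> \<and> Linf_norm \<mu> f \<le> 1}"

text \<open>The three steps \<open>\<lambda>\<cdot>a\<close>, \<open>\<Psi>\<cdot>\<lambda>\<close> and \<open>\<Phi>\<box>\<Psi>\<close> of the first Arens product.\<close>

definition act_L1 ::
    "'g::{topological_group_add,t2_space} measure \<Rightarrow> ('g \<Rightarrow> complex) \<Rightarrow> ('g \<Rightarrow> complex) \<Rightarrow> 'g \<Rightarrow> complex" where
  "act_L1 \<mu> f a = Linf_rep \<mu> (\<lambda>b. pairing \<mu> f (convolution \<mu> a b))"

definition act_dual ::
    "'g::{topological_group_add,t2_space} measure \<Rightarrow> (('g \<Rightarrow> complex) \<Rightarrow> complex) \<Rightarrow> ('g \<Rightarrow> complex) \<Rightarrow> 'g \<Rightarrow> complex" where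
  "act_dual \<mu> \<Psi> f = Linf_rep \<mu> (\<lambda>a. \<Psi> (act_L1 \<mu> f a))"

definition arens ::
    "'g::{topological_group_add,t2_space} measure \<Rightarrow> (('g \<Rightarrow> complex) \<Rightarrow> complex)
      \<Rightarrow> (('g \<Rightarrow> complex) \<Rightarrow> complex) \<Rightarrow> ('g \<Rightarrow> complex) \<Rightarrow> complex" where
  "arens \<mu> \<Phi> \<Psi> = (\<lambda>f. if f \<in> Linf \<mu> then \<Phi> (act_dual \<mu> \<Psi> f) else 0)"

definition compact_carrier ::
    "'g::topological_space measure \<Rightarrow> (('g \<Rightarrow> complex) \<Rightarrow> complex) \<Rightarrow> bool" where
  "compact_carrier \<mu> F \<longleftrightarrow>
     (\<exists>K. compact K \<and> (\<forall>f\<in>Linf \<mu>. F f = F (\<lambda>x. indicator K x * f x)))"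

text \<open>\<open>L\<^sub>0\<^sup>\<infinity>(G)\<^sup>*\<close>, identified with the norm closure of the functionals with compact carrier.\<close>

definition Linf0_dual :: "'g::topological_space measure \<Rightarrow> (('g \<Rightarrow> complex) \<Rightarrow> complex) set" where
  "Linf0_dual \<mu> = {F \<in> Linf_dual \<mu>. \<forall>\<epsilon>>0. \<exists>H\<in>Linf_dual \<mu>.
     compact_carrier \<mu> H \<and> dual_norm \<mu> (\<lambda>f. F f - H f) < \<epsilon>}"

definition right_identities_norm_one ::
    "'g::{topological_group_add,t2_space} measure \<Rightarrow> (('g \<Rightarrow> complex) \<Rightarrow> complex) set" where
  "right_identities_norm_one \<mu> =
     {E \<in> Linf_dual \<mu>. (\<forall>\<Phi>\<in>Linf_dual \<mu>. arens \<mu> \<Phi> E = \<Phi>) \<and> dual_norm \<mu> E = 1}"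

record 'x normed_alg =
  carr :: "'x set"
  zer :: 'x
  plus_of :: "'x \<Rightarrow> 'x \<Rightarrow> 'x"
  scale_of :: "complex \<Rightarrow> 'x \<Rightarrow> 'x"
  mult_of :: "'x \<Rightarrow> 'x \<Rightarrow> 'x"
  norm_of :: "'x \<Rightarrow> real"

text \<open>
  Trivolutions of a complex normed algebra.  The last two conditions say that the operator
  norm of \<open>\<tau>\<close> is \<open>1\<close>; boundedness is explicit because \<^const>\<open>Sup\<close> of an unbounded set of
  reals is unspecified.
\<close>

definition trivolution :: "'x normed_alg \<Rightarrow> ('x \<Rightarrow> 'x) \<Rightarrow> bool" where
  "trivolution X \<tau> \<longleftrightarrow>
     (\<forall>x\<in>carr X. \<tau> x \<in> carr X) \<and>
     (\<forall>x\<in>carr X. \<forall>y\<in>carr X. \<tau> (plus_of X x y) = plus_of X (\<tau> x) (\<tau> y)) \<and>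
     (\<forall>c. \<forall>x\<in>carr X. \<tau> (scale_of X c x) = scale_of X (cnj c) (\<tau> x)) \<and>
     (\<forall>x\<in>carr X. \<forall>y\<in>carr X. \<tau> (mult_of X x y) = mult_of X (\<tau> y) (\<tau> x)) \<and>
     (\<exists>x\<in>carr X. \<tau> x \<noteq> zer X) \<and>
     (\<forall>x\<in>carr X. \<tau> (\<tau> (\<tau> x)) = \<tau> x) \<and>
     bdd_above {norm_of X (\<tau> x) | x. x \<in> carr X \<and> norm_of X x \<le> 1} \<and>
     Sup {norm_of X (\<tau> x) | x. x \<in> carr X \<and> norm_of X x \<le> 1} = 1"

definition trivolution_onto :: "'x normed_alg \<Rightarrow> 'x set \<Rightarrow> ('x \<Rightarrow> 'x) \<Rightarrow> bool" where
  "trivolution_onto X Y \<tau> \<longleftrightarrow> Y \<subseteq> carr X \<and> trivolution X \<tau> \<and> \<tau> ` carr X = Y"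

definition Linf0_dual_alg ::
    "'g::{topological_group_add,t2_space} measure \<Rightarrow> (('g \<Rightarrow> complex) \<Rightarrow> complex) normed_alg" where
  "Linf0_dual_alg \<mu> =
     \<lparr>carr = Linf0_dual \<mu>,
      zer = (\<lambda>f. 0),
      plus_of = (\<lambda>F H f. F f + H f),
      scale_of = (\<lambda>c F f. c * F f),
      mult_of = arens \<mu>,
      norm_of = dual_norm \<mu>\<rparr>"

end

theory Submission
  imports Defs
begin

text \<open>
  Let \<open>f\<^sup>~(x)\<close> be the complex conjugate of \<open>f(- x)\<close>, and let \<open>F\<^sup>*(f)\<close> be the complex conjugate of
  \<open>F(f\<^sup>~)\<close> for a bounded functional \<open>F\<close> on \<open>L\<^sup>\<infinity>(G)\<close>.  The Arens product treats its two factors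
  differently, and \<open>F \<mapsto> F\<^sup>*\<close> need not reverse it.  The trivolution is \<open>\<tau>(F) = E \<box> F\<^sup>*\<close>:
  multiplying by \<open>E\<close> from the left forgets exactly what obstructs the anti-multiplicativity.

  The product \<open>\<Phi> \<box> F\<close> depends on \<open>F\<close> only through its values on the functions \<open>f\<cdot>a\<close> with
  \<open>f \<in> L\<^sup>\<infinity>(G)\<close> and \<open>a \<in> L\<^sup>1(G)\<close>, and these functions are bounded and continuous
  (\<open>act_continuous\<close>).  If \<open>F\<close> belongs to \<open>L\<^sub>0\<^sup>\<infinity>(G)\<^sup>*\<close>, it is concentrated on a compact set up to a
  small error, so its values on bounded continuous functions are determined by its values on the
  continuous functions of compact support.  Hence \<open>\<Phi> \<box> F = \<Phi> \<box> F'\<close> as soon as \<open>F\<close> and \<open>F'\<close> in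
  \<open>L\<^sub>0\<^sup>\<infinity>(G)\<^sup>*\<close> agree there (\<open>Linf0_arens_cong\<close>).  On such a function \<open>g\<close> the product is an
  iterated one: \<open>(F \<box> H)(g)\<close> is obtained by applying \<open>H\<close> to \<open>g(x + y)\<close> in \<open>y\<close> and then \<open>F\<close> in
  \<open>x\<close>.  The order may be interchanged (\<open>functional_fubini\<close>), because on a compact set \<open>x\<close> can be
  rounded to finitely many points while \<open>g(x + y)\<close> changes little, uniformly in \<open>y\<close>.
  Consequently \<open>(F \<box> H)\<^sup>*\<close> and \<open>H\<^sup>* \<box> F\<^sup>*\<close> agree on the continuous functions of compact support
  (\<open>star_arens_Cc\<close>).

  A right identity \<open>E\<close> satisfies \<open>E(f\<cdot>a) = \<langle>f, a\<rangle>\<close>, whence \<open>E \<box> F\<close> and \<open>F\<close> agree on all functions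
  \<open>f\<cdot>a\<close>, and \<open>(E \<box> A) \<box> (E \<box> B) = E \<box> (A \<box> B)\<close>.  These facts give
  \<open>\<tau>(F \<box> H) = \<tau>(H) \<box> \<tau>(F)\<close>, \<open>\<tau>(\<tau>(F)) = E \<box> F\<close> and \<open>\<tau>\<^sup>3 = \<tau>\<close>; moreover \<open>\<tau>(E) = E\<close>, so that the
  contraction \<open>\<tau>\<close> has norm one.  The hypothesis \<open>\<parallel>E\<parallel> = 1\<close> puts \<open>E\<close> itself into \<open>L\<^sub>0\<^sup>\<infinity>(G)\<^sup>*\<close>
  (\<open>right_identity_norm_one_Linf0\<close>): \<open>E\<close> takes the value \<open>1\<close> at a function with values in
  \<open>[0,1]\<close> and compact support, and a functional of norm one then has no mass off that support.

  The group need not be \<open>\<sigma>\<close>-compact, and the Borel sets of \<open>G \<times> G\<close> need not be generated by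
  rectangles.  This is why three classical facts about Haar measure precede the argument: Tonelli's
  theorem for Borel functions on \<open>G \<times> G\<close>, whose core is an approximation of open sets by
  countable unions of open rectangles (\<open>open_set_countable_rectangles\<close>); the invariance of null
  sets under inversion (\<open>neg_null_set\<close>), which yields the continuity of \<open>f\<cdot>a\<close>; and the duality
  \<open>L\<^sup>1(G)\<^sup>* = L\<^sup>\<infinity>(G)\<close> (\<open>L1_dual\<close>), which supplies the representing functions that occur in the
  definition of the Arens product.
\<close>

section \<open>Compact sets in a locally compact group\<close>

lemma compact_neighbourhood:
  fixes x :: "'g::topological_space"
  assumes "locally compact (UNIV :: 'g set)" "open W" "x \<in> W"
  obtains U C where "open U" "compact C" "x \<in> U" "U \<subseteq> C" "C \<subseteq> W"
proof -
  have "openin (top_of_set UNIV) W" using assms by simp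
  from locallyE[OF assms(1) this assms(3)] show ?thesis
    using that by (metis open_openin subtopology_UNIV)
qed

lemma compact_set_neighbourhood:
  fixes K :: "'g::topological_space set"
  assumes lc: "locally compact (UNIV :: 'g set)" and K: "compact K" "open W" "K \<subseteq> W"
  obtains U C where "open U" "compact C" "K \<subseteq> U" "U \<subseteq> C" "C \<subseteq> W"
proof -
  have "\<forall>x\<in>K. \<exists>U C. open U \<and> compact C \<and> x \<in> U \<and> U \<subseteq> C \<and> C \<subseteq> W"
    using compact_neighbourhood[OF lc K(2)] K(3) by (metis subsetD)
  then obtain U C where UC: "\<And>x. x \<in> K \<Longrightarrow> open (U x) \<and> compact (C x) \<and> x \<in> U x \<and> U x \<subseteq> C x \<and> C x \<subseteq> W"
    by metis
  have "K \<subseteq> \<Union>(U ` K)" "\<forall>B\<in>U ` K. open B" using UC by auto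
  with \<open>compact K\<close> obtain D where D: "D \<subseteq> U ` K" "finite D" "K \<subseteq> \<Union>D"
    by (meson compactE)
  then obtain F where F: "F \<subseteq> K" "finite F" "D = U ` F"
    by (metis finite_subset_image)
  show ?thesis
  proof (rule that[of "\<Union>(U ` F)" "\<Union>(C ` F)"])
    show "compact (\<Union> (C ` F))" using F UC by (intro compact_UN) auto
    show "open (\<Union> (U ` F))" using F UC by (intro open_UN) auto
    show "K \<subseteq> \<Union> (U ` F)" using D F by auto
    show "\<Union> (U ` F) \<subseteq> \<Union> (C ` F)" using F UC by (intro UN_mono) auto
    show "\<Union> (C ` F) \<subseteq> W" using F UC by (intro UN_least) auto
  qed
qed

text \<open>
  A locally compact Hausdorff space is completely regular, so a continuous function separates \<open>K\<close>
  from the complement of a relatively compact open neighbourhood of \<open>K\<close>.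
\<close>
lemma compact_support_cutoff:
  fixes K :: "'g::t2_space set"
  assumes lc: "locally compact (UNIV :: 'g set)" and K: "compact K" "open W" "K \<subseteq> W"
  obtains u :: "'g \<Rightarrow> real" and C where "continuous_on UNIV u" "\<And>x. 0 \<le> u x" "\<And>x. u x \<le> 1"
    "\<And>x. x \<in> K \<Longrightarrow> u x = 1" "compact C" "C \<subseteq> W" "\<And>x. x \<notin> C \<Longrightarrow> u x = 0"
proof -
  obtain U C where U: "open U" "compact C" "K \<subseteq> U" "U \<subseteq> C" "C \<subseteq> W"
    using compact_set_neighbourhood[OF lc K] by metis
  have "locally_compact_space (euclidean :: 'g topology)"
    unfolding locally_compact_space_def using compact_neighbourhood[OF lc open_UNIV UNIV_I]
    by (metis compactin_euclidean_iff open_openin)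
  moreover have "Hausdorff_space (euclidean :: 'g topology)"
    unfolding Hausdorff_space_def disjnt_def by (simp, metis hausdorff)
  ultimately have cr: "completely_regular_space (euclidean :: 'g topology)"
    using locally_compact_regular_imp_completely_regular_space by blast
  obtain f :: "'g \<Rightarrow> real" where f: "continuous_map euclidean (top_of_set {0..1}) f"
      "f ` (-U) \<subseteq> {0}" "f ` K \<subseteq> {1}"
    by (rule Urysohn_completely_regular_compact_closed[of 0 1, OF _ cr, of K "-U"])
      (use U K in \<open>auto simp: disjnt_def closed_Compl\<close>)
  show ?thesis
  proof (rule that[of f C])
    show "continuous_on UNIV f" using f(1) 
      by (simp add: continuous_map_in_subtopology)
  qed (use f U in \<open>auto simp: continuous_map_in_subtopology image_subset_iff\<close>)
qed

section \<open>Uniform continuity and Borel rounding\<close>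

lemma continuous_on_add_left [continuous_intros]:
  fixes x :: "'g::topological_group_add"
  shows "continuous_on S (\<lambda>y. x + y)" by (intro continuous_intros)

lemma continuous_on_neg:
  "continuous_on S f \<Longrightarrow> continuous_on S (\<lambda>x. - f x :: 'g::topological_group_add)"
  unfolding continuous_on_def by (auto intro: tendsto_minus)

lemma compact_neg:
  fixes K :: "'g::topological_group_add set"
  shows "compact K \<Longrightarrow> compact (uminus ` K)"
  by (intro compact_continuous_image continuous_on_neg continuous_intros)

lemma compact_plus:
  fixes K L :: "'g::topological_group_add set"
  assumes "compact K" "compact L"
  shows "compact ((\<lambda>(x,y). x + y) ` (K \<times> L))"
  unfolding split_def
  by (intro compact_continuous_image compact_Times assms continuous_intros)

lemma open_neg:
  fixes U :: "'g::topological_group_add set"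
  assumes "open U" shows "open (uminus -` U)"
  using assms by (intro open_vimage continuous_on_neg continuous_intros)

definition Cc :: "('g::topological_space \<Rightarrow> complex) set" where
  "Cc = {g. continuous_on UNIV g \<and> (\<exists>K. compact K \<and> (\<forall>x. x \<notin> K \<longrightarrow> g x = 0))}"

text \<open>
  The tube lemma gives the estimate uniformly for \<open>x\<close> in the support.  If only \<open>v + x\<close> lies in the
  support, the estimate at \<open>v + x\<close> with \<open>- v\<close> in place of \<open>v\<close> serves, and for this \<open>V\<close> is made
  symmetric.
\<close>
lemma Cc_left_uniformly_continuous:
  fixes g :: "'g::topological_group_add \<Rightarrow> complex"
  assumes g: "g \<in> Cc" and e: "0 < e"
  obtains V where "open V" "0 \<in> V" "\<And>v x. v \<in> V \<Longrightarrow> cmod (g (v + x) - g x) < e"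
proof -
  obtain K where c: "continuous_on UNIV g" and K: "compact K" "\<And>x. x \<notin> K \<Longrightarrow> g x = 0"
    using g by (auto simp: Cc_def)
  let ?W = "{(v,x). cmod (g (v + x) - g x) < e}"
  have W: "open ?W"
    unfolding split_def
    by (intro open_Collect_less continuous_intros continuous_on_compose2[OF c]) auto
  have W0: "{0} \<times> K \<subseteq> ?W" using e by auto
  obtain V where V: "0 \<in> V" "open V" "V \<times> K \<subseteq> ?W"
    using Elementary_Topology.tube_lemma[OF K(1) W W0] by (elim exE conjE)
  show ?thesis
  proof (rule that[of "V \<inter> uminus -` V"])
    show "open (V \<inter> uminus -` V)" using V open_neg by auto
    show "0 \<in> V \<inter> uminus -` V" using V by auto
    fix v x assume v: "v \<in> V \<inter> uminus -` V"
    show "cmod (g (v + x) - g x) < e"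
    proof (cases "x \<in> K")
      case True then show ?thesis using V v by auto
    next
      case x: False
      show ?thesis
      proof (cases "v + x \<in> K")
        case True
        then have "(- v, v + x) \<in> ?W" using V v by auto
        then show ?thesis by (simp add: add.assoc[symmetric] norm_minus_commute)
      next
        case False then show ?thesis using K x e by simp
      qed
    qed
  qed
qed

lemma Cc_neg: 
  fixes g :: "'g::topological_group_add \<Rightarrow> complex"
  assumes "g \<in> Cc" shows "(\<lambda>x. g (- x)) \<in> Cc"
proof -
  obtain K where c: "continuous_on UNIV g" and K: "compact K" "\<And>x. x \<notin> K \<Longrightarrow> g x = 0"
    using assms by (auto simp: Cc_def)
  have "continuous_on UNIV (\<lambda>x. g (- x))"
    by (intro continuous_on_compose2[OF c] continuous_on_neg continuous_intros) auto
  moreover have "\<forall>x. x \<notin> uminus ` K \<longrightarrow> g (- x) = 0"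
    by (metis K(2) image_iff minus_minus)
  ultimately show ?thesis using compact_neg[OF K(1)] by (auto simp: Cc_def)
qed

lemma Cc_cnj: "g \<in> Cc \<Longrightarrow> (\<lambda>x. cnj (g x)) \<in> Cc"
  by (auto simp: Cc_def intro!: continuous_intros)

lemma Cc_translate:
  fixes g :: "'g::topological_group_add \<Rightarrow> complex"
  assumes "g \<in> Cc" shows "(\<lambda>x. g (y + x)) \<in> Cc"
proof -
  obtain K where c: "continuous_on UNIV g" and K: "compact K" "\<And>x. x \<notin> K \<Longrightarrow> g x = 0"
    using assms by (auto simp: Cc_def)
  have "continuous_on UNIV (\<lambda>x. g (y + x))"
    by (intro continuous_on_compose2[OF c] continuous_intros) auto
  moreover have "\<forall>x. x \<notin> (\<lambda>x. - y + x) ` K \<longrightarrow> g (y + x) = 0"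
    using K(2) by (metis (no_types) image_iff minus_add_cancel)
  moreover have "compact ((\<lambda>x. - y + x) ` K)"
    by (intro compact_continuous_image K continuous_intros)
  ultimately show ?thesis by (auto simp: Cc_def)
qed

lemma Cc_right_translate:
  fixes g :: "'g::topological_group_add \<Rightarrow> complex"
  assumes "g \<in> Cc" shows "(\<lambda>x. g (x + y)) \<in> Cc"
  using Cc_neg[OF Cc_translate[OF Cc_neg[OF assms], of "- y"]] by (simp add: minus_add)

lemma Cc_bounded:
  assumes "g \<in> Cc" obtains B where "\<And>x. cmod (g x) \<le> B"
proof -
  obtain K where c: "continuous_on UNIV g" and K: "compact K" "\<And>x. x \<notin> K \<Longrightarrow> g x = 0"
    using assms by (auto simp: Cc_def)
  have "bounded (g ` K)" by (intro compact_imp_bounded compact_continuous_image K continuous_on_subset[OF c]) auto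
  then obtain B where "\<And>x. x \<in> K \<Longrightarrow> cmod (g x) \<le> B" by (auto simp: bounded_iff)
  then have "cmod (g x) \<le> max B 0" for x using K(2)[of x] by (cases "x \<in> K") fastforce+
  then show ?thesis using that by blast
qed

text \<open>
  Finitely many translates \<open>V + y\<close> with \<open>y \<in> K\<close> cover \<open>K\<close>, and \<open>x\<close> is rounded to the first \<open>y\<close> in
  a list of these with \<open>x - y \<in> V\<close>.  This lets a functional act on \<open>x \<mapsto> g(x + y)\<close> as a finite sum,
  up to a small error.
\<close>
lemma Borel_rounding:
  fixes K :: "'g::{topological_group_add,t2_space} set"
  assumes K: "compact K" and V: "open V" "0 \<in> V"
  obtains I and p :: "'g \<Rightarrow> 'g" where "finite I" "\<And>x. x \<in> K \<Longrightarrow> p x \<in> I"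
    "\<And>x. x \<in> K \<Longrightarrow> x - p x \<in> V" "\<And>i. {x\<in>K. p x = i} \<in> sets borel"
proof -
  let ?O = "\<lambda>y. (\<lambda>x. x - y) -` V"
  have op: "open (?O y)" for y using V(1) 
    by (intro open_vimage) (auto simp only: diff_conv_add_uminus intro!: continuous_intros)
  have "K \<subseteq> \<Union>(?O ` K)" using V by auto
  with K obtain D where D: "D \<subseteq> ?O ` K" "finite D" "K \<subseteq> \<Union>D"
    by (rule compactE[of K "?O ` K"]) (use op in auto)
  then obtain F where F: "finite F" "D = ?O ` F" by (metis finite_subset_image)
  obtain l where l: "set l = F" using F finite_list by blast
  define p where "p x = l ! (LEAST i. i < length l \<and> x - l ! i \<in> V)" for x
  define m where "m x = (LEAST i. i < length l \<and> x - l ! i \<in> V)" for x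
  have ex: "\<exists>i. i < length l \<and> x - l ! i \<in> V" if "x \<in> K" for x
    using that D(3) F(2) l by (auto simp: in_set_conv_nth[symmetric] set_conv_nth)
  have m: "m x < length l \<and> x - l ! m x \<in> V" if "x \<in> K" for x
    unfolding m_def using LeastI_ex[OF ex[OF that]] .
  have p: "p x = l ! m x" for x by (simp add: p_def m_def)
  have mk: "{x\<in>K. m x = k} \<in> sets borel" for k
  proof (cases "k < length l")
    case False
    then have "{x\<in>K. m x = k} = {}" using m by auto
    then show ?thesis by (simp only: sets.empty_sets)
  next
    case k: True
    have "{x\<in>K. m x = k} = K \<inter> ?O (l ! k) - (\<Union>j<k. ?O (l ! j))"
    proof (intro set_eqI iffI)
      fix x assume "x \<in> {x\<in>K. m x = k}"
      then show "x \<in> K \<inter> ?O (l ! k) - (\<Union>j<k. ?O (l ! j))"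
        using m[of x] not_less_Least[of _ "\<lambda>i. i < length l \<and> x - l ! i \<in> V"] k
        by (auto simp: m_def)
    next
      fix x assume x: "x \<in> K \<inter> ?O (l ! k) - (\<Union>j<k. ?O (l ! j))"
      then have "m x = k" unfolding m_def using k by (intro Least_equality) (auto simp: not_less[symmetric])
      then show "x \<in> {x\<in>K. m x = k}" using x by auto
    qed
    also have "\<dots> \<in> sets borel" using op K by (intro sets.Diff sets.Int sets.finite_UN borel_open borel_closed compact_imp_closed) auto
    finally show ?thesis .
  qed
  show ?thesis
  proof (rule that[of F p])
    show "finite F" by fact
    show "p x \<in> F" if "x \<in> K" for x using m[OF that] l p by auto
    show "x - p x \<in> V" if "x \<in> K" for x using m[OF that] p by auto
    fix i
    have "{x\<in>K. p x = i} = (\<Union>k\<in>{k. k < length l \<and> l ! k = i}. {x\<in>K. m x = k})"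
      using m p by auto
    also have "\<dots> \<in> sets borel" using mk by (intro sets.finite_UN) auto
    finally show "{x\<in>K. p x = i} \<in> sets borel" .
  qed
qed

section \<open>Sigma-compact subgroups\<close>

definition sigma_compact :: "'g::topological_space set \<Rightarrow> bool" where
  "sigma_compact S \<longleftrightarrow> (\<exists>K::nat \<Rightarrow> 'g set. (\<forall>n. compact (K n)) \<and> S = (\<Union>n. K n))"

lemma sigma_compact_compact: "compact K \<Longrightarrow> sigma_compact K"
  unfolding sigma_compact_def by (rule exI[of _ "\<lambda>_. K"]) auto

lemma sigma_compact_countable_Union:
  assumes "countable A" "\<And>i. i \<in> A \<Longrightarrow> sigma_compact (S i)"
  shows "sigma_compact (\<Union>i\<in>A. S i)"
proof (cases "A = {}")
  case True then show ?thesis using sigma_compact_compact[of "{}"] by simp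
next
  case False
  obtain K where K: "\<And>i n. i \<in> A \<Longrightarrow> compact (K i n)" "\<And>i. i \<in> A \<Longrightarrow> S i = (\<Union>n::nat. K i n)"
    using assms(2) unfolding sigma_compact_def by metis
  let ?f = "\<lambda>k. case prod_decode k of (i, n) \<Rightarrow> K (from_nat_into A i) n"
  have "\<forall>k. compact (?f k)" using False K by (auto simp: from_nat_into split: prod.split)
  moreover have "(\<Union>i\<in>A. S i) = (\<Union>k. ?f k)"
  proof (intro equalityI subsetI)
    fix x assume "x \<in> (\<Union>i\<in>A. S i)"
    then obtain i n where "i \<in> A" "x \<in> K i n" using K by auto
    then have "x \<in> ?f (prod_encode (to_nat_on A i, n))" using assms(1) by simp
    then show "x \<in> (\<Union>k. ?f k)" by (rule UN_I[OF UNIV_I])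
  next
    fix x assume "x \<in> (\<Union>k. ?f k)"
    then obtain k where "x \<in> ?f k" by (rule UN_E)
    then obtain i n where "x \<in> K (from_nat_into A i) n" by (cases "prod_decode k") auto
    then show "x \<in> (\<Union>i\<in>A. S i)" using from_nat_into[OF False, of i] K(2)[OF from_nat_into[OF False, of i]]
      by (intro UN_I[of "from_nat_into A i"]) (simp, blast)
  qed
  ultimately show ?thesis unfolding sigma_compact_def by (intro exI[of _ ?f] conjI)
qed

lemma sigma_compact_Un: "sigma_compact S \<Longrightarrow> sigma_compact T \<Longrightarrow> sigma_compact (S \<union> T)"
  using sigma_compact_countable_Union[of "{S, T}" id] by auto

lemma sigma_compact_plus:
  fixes S T :: "'g::topological_group_add set"
  assumes "sigma_compact S" "sigma_compact T"
  shows "sigma_compact ((\<lambda>(x,y). x + y) ` (S \<times> T))"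
proof -
  obtain K L where K: "\<And>n::nat. compact (K n)" "S = (\<Union>n. K n)" and L: "\<And>n::nat. compact (L n)" "T = (\<Union>n. L n)"
    using assms unfolding sigma_compact_def by metis
  have "(\<lambda>(x,y). x + y) ` (S \<times> T) = (\<Union>(m,n)\<in>UNIV. (\<lambda>(x,y). x + y) ` (K m \<times> L n))"
    unfolding K L by force
  also have "sigma_compact \<dots>"
    by (intro sigma_compact_countable_Union) (auto intro!: sigma_compact_compact compact_plus K L)
  finally show ?thesis .
qed

lemma sigma_compact_neg:
  fixes S :: "'g::topological_group_add set"
  assumes "sigma_compact S" shows "sigma_compact (uminus ` S)"
proof -
  obtain K where K: "\<And>n::nat. compact (K n)" "S = (\<Union>n. K n)"
    using assms unfolding sigma_compact_def by metis
  have "uminus ` S = (\<Union>n. uminus ` K n)" unfolding K by auto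
  also have "sigma_compact \<dots>"
    by (intro sigma_compact_countable_Union) (auto intro!: sigma_compact_compact compact_neg K)
  finally show ?thesis .
qed

lemma sigma_compact_borel:
  fixes S :: "'g::t2_space set"
  assumes "sigma_compact S" shows "S \<in> sets borel"
proof -
  obtain K where K: "\<And>n::nat. compact (K n)" "S = (\<Union>n. K n)"
    using assms unfolding sigma_compact_def by metis
  show ?thesis unfolding K(2) 
    by (intro sets.countable_UN image_subsetI borel_closed compact_imp_closed K)
qed

definition sc_subgroup :: "'g::topological_group_add set \<Rightarrow> bool" where
  "sc_subgroup H \<longleftrightarrow> sigma_compact H \<and> 0 \<in> H \<and> (\<forall>x\<in>H. \<forall>y\<in>H. x + y \<in> H) \<and> (\<forall>x\<in>H. - x \<in> H)"

text \<open>
  Adjoin \<open>0\<close> and all inverses and take sums \<open>T + T\<close> repeatedly.  The sets increase since they contain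
  \<open>0\<close>, and they stay symmetric, so their union is a subgroup.
\<close>
lemma sc_subgroup_generated:
  fixes S :: "'g::topological_group_add set"
  assumes "sigma_compact S"
  obtains H where "sc_subgroup H" "S \<subseteq> H"
proof -
  define T where "T = rec_nat (insert 0 (S \<union> uminus ` S)) (\<lambda>_ X. (\<lambda>(x,y). x + y) ` (X \<times> X))"
  have T0: "T 0 = insert 0 (S \<union> uminus ` S)" by (simp add: T_def)
  have TS: "T (Suc n) = (\<lambda>(x,y). x + y) ` (T n \<times> T n)" for n by (simp add: T_def)
  have sc: "sigma_compact (T n)" for n
  proof (induction n)
    case 0
    have "sigma_compact ({0} \<union> (S \<union> uminus ` S))"
      by (intro sigma_compact_Un sigma_compact_neg assms sigma_compact_compact) auto
    then show ?case by (simp add: T0)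
  qed (auto simp only: TS intro: sigma_compact_plus)
  have z: "0 \<in> T n" for n 
  proof (induction n)
    case (Suc n)
    then show ?case unfolding TS by (intro image_eqI[of _ _ "(0,0)"]) auto
  qed (simp add: T0)
  have inc: "T n \<subseteq> T (Suc n)" for n
  proof
    fix x assume "x \<in> T n"
    then show "x \<in> T (Suc n)" unfolding TS by (intro image_eqI[of _ _ "(0,x)"]) (auto simp: z)
  qed
  then have mono: "m \<le> n \<Longrightarrow> T m \<subseteq> T n" for m n by (rule lift_Suc_mono_le)
  have neg: "x \<in> T n \<Longrightarrow> - x \<in> T n" for x n
  proof (induction n arbitrary: x)
    case (Suc n)
    then obtain y z where yz: "x = y + z" "y \<in> T n" "z \<in> T n" unfolding TS by auto
    then have "- x = (\<lambda>(x,y). x + y) (- z, - y)" by (simp add: minus_add)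
    then show ?case unfolding TS using yz Suc.IH by blast
  qed (auto simp: T0)
  show ?thesis
  proof (rule that[of "\<Union>n. T n"])
    show "S \<subseteq> (\<Union>n. T n)" using T0 by auto
    have add: "x + y \<in> (\<Union>n. T n)" if xy: "x \<in> T m" "y \<in> T n" for x y m n
    proof -
      have "x \<in> T (max m n)" "y \<in> T (max m n)" using mono[of m "max m n"] mono[of n "max m n"] xy by auto
      then have "(\<lambda>(x,y). x + y) (x, y) \<in> T (Suc (max m n))" unfolding TS by (intro imageI) simp
      then show ?thesis by (intro UN_I[of "Suc (max m n)"]) simp_all
    qed
    have "sigma_compact (\<Union>n. T n)" by (intro sigma_compact_countable_Union sc) auto
    moreover have "0 \<in> (\<Union>n. T n)" using z by (intro UN_I[of 0]) auto
    moreover have "\<forall>x\<in>(\<Union>n. T n). - x \<in> (\<Union>n. T n)"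
    proof
      fix x assume "x \<in> (\<Union>n. T n)"
      then obtain n where "x \<in> T n" by (rule UN_E)
      then show "- x \<in> (\<Union>n. T n)" by (intro UN_I[of n] neg) auto
    qed
    moreover have "\<forall>x\<in>(\<Union>n. T n). \<forall>y\<in>(\<Union>n. T n). x + y \<in> (\<Union>n. T n)"
      by (intro ballI, elim UN_E) (rule add)
    ultimately show "sc_subgroup (\<Union>n. T n)" unfolding sc_subgroup_def by (intro conjI)
  qed
qed

section \<open>Haar measure\<close>

locale haar_group =
  fixes \<mu> :: "'g::{topological_group_add,t2_space} measure"
  assumes lc: "locally compact (UNIV :: 'g set)" and haar: "left_haar_measure \<mu>"
begin

lemma sets_mu [simp, measurable_cong]: "sets \<mu> = sets borel"
  using haar by (simp add: left_haar_measure_def)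

lemma space_mu [simp]: "space \<mu> = UNIV"
  using sets_eq_imp_space_eq[OF sets_mu] by simp

lemma measurable_mu_iff [simp]: "borel_measurable \<mu> = borel_measurable borel"
  by (rule measurable_cong_sets) simp_all

lemma compact_finite: "compact K \<Longrightarrow> emeasure \<mu> K < \<infinity>"
  using haar by (simp add: left_haar_measure_def)

lemma inner_regular_open: "open U \<Longrightarrow> emeasure \<mu> U = (SUP K\<in>{K. compact K \<and> K \<subseteq> U}. emeasure \<mu> K)"
  using haar unfolding left_haar_measure_def by blast

lemma outer_regular: "A \<in> sets borel \<Longrightarrow> emeasure \<mu> A = (INF U\<in>{U. open U \<and> A \<subseteq> U}. emeasure \<mu> U)"
  using haar unfolding left_haar_measure_def by blast

lemma outer_regularE:
  assumes "A \<in> sets borel" "emeasure \<mu> A < t"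
  obtains U where "open U" "A \<subseteq> U" "emeasure \<mu> U < t"
  using assms(2) unfolding outer_regular[OF assms(1)] INF_less_iff using that by auto

lemma inner_regularE:
  assumes "open U" "t < emeasure \<mu> U"
  obtains K where "compact K" "K \<subseteq> U" "t < emeasure \<mu> K"
  using assms(2) unfolding inner_regular_open[OF assms(1)] less_SUP_iff using that by auto

lemma compact_borel: "compact (K :: 'g set) \<Longrightarrow> K \<in> sets borel"
  by (intro borel_closed compact_imp_closed)

lemma measurable_left_translation [measurable]: "(\<lambda>y. x + y :: 'g) \<in> borel_measurable borel"
  by (intro borel_measurable_continuous_onI continuous_intros)

lemma measurable_right_translation [measurable]: "(\<lambda>y. y + x :: 'g) \<in> borel_measurable borel"
  by (intro borel_measurable_continuous_onI continuous_intros)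

lemma measurable_neg [measurable]: "(uminus :: 'g \<Rightarrow> 'g) \<in> borel_measurable borel"
  by (intro borel_measurable_continuous_onI continuous_on_neg continuous_intros)

lemma emeasure_translate:
  assumes "A \<in> sets borel" shows "emeasure \<mu> ((\<lambda>y. x + y) -` A) = emeasure \<mu> A"
proof -
  have "(\<lambda>y. x + y) -` A = (\<lambda>y. - x + y) ` A"
    by (auto simp: image_iff) (metis minus_add_cancel)
  then show ?thesis using haar assms unfolding left_haar_measure_def by simp
qed

lemma distr_translate: "distr \<mu> borel (\<lambda>y. x + y) = \<mu>"
  by (rule measure_eqI) (auto simp: emeasure_distr emeasure_translate)

lemma nn_integral_translate:
  assumes [measurable]: "f \<in> borel_measurable borel"
  shows "(\<integral>\<^sup>+y. f (x + y) \<partial>\<mu>) = (\<integral>\<^sup>+y. f y \<partial>\<mu>)"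
proof -
  have "(\<integral>\<^sup>+y. f y \<partial>\<mu>) = (\<integral>\<^sup>+y. f y \<partial>(distr \<mu> borel (\<lambda>y. x + y)))" by (simp add: distr_translate)
  also have "\<dots> = (\<integral>\<^sup>+y. f (x + y) \<partial>\<mu>)" by (rule nn_integral_distr) auto
  finally show ?thesis by simp
qed

lemma integral_translate:
  fixes f :: "'g \<Rightarrow> complex"
  assumes [measurable]: "f \<in> borel_measurable borel"
  shows "(LINT y|\<mu>. f (x + y)) = (LINT y|\<mu>. f y)"
proof -
  have "(LINT y|\<mu>. f y) = (LINT y|distr \<mu> borel (\<lambda>y. x + y). f y)" by (simp add: distr_translate)
  also have "\<dots> = (LINT y|\<mu>. f (x + y))" by (rule integral_distr) auto
  finally show ?thesis by simp
qed

lemma integrable_translate: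
  fixes f :: "'g \<Rightarrow> complex"
  assumes "integrable \<mu> f" shows "integrable \<mu> (\<lambda>y. f (x + y))"
proof -
  have [measurable]: "f \<in> borel_measurable borel" using borel_measurable_integrable[OF assms] by simp
  have "integrable (distr \<mu> borel (\<lambda>y. x + y)) f" using assms by (simp add: distr_translate)
  then show ?thesis by (subst (asm) integrable_distr_eq) auto
qed

text \<open>
  Finitely many translates of a nonempty open set cover a given compact set.  If the open set were
  null, then so would be all compact sets, and hence the group by inner regularity.
\<close>
lemma open_pos:
  assumes U: "open U" "U \<noteq> {}" shows "emeasure \<mu> U \<noteq> 0"
proof
  assume z: "emeasure \<mu> U = 0"
  obtain u where u: "u \<in> U" using U by auto
  have K0: "emeasure \<mu> K = 0" if K: "compact K" for K
  proof -
    let ?T = "\<lambda>k. (\<lambda>y. u - k + y) -` U"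
    have op: "open (?T k)" for k using U(1) by (intro open_vimage continuous_intros)
    have "K \<subseteq> \<Union>(?T ` K)" using u by auto
    with K obtain D where D: "D \<subseteq> ?T ` K" "finite D" "K \<subseteq> \<Union>D"
      by (rule compactE[of K "?T ` K"]) (use op in auto)
    then have "\<And>d. d \<in> D \<Longrightarrow> d \<in> null_sets \<mu>"
      using op z U by (auto simp: null_sets_def emeasure_translate)
    then have "\<Union>D \<in> null_sets \<mu>" using D(2) null_sets_UN'[of D "\<lambda>x. x" \<mu>] 
      by (simp add: countable_finite)
    then show ?thesis using D(3) K by (metis compact_borel null_sets_subset null_setsD1 sets_mu)
  qed
  have "emeasure \<mu> UNIV = (SUP K\<in>{K. compact K \<and> K \<subseteq> UNIV}. emeasure \<mu> K)"
    by (intro inner_regular_open) simp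
  also have "\<dots> = 0" using K0 by (intro antisym SUP_least) auto
  finally show False using haar unfolding left_haar_measure_def by blast
qed

text \<open>
  A subgroup that contains a neighbourhood of \<open>0\<close> contains a translate of it around each of its
  points.
\<close>
lemma open_sc_subgroup:
  obtains H :: "'g set" where "sc_subgroup H" "open H"
proof -
  obtain U C :: "'g set" where U: "open U" "compact C" "0 \<in> U" "U \<subseteq> C"
    using compact_neighbourhood[OF lc open_UNIV UNIV_I, of 0] by metis
  obtain H where H: "sc_subgroup H" "C \<subseteq> H"
    using sc_subgroup_generated[OF sigma_compact_compact[OF U(2)]] by metis
  have "open H"
  proof (subst open_subopen, intro ballI)
    fix x assume x: "x \<in> H"
    have "(\<lambda>y. - x + y) -` U \<subseteq> H"
    proof
      fix y assume "y \<in> (\<lambda>y. - x + y) -` U"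
      then have "- x + y \<in> H" using U H by auto
      then have "x + (- x + y) \<in> H" using H x unfolding sc_subgroup_def by blast
      then show "y \<in> H" by (simp add: add.assoc[symmetric])
    qed
    moreover have "open ((\<lambda>y. - x + y) -` U)" using U by (intro open_vimage continuous_intros)
    moreover have "x \<in> (\<lambda>y. - x + y) -` U" using U by simp
    ultimately show "\<exists>T. open T \<and> x \<in> T \<and> T \<subseteq> H" by blast
  qed
  then show ?thesis using that H by blast
qed

abbreviation coset :: "'g set \<Rightarrow> 'g \<Rightarrow> 'g set" where "coset H x \<equiv> (\<lambda>h. x + h) ` H"

lemma coset_iff: "y \<in> coset H x \<longleftrightarrow> - x + y \<in> H"
  by (auto simp: image_iff add.assoc[symmetric] intro!: bexI[of _ "- x + y"])

lemma coset_eq: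
  assumes H: "sc_subgroup H" shows "coset H x = coset H y \<longleftrightarrow> - x + y \<in> H"
proof
  assume "coset H x = coset H y"
  moreover have "y \<in> coset H y" using H by (simp add: coset_iff sc_subgroup_def)
  ultimately show "- x + y \<in> H" by (simp add: coset_iff[symmetric])
next
  assume xy: "- x + y \<in> H"
  have "- x + z \<in> H \<longleftrightarrow> - y + z \<in> H" for z
  proof
    assume "- x + z \<in> H"
    then have "- (- x + y) + (- x + z) \<in> H" using xy H unfolding sc_subgroup_def by blast
    then show "- y + z \<in> H" by (simp add: minus_add add.assoc)
  next
    assume "- y + z \<in> H"
    then have "(- x + y) + (- y + z) \<in> H" using xy H unfolding sc_subgroup_def by blast
    then show "- x + z \<in> H" by (simp add: add.assoc)
  qed
  then show "coset H x = coset H y" by (intro set_eqI) (simp only: coset_iff)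
qed

lemma self_in_coset: "sc_subgroup H \<Longrightarrow> x \<in> coset H x"
  unfolding coset_iff by (simp add: sc_subgroup_def)

text \<open>
  The cosets of an open subgroup are open.  Hence a coset that meets \<open>B\<close> meets an open set
  \<open>U \<supseteq> B\<close> of finite measure in a set of positive measure, and a finite measure has room for only
  countably many disjoint sets of positive measure.
\<close>
lemma countably_many_cosets:
  assumes H: "sc_subgroup H" "open H" and B: "B \<in> sets borel" "emeasure \<mu> B < \<infinity>"
  shows "countable (coset H ` B)"
proof -
  obtain U where U: "open U" "B \<subseteq> U" "emeasure \<mu> U < \<infinity>" using outer_regularE[OF B] by metis
  have opc: "open (coset H -` X)" for X
  proof -
    have "coset H -` X = (\<Union>x\<in>coset H -` X. (\<lambda>y. - x + y) -` H)"
    proof (intro equalityI subsetI)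
      fix x assume "x \<in> coset H -` X"
      then show "x \<in> (\<Union>x\<in>coset H -` X. (\<lambda>y. - x + y) -` H)"
        using H(1) by (intro UN_I[of x]) (auto simp: sc_subgroup_def)
    next
      fix y assume "y \<in> (\<Union>x\<in>coset H -` X. (\<lambda>y. - x + y) -` H)"
      then obtain x where "coset H x \<in> X" "- x + y \<in> H" by auto
      then show "y \<in> coset H -` X" using coset_eq[OF H(1), of x y] by simp
    qed
    also have "open \<dots>" using H(2) by (intro open_UN ballI open_vimage continuous_intros)
    finally show ?thesis .
  qed
  \<comment> \<open>The measure \<open>?N\<close> on the set of cosets charges a coset by its part in \<open>U\<close>; a finite measure has
    only countably many atoms.\<close>
  let ?M = "density \<mu> (indicator U)"
  let ?N = "distr ?M (count_space UNIV) (coset H)"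
  have meas: "coset H \<in> measurable ?M (count_space UNIV)"
    using opc by (intro measurableI) (auto intro!: borel_open)
  have em: "emeasure ?N {c} = emeasure \<mu> (U \<inter> coset H -` {c})" for c
  proof -
    have A: "coset H -` {c} \<in> sets borel" by (intro borel_open opc)
    have "emeasure ?N {c} = emeasure ?M (coset H -` {c})" by (simp add: emeasure_distr[OF meas])
    also have "\<dots> = (\<integral>\<^sup>+x. indicator U x * indicator (coset H -` {c}) x \<partial>\<mu>)"
      using U(1) A by (intro emeasure_density) auto
    also have "\<dots> = (\<integral>\<^sup>+x. indicator (U \<inter> coset H -` {c}) x \<partial>\<mu>)"
      by (simp only: indicator_inter_arith)
    also have "\<dots> = emeasure \<mu> (U \<inter> coset H -` {c})"
      using U(1) A by (intro nn_integral_indicator) auto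
    finally show ?thesis .
  qed
  have "emeasure ?M UNIV = emeasure \<mu> U" using U(1) by (simp add: emeasure_density)
  then interpret M: finite_measure ?M using U(3) by (intro finite_measureI) simp
  interpret N: finite_measure ?N by (rule M.finite_measure_distr[OF meas])
  have "countable {c. measure ?N {c} \<noteq> 0}" by (rule N.countable_support)
  moreover have "coset H ` B \<subseteq> {c. measure ?N {c} \<noteq> 0}"
  proof (intro subsetI)
    fix c assume "c \<in> coset H ` B"
    then obtain x where x: "x \<in> B" "c = coset H x" by auto
    have "x \<in> U \<inter> coset H -` {c}" using x U by auto
    then have "emeasure ?N {c} \<noteq> 0" unfolding em using U(1) opc by (intro open_pos open_Int) blast+
    then show "c \<in> {c. measure ?N {c} \<noteq> 0}" by (simp add: N.emeasure_eq_measure)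
  qed
  ultimately show ?thesis by (rule countable_subset[rotated])
qed

text \<open>
  This allows the conditions in \<^const>\<open>locally_measurable_set\<close> and \<^const>\<open>locally_null\<close>, which are
  imposed on all sets of finite measure, to be tested on compact sets.
\<close>
lemma finite_measure_sigma_compact:
  assumes B: "B \<in> sets borel" "emeasure \<mu> B < \<infinity>"
  obtains S where "sigma_compact S" "B \<subseteq> S"
proof -
  obtain H :: "'g set" where H: "sc_subgroup H" "open H" by (rule open_sc_subgroup)
  have "sigma_compact (coset H x)" for x
  proof -
    have "coset H x = (\<lambda>(x,y). x + y) ` ({x} \<times> H)" by auto
    also have "sigma_compact \<dots>" using H by (intro sigma_compact_plus) (auto simp: sc_subgroup_def intro: sigma_compact_compact)
    finally show ?thesis .
  qed
  then have "sigma_compact (\<Union>c\<in>coset H ` B. c)"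
    by (intro sigma_compact_countable_Union countably_many_cosets[OF H B]) auto
  moreover have "B \<subseteq> (\<Union>c\<in>coset H ` B. c)"
    using self_in_coset[OF H(1)] by blast
  ultimately show ?thesis by (rule that)
qed

text \<open>
  The replacement for \<open>\<sigma>\<close>-finiteness: pieces of finite measure, of which a set of finite measure
  meets only countably many.  Let \<open>H\<close> be an open subgroup that is the union of compact sets \<open>K\<^sub>n\<close>.
  The label of \<open>x\<close> consists of the point \<open>r\<close> that represents the coset \<open>x + H\<close> and of the first \<open>n\<close>
  with \<open>- r + x \<in> K\<^sub>n\<close>.
\<close>
lemma decomposition_into_finite_pieces:
  obtains \<pi> :: "'g \<Rightarrow> 'g \<times> nat" where "\<And>i. \<pi> -` {i} \<in> sets borel" "\<And>i. emeasure \<mu> (\<pi> -` {i}) < \<infinity>"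
    "\<And>B. B \<in> sets borel \<Longrightarrow> emeasure \<mu> B < \<infinity> \<Longrightarrow> countable (\<pi> ` B)"
proof -
  obtain H :: "'g set" where H: "sc_subgroup H" "open H" by (rule open_sc_subgroup)
  obtain K where K: "\<And>n::nat. compact (K n)" "H = (\<Union>n. K n)"
    using H(1) unfolding sc_subgroup_def sigma_compact_def by metis
  define r where "r x = (SOME y. y \<in> coset H x)" for x
  have r: "r x \<in> coset H x" for x
    unfolding r_def by (rule someI[of "\<lambda>y. y \<in> coset H x", OF self_in_coset[OF H(1)]])
  have r_eq: "r y = r x" if "- r x + y \<in> H" for x y
  proof -
    have "coset H (r x) = coset H y" using that coset_eq[OF H(1)] by simp
    moreover have "coset H x = coset H (r x)" using r[of x] unfolding coset_iff coset_eq[OF H(1)] .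
    ultimately have "coset H x = coset H y" by simp
    then show ?thesis unfolding r_def by (rule arg_cong[where f = "\<lambda>c. SOME y. y \<in> c", symmetric])
  qed
  have rH: "- r x + x \<in> H" for x
  proof -
    have "- x + r x \<in> H" using r[of x] unfolding coset_iff .
    then have "- (- x + r x) \<in> H" using H(1) unfolding sc_subgroup_def by blast
    then show ?thesis by (simp add: minus_add)
  qed
  define n where "n x = (LEAST k. - r x + x \<in> K k)" for x
  have n: "- r x + x \<in> K (n x)" for x
  proof -
    have "\<exists>k. - r x + x \<in> K k" using rH[of x] unfolding K(2) by (elim UN_E) (rule exI)
    then show ?thesis unfolding n_def by (rule LeastI_ex)
  qed
  let ?P = "\<lambda>x. (r x, n x)"
  have fib: "?P -` {(s, k)} = (if s \<in> range r then (\<lambda>y. - s + y) -` (K k - (\<Union>j<k. K j)) else {})" for s k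
  proof (cases "s \<in> range r")
    case True
    then obtain x where x: "s = r x" by auto
    have "y \<in> ?P -` {(s, k)} \<longleftrightarrow> y \<in> (\<lambda>y. - s + y) -` (K k - (\<Union>j<k. K j))" for y
    proof
      assume "y \<in> ?P -` {(s, k)}"
      then have y: "r y = s" "n y = k" by auto
      then show "y \<in> (\<lambda>y. - s + y) -` (K k - (\<Union>j<k. K j))"
      proof -
        have "- s + y \<notin> K j" if "j < k" for j
          using not_less_Least[of j "\<lambda>k. - r y + y \<in> K k"] that y unfolding n_def by blast
        moreover have "- s + y \<in> K k" using n[of y] y by simp
        ultimately show ?thesis by simp
      qed
    next
      assume y: "y \<in> (\<lambda>y. - s + y) -` (K k - (\<Union>j<k. K j))"
      then have "- r x + y \<in> H" unfolding K(2) using x by (intro UN_I[of k]) auto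
      from r_eq[OF this] have ry: "r y = s" using x by simp
      have "(LEAST k. - s + y \<in> K k) = k"
      proof (rule Least_equality)
        show "- s + y \<in> K k" using y by simp
        fix j assume "- s + y \<in> K j"
        then have "\<not> j < k" using y by (metis DiffD2 UN_I lessThan_iff vimageE)
        then show "k \<le> j" by simp
      qed
      then have "n y = k" unfolding n_def ry .
      then show "y \<in> ?P -` {(s, k)}" using ry by simp
    qed
    then show ?thesis using True by auto
  qed auto
  show ?thesis
  proof (rule that[of ?P])
    fix i :: "'g \<times> nat"
    obtain s k where i: "i = (s, k)" by (cases i)
    have b: "K k - (\<Union>j<k. K j) \<in> sets borel"
      by (intro sets.Diff sets.finite_UN compact_borel K) auto
    show "?P -` {i} \<in> sets borel" unfolding i fib
      using measurable_sets[OF measurable_left_translation b, of "- s"] by auto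
    have "emeasure \<mu> (K k - (\<Union>j<k. K j)) \<le> emeasure \<mu> (K k)" 
      by (intro emeasure_mono) (auto intro!: compact_borel K)
    also have "\<dots> < \<infinity>" by (rule compact_finite[OF K(1)])
    finally show "emeasure \<mu> (?P -` {i}) < \<infinity>" unfolding i fib using emeasure_translate[OF b, of "- s"] by auto
  next
    fix B assume B: "B \<in> sets borel" "emeasure \<mu> B < \<infinity>"
    have "r ` B = (\<lambda>c. SOME y. y \<in> c) ` coset H ` B" by (auto simp: r_def image_comp)
    then have "countable (r ` B)" using countably_many_cosets[OF H B] by simp
    then have "countable (r ` B \<times> (UNIV :: nat set))" by simp
    then show "countable (?P ` B)" by (rule countable_subset[rotated]) auto
  qed
qed

lemma locally_measurable_set_iff:
  "locally_measurable_set \<mu> A \<longleftrightarrow> (\<forall>K. compact K \<longrightarrow> A \<inter> K \<in> sets borel)" (is "_ = ?R")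
proof
  assume "locally_measurable_set \<mu> A"
  then show ?R unfolding locally_measurable_set_def using compact_finite compact_borel by auto
next
  assume R: ?R
  show "locally_measurable_set \<mu> A" unfolding locally_measurable_set_def
  proof (intro ballI impI)
    fix B assume B: "B \<in> sets \<mu>" "emeasure \<mu> B < \<infinity>"
    then obtain S where "sigma_compact S" "B \<subseteq> S" using finite_measure_sigma_compact by auto
    then obtain K where K: "\<And>n::nat. compact (K n)" "B \<subseteq> (\<Union>n. K n)" by (auto simp: sigma_compact_def)
    have "A \<inter> B = (\<Union>n. A \<inter> K n) \<inter> B" using K(2) by auto
    also have "\<dots> \<in> sets \<mu>" using R K(1) B by (intro sets.Int[of "\<Union>n. A \<inter> K n"] sets.countable_UN) auto
    finally show "A \<inter> B \<in> sets \<mu>" .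
  qed
qed

lemma locally_measurable_sigma_compact:
  assumes "locally_measurable_set \<mu> A" "sigma_compact S"
  shows "A \<inter> S \<in> sets borel"
proof -
  obtain K where K: "\<And>n::nat. compact (K n)" "S = (\<Union>n. K n)" using assms(2) by (auto simp: sigma_compact_def)
  have "A \<inter> S = (\<Union>n. A \<inter> K n)" using K by auto
  also have "\<dots> \<in> sets borel" 
    using assms(1)[unfolded locally_measurable_set_iff] K(1) by (intro sets.countable_UN) auto
  finally show ?thesis .
qed

lemma locally_null_sigma_compact:
  assumes "locally_null \<mu> A" "sigma_compact S"
  shows "A \<inter> S \<in> null_sets \<mu>"
proof -
  obtain K where K: "\<And>n::nat. compact (K n)" "S = (\<Union>n. K n)" using assms(2) by (auto simp: sigma_compact_def)
  have "A \<inter> S = (\<Union>n. A \<inter> K n)" using K by auto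
  also have "\<dots> \<in> null_sets \<mu>" 
    using assms(1) K(1) compact_finite compact_borel
    by (intro null_sets_UN) (auto simp: locally_null_def locally_measurable_set_iff)
  finally show ?thesis .
qed

lemma locally_null_iff:
  "locally_null \<mu> A \<longleftrightarrow> (\<forall>K. compact K \<longrightarrow> A \<inter> K \<in> null_sets \<mu>)" (is "_ = ?R")
proof
  assume "locally_null \<mu> A"
  then show ?R using locally_null_sigma_compact sigma_compact_compact by blast
next
  assume R: ?R
  then have lm: "locally_measurable_set \<mu> A"
    unfolding locally_measurable_set_iff using null_setsD2[of _ \<mu>] by simp
  show "locally_null \<mu> A" unfolding locally_null_def
  proof (intro conjI ballI impI lm)
    fix B assume B: "B \<in> sets \<mu>" "emeasure \<mu> B < \<infinity>"
    then obtain S where "sigma_compact S" "B \<subseteq> S" using finite_measure_sigma_compact by auto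
    then obtain K where K: "\<And>n::nat. compact (K n)" "B \<subseteq> (\<Union>n. K n)" by (auto simp: sigma_compact_def)
    have "(\<Union>n. A \<inter> K n) \<in> null_sets \<mu>" using R K(1) by (intro null_sets_UN) auto
    moreover have "A \<inter> B \<subseteq> (\<Union>n. A \<inter> K n)" using K(2) by auto
    moreover have "A \<inter> B \<in> sets \<mu>" using lm B by (auto simp: locally_measurable_set_def)
    ultimately show "emeasure \<mu> (A \<inter> B) = 0" by (metis null_sets_subset null_setsD1)
  qed
qed

text \<open>
  The sets where \<open>|a| \<ge> 1/n\<close> have finite measure by Markov's inequality.
\<close>
lemma integrable_sigma_compact_support:
  fixes a :: "'g \<Rightarrow> complex"
  assumes a: "integrable \<mu> a"
  obtains S where "sigma_compact S" "\<And>x. x \<notin> S \<Longrightarrow> a x = 0"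
proof -
  have am [measurable]: "a \<in> borel_measurable borel" using borel_measurable_integrable[OF a] by simp
  let ?B = "\<lambda>n::nat. {x. inverse (Suc n) \<le> cmod (a x)}"
  have B: "?B n \<in> sets borel" for n by measurable
  have fin: "emeasure \<mu> (?B n) < \<infinity>" for n
  proof -
    have "integrable \<mu> (\<lambda>x. cmod (a x))" using a by simp
    then have "emeasure \<mu> {x\<in>space \<mu>. cmod (a x) \<ge> inverse (Suc n)} \<le> (1 / inverse (Suc n)) * (LINT x|\<mu>. cmod (a x))"
      by (rule integral_Markov_inequality) auto
    also have "\<dots> < \<infinity>" by simp
    finally show ?thesis by simp
  qed
  have "\<exists>S. sigma_compact S \<and> ?B n \<subseteq> S" for n using finite_measure_sigma_compact[OF B fin] by metis
  then obtain S where S: "\<And>n. sigma_compact (S n)" "\<And>n. ?B n \<subseteq> S n" by metis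
  show ?thesis
  proof (rule that[of "\<Union>n. S n"])
    show "sigma_compact (\<Union>n. S n)" by (intro sigma_compact_countable_Union S) auto
    fix x assume x: "x \<notin> (\<Union>n. S n)"
    show "a x = 0"
    proof (rule ccontr)
      assume "a x \<noteq> 0"
      then obtain n where "inverse (real (Suc n)) < cmod (a x)" using reals_Archimedean[of "cmod (a x)"] by auto
      then have "x \<in> ?B n" by simp
      then show False using S(2)[of n] x by blast
    qed
  qed
qed

text \<open>
  The support is chosen to be a subgroup because it is then closed under the operations in a
  convolution: integrands such as \<open>a(y) b(- y + x)\<close> vanish off \<open>H \<times> H\<close>.
\<close>
lemma common_support:
  assumes "a \<in> L1 \<mu>" "b \<in> L1 \<mu>"
  obtains H where "sc_subgroup H" "\<And>x. x \<notin> H \<Longrightarrow> a x = 0" "\<And>x. x \<notin> H \<Longrightarrow> b x = 0"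
proof -
  have i: "integrable \<mu> a" "integrable \<mu> b" using assms by (simp_all add: L1_def)
  obtain S where S: "sigma_compact S" "\<And>x. x \<notin> S \<Longrightarrow> a x = 0"
    by (rule integrable_sigma_compact_support[OF i(1)]) (rule that; assumption)
  obtain T where T: "sigma_compact T" "\<And>x. x \<notin> T \<Longrightarrow> b x = 0"
    by (rule integrable_sigma_compact_support[OF i(2)]) (rule that; assumption)
  obtain H where H: "sc_subgroup H" "S \<union> T \<subseteq> H" by (rule sc_subgroup_generated[OF sigma_compact_Un[OF S(1) T(1)]])
  show ?thesis by (rule that[OF H(1)]) (use H(2) S(2) T(2) in blast)+
qed

end

section \<open>Tonelli's theorem for Borel functions on the product space\<close>

context haar_group
begin

text \<open>
  A compact subset of the union lies in a single member of the directed family; inner regularity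
  does the rest.  The family may be uncountable, and this is what the approximation of open sets of
  \<open>G \<times> G\<close> below rests on.
\<close>
lemma emeasure_directed_Union:
  assumes ne: "\<U> \<noteq> {}" and op: "\<And>U. U \<in> \<U> \<Longrightarrow> open U"
    and dir: "\<And>A B. A \<in> \<U> \<Longrightarrow> B \<in> \<U> \<Longrightarrow> \<exists>C\<in>\<U>. A \<union> B \<subseteq> C"
  shows "emeasure \<mu> (\<Union>\<U>) = (SUP U\<in>\<U>. emeasure \<mu> U)"
proof (rule antisym)
  have fin: "\<exists>C\<in>\<U>. \<Union>D \<subseteq> C" if "finite D" "D \<subseteq> \<U>" for D
    using that
  proof (induction D rule: finite_induct)
    case empty then show ?case using ne by auto
  next
    case (insert A D)
    then obtain C where C: "C \<in> \<U>" "\<Union>D \<subseteq> C" by auto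
    then obtain C' where "C' \<in> \<U>" "A \<union> C \<subseteq> C'" using dir[of A C] insert by auto
    then show ?case using C by (intro bexI[of _ C']) auto
  qed
  have "open (\<Union>\<U>)" using op by auto
  then have "emeasure \<mu> (\<Union>\<U>) = (SUP K\<in>{K. compact K \<and> K \<subseteq> \<Union>\<U>}. emeasure \<mu> K)"
    by (rule inner_regular_open)
  also have "\<dots> \<le> (SUP U\<in>\<U>. emeasure \<mu> U)"
  proof (rule SUP_least)
    fix K assume "K \<in> {K. compact K \<and> K \<subseteq> \<Union>\<U>}"
    then have K: "compact K" "K \<subseteq> \<Union>\<U>" by auto
    obtain D where D: "D \<subseteq> \<U>" "finite D" "K \<subseteq> \<Union>D"
      using compactE[OF K op] by metis
    obtain C where C: "C \<in> \<U>" "\<Union>D \<subseteq> C" using fin[OF D(2,1)] by auto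
    have "emeasure \<mu> K \<le> emeasure \<mu> C"
      using C D op[OF C(1)] by (intro emeasure_mono) auto
    also have "\<dots> \<le> (SUP U\<in>\<U>. emeasure \<mu> U)" using C by (intro SUP_upper)
    finally show "emeasure \<mu> K \<le> (SUP U\<in>\<U>. emeasure \<mu> U)" .
  qed
  finally show "emeasure \<mu> (\<Union>\<U>) \<le> (SUP U\<in>\<U>. emeasure \<mu> U)" .
  show "(SUP U\<in>\<U>. emeasure \<mu> U) \<le> emeasure \<mu> (\<Union>\<U>)"
    using op by (intro SUP_least emeasure_mono) (auto intro!: borel_open)
qed

lemma open_section: "open W \<Longrightarrow> open (Pair x -` W)" "open W \<Longrightarrow> open ((\<lambda>x. (x, y)) -` W)"
  by (intro open_vimage continuous_intros; assumption)+

lemma measurable_Pair_section [measurable]: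
  "Pair x \<in> measurable borel (borel :: ('a::topological_space \<times> 'b::topological_space) measure)"
  "(\<lambda>x. (x, y)) \<in> measurable borel (borel :: ('a \<times> 'b) measure)"
  by (intro borel_measurable_continuous_onI continuous_intros)+

text \<open>
  The measure of the sections is lower semicontinuous: a compact part \<open>K\<close> of the section at \<open>x\<close>
  whose measure still exceeds \<open>q\<close> satisfies \<open>X \<times> K \<subseteq> W\<close> for a neighbourhood \<open>X\<close> of \<open>x\<close>, by the tube lemma.
\<close>
lemma open_section_measure_greater:
  fixes W :: "('g \<times> 'g) set"
  assumes W: "open W"
  shows "open {x. q < emeasure \<mu> (Pair x -` W)}"
proof (subst open_subopen, intro ballI)
  fix x assume "x \<in> {x. q < emeasure \<mu> (Pair x -` W)}"
  then have "q < emeasure \<mu> (Pair x -` W)" by simp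
  from inner_regularE[OF open_section(1)[OF W] this]
  obtain K where K: "compact K" "K \<subseteq> Pair x -` W" "q < emeasure \<mu> K" .
  have "{x} \<times> K \<subseteq> W" using K by auto
  from Elementary_Topology.tube_lemma[OF K(1) W this] obtain X where X: "x \<in> X" "open X" "X \<times> K \<subseteq> W" 
    by (elim exE conjE)
  have "q < emeasure \<mu> (Pair z -` W)" if "z \<in> X" for z
  proof -
    have "K \<subseteq> Pair z -` W" using X that by auto
    then have "emeasure \<mu> K \<le> emeasure \<mu> (Pair z -` W)" 
      by (intro emeasure_mono) (auto intro!: borel_open open_section W)
    then show ?thesis using K(3) by simp
  qed
  then show "\<exists>T. open T \<and> x \<in> T \<and> T \<subseteq> {x. q < emeasure \<mu> (Pair x -` W)}" using X by blast
qed

lemma section_measure_measurable_open: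
  fixes W :: "('g \<times> 'g) set"
  assumes "open W" shows "(\<lambda>x. emeasure \<mu> (Pair x -` W)) \<in> borel_measurable borel"
  by (rule borel_measurableI_greater) (use open_section_measure_greater[OF assms] in \<open>auto intro!: borel_open\<close>)

text \<open>
  The open set \<open>W\<close> is the union of the directed family of all finite unions of open rectangles in
  \<open>W\<close>.  For fixed \<open>q\<close>, the open set of those \<open>x\<close> at which the section of \<open>W\<close> has measure above \<open>q\<close>
  is the directed union of the corresponding sets for these finite unions, so a sequence of them
  already exhausts its measure.  The sequences for all rational \<open>q\<close> together yield countably many
  rectangles whose sections have the same measure as those of \<open>W\<close> almost everywhere.
\<close>
lemma open_set_countable_rectangles:
  fixes W :: "('g \<times> 'g) set"
  assumes W: "open W" "W \<subseteq> U0 \<times> V0" and U0: "open U0" "emeasure \<mu> U0 < \<infinity>"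
  obtains \<C> where "countable \<C>" "\<And>A B. (A, B) \<in> \<C> \<Longrightarrow> open A \<and> open B \<and> A \<times> B \<subseteq> W"
    "(\<integral>\<^sup>+x. emeasure \<mu> (Pair x -` W) \<partial>\<mu>) = (\<integral>\<^sup>+x. emeasure \<mu> (Pair x -` (\<Union>(A,B)\<in>\<C>. A \<times> B)) \<partial>\<mu>)"
proof -
  define \<F> where "\<F> = {F. finite F \<and> (\<forall>(A,B)\<in>F. open A \<and> open B \<and> A \<times> B \<subseteq> W)}"
  define R where "R \<C> = (\<Union>(A,B)\<in>\<C>. A \<times> B)" for \<C> :: "('g set \<times> 'g set) set"
  define G where "G q F = {x. q < emeasure \<mu> (Pair x -` R F)}" for q F
  have R_open: "open (R \<C>)" "R \<C> \<subseteq> W" if "\<forall>(A,B)\<in>\<C>. open A \<and> open B \<and> A \<times> B \<subseteq> W" for \<C>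
    using that unfolding R_def by (fastforce intro!: open_UN open_Times)+
  have R_mono: "R \<C> \<subseteq> R \<D>" if "\<C> \<subseteq> \<D>" for \<C> \<D> using that unfolding R_def by (rule UN_mono) simp
  have sec_mono: "emeasure \<mu> (Pair x -` A) \<le> emeasure \<mu> (Pair x -` B)" if "A \<subseteq> B" "open B" for x A B
    using that by (intro emeasure_mono) (auto intro!: borel_open open_section)
  have Fmem: "\<forall>(A,B)\<in>F. open A \<and> open B \<and> A \<times> B \<subseteq> W" if "F \<in> \<F>" for F
    using that unfolding \<F>_def mem_Collect_eq by (rule conjunct2)
  note RF = R_open(1)[OF Fmem] R_open(2)[OF Fmem]
  have cover: "{x. q < emeasure \<mu> (Pair x -` W)} = \<Union>(G q ` \<F>)" for q
  proof (intro equalityI subsetI)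
    fix x assume "x \<in> {x. q < emeasure \<mu> (Pair x -` W)}"
    then have "q < emeasure \<mu> (Pair x -` W)" by simp
    from inner_regularE[OF open_section(1)[OF W(1)] this]
    obtain K where K: "compact K" "K \<subseteq> Pair x -` W" "q < emeasure \<mu> K" .
    have "\<exists>A B. open A \<and> open B \<and> x \<in> A \<and> y \<in> B \<and> A \<times> B \<subseteq> W" if "y \<in> K" for y
    proof -
      have "(x, y) \<in> W" using K that by auto
      then show ?thesis using W(1) unfolding open_prod_def by (metis SigmaE2 mem_Sigma_iff)
    qed
    then obtain A B where AB: "\<And>y. y \<in> K \<Longrightarrow> open (A y) \<and> open (B y) \<and> x \<in> A y \<and> y \<in> B y \<and> A y \<times> B y \<subseteq> W"
      by metis
    have "K \<subseteq> \<Union>(B ` K)" "\<And>b. b \<in> B ` K \<Longrightarrow> open b" using AB by auto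
    from compactE[OF K(1) this] obtain D where D: "D \<subseteq> B ` K" "finite D" "K \<subseteq> \<Union>D" .
    obtain S where S: "S \<subseteq> K" "finite S" "D = B ` S" using finite_subset_image[OF D(2,1)] by metis
    let ?F = "(\<lambda>y. (A y, B y)) ` S"
    have F: "?F \<in> \<F>" unfolding \<F>_def using S AB by auto
    have "K \<subseteq> Pair x -` R ?F"
    proof
      fix z assume "z \<in> K"
      then obtain y where y: "y \<in> S" "z \<in> B y" using D(3) S(3) by auto
      then have "x \<in> A y" using AB[of y] S(1) by auto
      then have "(x, z) \<in> A y \<times> B y" using y by simp
      then have "(x, z) \<in> R ?F" unfolding R_def using y(1) by (intro UN_I[of "(A y, B y)"]) auto
      then show "z \<in> Pair x -` R ?F" by simp
    qed
    moreover have "open (R ?F)" by (rule RF(1)[OF F])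
    ultimately have "emeasure \<mu> K \<le> emeasure \<mu> (Pair x -` R ?F)"
      by (intro emeasure_mono) (auto intro!: borel_open open_section)
    then have "x \<in> G q ?F" using K(3) by (simp add: G_def)
    then show "x \<in> \<Union>(G q ` \<F>)" using F by blast
  next
    fix x assume "x \<in> \<Union>(G q ` \<F>)"
    then obtain F where F: "F \<in> \<F>" "q < emeasure \<mu> (Pair x -` R F)" by (auto simp: G_def)
    have "R F \<subseteq> W" by (rule RF(2)[OF F(1)])
    then show "x \<in> {x. q < emeasure \<mu> (Pair x -` W)}" using F(2) sec_mono[OF _ W(1), of "R F" x] by simp
  qed
  have Gop: "open (G q F)" if "F \<in> \<F>" for q F
    unfolding G_def by (intro open_section_measure_greater RF that)
  have "\<exists>f :: nat \<Rightarrow> ('g set \<times> 'g set) set. range f \<subseteq> \<F> \<and> emeasure \<mu> {x. q < emeasure \<mu> (Pair x -` W)} = (SUP n. emeasure \<mu> (G q (f n)))" for q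
  proof -
    have "{} \<in> \<F>" by (simp add: \<F>_def)
    then have ne: "\<F> \<noteq> {}" by auto
    have "emeasure \<mu> {x. q < emeasure \<mu> (Pair x -` W)} = (SUP U\<in>G q ` \<F>. emeasure \<mu> U)"
      unfolding cover
    proof (rule emeasure_directed_Union)
      fix A B assume "A \<in> G q ` \<F>" "B \<in> G q ` \<F>"
      then obtain F F' where F: "F \<in> \<F>" "F' \<in> \<F>" "A = G q F" "B = G q F'" by auto
      have U: "F \<union> F' \<in> \<F>" using F(1,2) by (auto simp: \<F>_def)
      have "open (R (F \<union> F'))" by (rule RF(1)[OF U])
      then have "emeasure \<mu> (Pair x -` R F) \<le> emeasure \<mu> (Pair x -` R (F \<union> F'))"
        "emeasure \<mu> (Pair x -` R F') \<le> emeasure \<mu> (Pair x -` R (F \<union> F'))" for x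
        by (intro sec_mono R_mono; simp)+
      then have "A \<union> B \<subseteq> G q (F \<union> F')" unfolding F G_def by (auto elim: less_le_trans)
      then show "\<exists>C\<in>G q ` \<F>. A \<union> B \<subseteq> C" using U by blast
    qed (use ne Gop in auto)
    also have "\<dots> = (SUP F\<in>\<F>. emeasure \<mu> (G q F))" by (simp add: image_comp)
    finally have *: "emeasure \<mu> {x. q < emeasure \<mu> (Pair x -` W)} = (SUP F\<in>\<F>. emeasure \<mu> (G q F))" .
    obtain g :: "nat \<Rightarrow> ennreal" where g: "range g \<subseteq> (\<lambda>F. emeasure \<mu> (G q F)) ` \<F>"
      "(SUP F\<in>\<F>. emeasure \<mu> (G q F)) = (SUP n. g n)"
      using ennreal_SUP_countable_SUP[OF ne, of "\<lambda>F. emeasure \<mu> (G q F)"] by auto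
    have "\<forall>n. \<exists>F\<in>\<F>. g n = emeasure \<mu> (G q F)" using g(1) by auto
    then obtain f where f: "\<And>n. f n \<in> \<F>" "\<And>n. g n = emeasure \<mu> (G q (f n))" by metis
    then show ?thesis using * g(2) by (intro exI[of _ f]) auto
  qed
  then obtain f :: "rat \<Rightarrow> nat \<Rightarrow> ('g set \<times> 'g set) set" where f: "\<And>q n. f q n \<in> \<F>"
    "\<And>q. emeasure \<mu> {x. ennreal (real_of_rat q) < emeasure \<mu> (Pair x -` W)} = (SUP n. emeasure \<mu> (G (ennreal (real_of_rat q)) (f q n)))"
    by (metis range_subsetD)
  define \<C> where "\<C> = (\<Union>(q,n)\<in>UNIV. f q n)"
  have C: "\<forall>(A,B)\<in>\<C>. open A \<and> open B \<and> A \<times> B \<subseteq> W"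
    unfolding \<C>_def using Fmem[OF f(1)] by blast
  have cnt: "countable \<C>" unfolding \<C>_def
    using f(1) by (intro countable_UN) (auto simp: \<F>_def countable_finite)
  note RC = R_open[OF C]
  have ae: "AE x in \<mu>. emeasure \<mu> (Pair x -` W) = emeasure \<mu> (Pair x -` R \<C>)"
  proof -
    let ?D = "\<lambda>q. {x. ennreal (real_of_rat q) < emeasure \<mu> (Pair x -` W)}"
    let ?E = "\<lambda>q. {x. ennreal (real_of_rat q) < emeasure \<mu> (Pair x -` R \<C>)}"
    have "?D q - ?E q \<in> null_sets \<mu>" for q
    proof -
      have oD: "open (?D q)" and oE: "open (?E q)" by (intro open_section_measure_greater W RC)+
      have sub: "?E q \<subseteq> ?D q" using sec_mono[OF RC(2) W(1)] by (auto elim: less_le_trans)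
      have "emeasure \<mu> (?D q) \<le> emeasure \<mu> (?E q)" unfolding f(2)
      proof (rule SUP_least)
        fix n
        have "f q n \<subseteq> \<C>" unfolding \<C>_def by auto
        then have "emeasure \<mu> (Pair x -` R (f q n)) \<le> emeasure \<mu> (Pair x -` R \<C>)" for x
          by (intro sec_mono R_mono RC)
        then have "G (ennreal (real_of_rat q)) (f q n) \<subseteq> ?E q" unfolding G_def by (auto elim: less_le_trans)
        then show "emeasure \<mu> (G (ennreal (real_of_rat q)) (f q n)) \<le> emeasure \<mu> (?E q)"
          by (intro emeasure_mono) (use oE in auto)
      qed
      moreover have "?D q \<subseteq> U0"
      proof
        fix x assume "x \<in> ?D q"
        then have "Pair x -` W \<noteq> {}" by (intro notI) simp
        then show "x \<in> U0" using W(2) by auto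
      qed
      then have "emeasure \<mu> (?D q) \<le> emeasure \<mu> U0" by (intro emeasure_mono) (use U0 in auto)
      then have "emeasure \<mu> (?D q) < \<infinity>" using U0(2) by simp
      moreover have "emeasure \<mu> (?E q) \<le> emeasure \<mu> (?D q)" by (intro emeasure_mono sub) (use oD in auto)
      \<comment> \<open>The bound by \<open>U0\<close> makes the two measures finite, so that they may be subtracted.\<close>
      ultimately have "emeasure \<mu> (?D q - ?E q) = 0"
        by (subst emeasure_Diff) (use oD oE sub in \<open>auto simp: less_top\<close>)
      then show ?thesis using oD oE by (auto intro!: null_setsI borel_open)
    qed
    then have "(\<Union>q. ?D q - ?E q) \<in> null_sets \<mu>" by (rule null_sets_UN)
    then show ?thesis
    proof (rule AE_I')
      show "{x \<in> space \<mu>. emeasure \<mu> (Pair x -` W) \<noteq> emeasure \<mu> (Pair x -` R \<C>)} \<subseteq> (\<Union>q. ?D q - ?E q)"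
      proof
        fix x assume "x \<in> {x \<in> space \<mu>. emeasure \<mu> (Pair x -` W) \<noteq> emeasure \<mu> (Pair x -` R \<C>)}"
        then have "emeasure \<mu> (Pair x -` R \<C>) < emeasure \<mu> (Pair x -` W)"
          using sec_mono[OF RC(2) W(1), of x] by (auto simp: less_le)
        from ennreal_rat_dense[OF this] obtain q where "emeasure \<mu> (Pair x -` R \<C>) < ennreal (real_of_rat q)" 
          "ennreal (real_of_rat q) < emeasure \<mu> (Pair x -` W)" by auto
        then show "x \<in> (\<Union>q. ?D q - ?E q)" by (intro UN_I[of q]) auto
      qed
    qed
  qed
  show ?thesis
  proof (rule that[OF cnt])
    show "open A \<and> open B \<and> A \<times> B \<subseteq> W" if "(A, B) \<in> \<C>" for A B
      using bspec[OF C that] by simp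
    show "(\<integral>\<^sup>+x. emeasure \<mu> (Pair x -` W) \<partial>\<mu>) = (\<integral>\<^sup>+x. emeasure \<mu> (Pair x -` (\<Union>(A,B)\<in>\<C>. A \<times> B)) \<partial>\<mu>)"
      using ae unfolding R_def by (rule nn_integral_cong_AE)
  qed
qed

text \<open>
  A countable union of open rectangles is measurable with respect to the product \<open>\<sigma>\<close>-algebra, so
  Tonelli's theorem for the restrictions of \<open>\<mu>\<close> to \<open>U0\<close> and \<open>V0\<close>, which are finite measures,
  applies.
\<close>
lemma tonelli_rectangles:
  assumes cnt: "countable \<C>" and C: "\<And>A B. (A, B) \<in> \<C> \<Longrightarrow> open A \<and> open B"
    and sub: "(\<Union>(A,B)\<in>\<C>. A \<times> B) \<subseteq> U0 \<times> V0"
    and U0: "open U0" "emeasure \<mu> U0 < \<infinity>" and V0: "open V0" "emeasure \<mu> V0 < \<infinity>"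
  defines "Q \<equiv> \<Union>(A,B)\<in>\<C>. A \<times> B"
  shows "(\<integral>\<^sup>+x. emeasure \<mu> (Pair x -` Q) \<partial>\<mu>) = (\<integral>\<^sup>+y. emeasure \<mu> ((\<lambda>x. (x, y)) -` Q) \<partial>\<mu>)"
proof -
  let ?M = "density \<mu> (indicator U0)" and ?N = "density \<mu> (indicator V0)"
  have emr: "emeasure (density \<mu> (indicator T)) A = emeasure \<mu> A" if "A \<subseteq> T" "T \<in> sets borel" "A \<in> sets borel" for A T
  proof -
    have "emeasure (density \<mu> (indicator T)) A = (\<integral>\<^sup>+x. indicator T x * indicator A x \<partial>\<mu>)"
      using that by (intro emeasure_density) auto
    also have "\<dots> = (\<integral>\<^sup>+x. indicator A x \<partial>\<mu>)" using that by (intro nn_integral_cong) (auto simp: indicator_def)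
    finally show ?thesis using that by simp
  qed
  have nnr: "(\<integral>\<^sup>+x. f x \<partial>(density \<mu> (indicator T))) = (\<integral>\<^sup>+x. f x \<partial>\<mu>)" 
    if "T \<in> sets borel" "f \<in> borel_measurable borel" "\<And>x. x \<notin> T \<Longrightarrow> f x = 0" for f T
    using that by (subst nn_integral_density) (auto intro!: nn_integral_cong simp: indicator_def)
  have "emeasure ?M UNIV = emeasure \<mu> U0" "emeasure ?N UNIV = emeasure \<mu> V0"
    using U0(1) V0(1) by (simp_all add: emeasure_density)
  then interpret M: finite_measure ?M + N: finite_measure ?N 
    using U0(2) V0(2) by (auto intro!: finite_measureI)
  interpret pair_sigma_finite ?M ?N by unfold_locales
  have oQ: "open Q" unfolding Q_def using C by (fastforce intro!: open_UN open_Times)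
  have QMN: "Q \<in> sets (?M \<Otimes>\<^sub>M ?N)" unfolding Q_def
    using C cnt by (intro sets.countable_UN') (auto intro!: pair_measureI borel_open)
  have s1: "Pair x -` Q \<subseteq> V0" and s2: "(\<lambda>x. (x, y)) -` Q \<subseteq> U0" for x y using sub unfolding Q_def by auto
  have s3: "Pair x -` Q = {}" if "x \<notin> U0" for x using that sub unfolding Q_def by auto
  have s4: "(\<lambda>x. (x, y)) -` Q = {}" if "y \<notin> V0" for y using that sub unfolding Q_def by auto
  have m1: "(\<lambda>x. emeasure \<mu> (Pair x -` Q)) \<in> borel_measurable borel"
    by (rule section_measure_measurable_open[OF oQ])
  have "open (prod.swap -` Q)" using oQ by (intro open_vimage) (auto simp: prod.swap_def intro!: continuous_intros)
  from section_measure_measurable_open[OF this]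
  have m2: "(\<lambda>y. emeasure \<mu> ((\<lambda>x. (x, y)) -` Q)) \<in> borel_measurable borel" 
    by (simp add: vimage_comp o_def)
  have "(\<integral>\<^sup>+x. emeasure \<mu> (Pair x -` Q) \<partial>\<mu>) = (\<integral>\<^sup>+x. emeasure \<mu> (Pair x -` Q) \<partial>?M)"
    using U0(1) m1 s3 by (intro nnr[symmetric]) auto
  also have "\<dots> = (\<integral>\<^sup>+x. emeasure ?N (Pair x -` Q) \<partial>?M)"
    using s1 V0(1) oQ by (intro nn_integral_cong emr[symmetric]) (auto intro!: borel_open open_section)
  also have "\<dots> = emeasure (?M \<Otimes>\<^sub>M ?N) Q" using N.emeasure_pair_measure_alt[OF QMN] by simp
  also have "\<dots> = (\<integral>\<^sup>+y. emeasure ?M ((\<lambda>x. (x, y)) -` Q) \<partial>?N)" by (rule emeasure_pair_measure_alt2[OF QMN])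
  also have "\<dots> = (\<integral>\<^sup>+y. emeasure \<mu> ((\<lambda>x. (x, y)) -` Q) \<partial>?N)"
    using s2 U0(1) oQ by (intro nn_integral_cong emr) (auto intro!: borel_open open_section)
  also have "\<dots> = (\<integral>\<^sup>+y. emeasure \<mu> ((\<lambda>x. (x, y)) -` Q) \<partial>\<mu>)"
    using V0(1) m2 s4 by (intro nnr) auto
  finally show ?thesis .
qed

lemma open_swap:
  fixes W :: "('a::topological_space \<times> 'b::topological_space) set"
  assumes "open W" shows "open (prod.swap -` W)"
  using assms by (intro open_vimage) (auto simp: prod.swap_def intro!: continuous_intros)

text \<open>
  The rectangles found for the sections of \<open>W\<close> in one direction and those found for the other
  direction are put together: enlarging a family within \<open>W\<close> keeps the approximation.
\<close>
lemma tonelli_open: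
  assumes W: "open W" "W \<subseteq> U0 \<times> V0"
    and U0: "open U0" "emeasure \<mu> U0 < \<infinity>" and V0: "open V0" "emeasure \<mu> V0 < \<infinity>"
  shows "(\<integral>\<^sup>+x. emeasure \<mu> (Pair x -` W) \<partial>\<mu>) = (\<integral>\<^sup>+y. emeasure \<mu> ((\<lambda>x. (x, y)) -` W) \<partial>\<mu>)"
proof -
  obtain \<C>1 where c1: "countable \<C>1" "\<And>A B. (A, B) \<in> \<C>1 \<Longrightarrow> open A \<and> open B \<and> A \<times> B \<subseteq> W"
    "(\<integral>\<^sup>+x. emeasure \<mu> (Pair x -` W) \<partial>\<mu>) = (\<integral>\<^sup>+x. emeasure \<mu> (Pair x -` (\<Union>(A,B)\<in>\<C>1. A \<times> B)) \<partial>\<mu>)"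
    by (rule open_set_countable_rectangles[OF W U0]) (rule that; assumption)
  let ?W = "prod.swap -` W"
  have sw: "open ?W" "?W \<subseteq> V0 \<times> U0" using W open_swap by auto
  obtain \<C>2 where c2: "countable \<C>2" "\<And>A B. (A, B) \<in> \<C>2 \<Longrightarrow> open A \<and> open B \<and> A \<times> B \<subseteq> ?W"
    "(\<integral>\<^sup>+x. emeasure \<mu> (Pair x -` ?W) \<partial>\<mu>) = (\<integral>\<^sup>+x. emeasure \<mu> (Pair x -` (\<Union>(A,B)\<in>\<C>2. A \<times> B)) \<partial>\<mu>)"
    by (rule open_set_countable_rectangles[OF sw V0]) (rule that; assumption)
  let ?C = "\<C>1 \<union> prod.swap ` \<C>2"
  let ?Q = "\<Union>(A,B)\<in>?C. A \<times> B"
  have C: "open A \<and> open B \<and> A \<times> B \<subseteq> W" if "(A, B) \<in> ?C" for A B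
    using that
  proof
    assume "(A, B) \<in> prod.swap ` \<C>2"
    then have "(B, A) \<in> \<C>2" by auto
    from c2(2)[OF this] show ?thesis by auto
  qed (rule c1(2))
  have QW: "?Q \<subseteq> W"
  proof
    fix z assume "z \<in> ?Q"
    then obtain P where "P \<in> ?C" "z \<in> (case P of (A, B) \<Rightarrow> A \<times> B)" by (rule UN_E)
    then show "z \<in> W" using C[of "fst P" "snd P"] by (cases P) auto
  qed
  have oQ: "open ?Q" using C by (fastforce intro!: open_UN open_Times)
  have secQ: "Pair x -` ?Q \<in> sets \<mu>" "(\<lambda>x. (x, y)) -` ?Q \<in> sets \<mu>" for x y
    unfolding sets_mu by (intro borel_open open_section oQ)+
  have "(\<integral>\<^sup>+x. emeasure \<mu> (Pair x -` W) \<partial>\<mu>) \<le> (\<integral>\<^sup>+x. emeasure \<mu> (Pair x -` ?Q) \<partial>\<mu>)"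
    unfolding c1(3) by (intro nn_integral_mono emeasure_mono vimage_mono UN_mono secQ) auto
  moreover have "(\<integral>\<^sup>+x. emeasure \<mu> (Pair x -` ?Q) \<partial>\<mu>) \<le> (\<integral>\<^sup>+x. emeasure \<mu> (Pair x -` W) \<partial>\<mu>)"
    by (intro nn_integral_mono emeasure_mono vimage_mono QW) (use W(1) in \<open>auto intro!: borel_open open_section\<close>)
  ultimately have e1: "(\<integral>\<^sup>+x. emeasure \<mu> (Pair x -` W) \<partial>\<mu>) = (\<integral>\<^sup>+x. emeasure \<mu> (Pair x -` ?Q) \<partial>\<mu>)" by (rule antisym)
  have "(\<integral>\<^sup>+x. emeasure \<mu> (Pair x -` ?W) \<partial>\<mu>) \<le> (\<integral>\<^sup>+y. emeasure \<mu> ((\<lambda>x. (x, y)) -` ?Q) \<partial>\<mu>)"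
    unfolding c2(3)
  proof (intro nn_integral_mono emeasure_mono subsetI)
    fix y x assume "x \<in> Pair y -` (\<Union>(A,B)\<in>\<C>2. A \<times> B)"
    then obtain A B where "(A, B) \<in> \<C>2" "y \<in> A" "x \<in> B" by auto
    then show "x \<in> (\<lambda>x. (x, y)) -` ?Q" by force
  qed (rule secQ)
  moreover have "(\<integral>\<^sup>+y. emeasure \<mu> ((\<lambda>x. (x, y)) -` ?Q) \<partial>\<mu>) \<le> (\<integral>\<^sup>+y. emeasure \<mu> ((\<lambda>x. (x, y)) -` W) \<partial>\<mu>)"
    by (intro nn_integral_mono emeasure_mono vimage_mono QW) (use W(1) in \<open>auto intro!: borel_open open_section\<close>)
  moreover have "Pair y -` ?W = (\<lambda>x. (x, y)) -` W" for y by auto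
  ultimately have e2: "(\<integral>\<^sup>+y. emeasure \<mu> ((\<lambda>x. (x, y)) -` W) \<partial>\<mu>) = (\<integral>\<^sup>+y. emeasure \<mu> ((\<lambda>x. (x, y)) -` ?Q) \<partial>\<mu>)"
    by (intro antisym) simp_all
  show ?thesis unfolding e1 e2
    by (rule tonelli_rectangles[OF _ _ order_trans[OF QW W(2)] U0 V0])
      (use c1(1) c2(1) in simp, use C in blast)
qed

text \<open>
  The open sets are stable under intersection and generate the Borel sets.  The finite measure of
  \<open>U0\<close> and \<open>V0\<close> is needed for complements, where the measures of sections are subtracted.
\<close>
lemma tonelli_borel_set:
  fixes W :: "('g \<times> 'g) set"
  assumes W: "W \<in> sets borel"
    and U0: "open U0" "emeasure \<mu> U0 < \<infinity>" and V0: "open V0" "emeasure \<mu> V0 < \<infinity>"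
  shows "(\<lambda>x. emeasure \<mu> (Pair x -` (W \<inter> U0 \<times> V0))) \<in> borel_measurable borel \<and>
    (\<lambda>y. emeasure \<mu> ((\<lambda>x. (x, y)) -` (W \<inter> U0 \<times> V0))) \<in> borel_measurable borel \<and>
    (\<integral>\<^sup>+x. emeasure \<mu> (Pair x -` (W \<inter> U0 \<times> V0)) \<partial>\<mu>) = (\<integral>\<^sup>+y. emeasure \<mu> ((\<lambda>x. (x, y)) -` (W \<inter> U0 \<times> V0)) \<partial>\<mu>)"
    (is "?P W")
proof -
  let ?R = "U0 \<times> V0"
  let ?f = "\<lambda>W x. emeasure \<mu> (Pair x -` (W \<inter> ?R))" and ?g = "\<lambda>W y. emeasure \<mu> ((\<lambda>x. (x, y)) -` (W \<inter> ?R))"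
  have oR: "open ?R" using U0 V0 by (intro open_Times)
  have Wb: "W \<in> sigma_sets UNIV {S. open S}" if "W \<in> sets borel" for W :: "('g \<times> 'g) set" 
    using that unfolding borel_def by simp
  have Wb': "W \<in> sets borel" if "W \<in> sigma_sets UNIV {S. open S}" for W :: "('g \<times> 'g) set"
    using that unfolding borel_def by simp
  have sec: "Pair x -` (W \<inter> ?R) \<in> sets borel" "(\<lambda>x. (x, y)) -` (W \<inter> ?R) \<in> sets borel" if "W \<in> sets borel" for W x y
    using measurable_sets[OF measurable_Pair_section(1), of "W \<inter> ?R" x] 
      measurable_sets[OF measurable_Pair_section(2), of "W \<inter> ?R" y] that oR
    by (auto intro: borel_open sets.Int)
  have fle: "?f W x \<le> emeasure \<mu> V0 * indicator U0 x" and gle: "?g W x \<le> emeasure \<mu> U0 * indicator V0 x" for W x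
    using U0 V0 by (auto simp: indicator_def vimage_def intro!: emeasure_mono)
  have top: "?f W x < \<infinity>" "?g W x < \<infinity>" for W x
    using order.strict_trans1[OF fle] order.strict_trans1[OF gle] U0 V0 
    by (auto simp: indicator_def ennreal_mult_less_top)
  have itop: "(\<integral>\<^sup>+x. ?f W x \<partial>\<mu>) \<noteq> \<infinity>" for W
  proof -
    have "(\<integral>\<^sup>+x. ?f W x \<partial>\<mu>) \<le> (\<integral>\<^sup>+x. emeasure \<mu> V0 * indicator U0 x \<partial>\<mu>)" by (intro nn_integral_mono fle)
    also have "\<dots> = emeasure \<mu> V0 * emeasure \<mu> U0" using U0(1) by (intro nn_integral_cmult_indicator) auto
    also have "\<dots> < \<infinity>" using U0 V0 by (simp add: ennreal_mult_less_top)
    finally show ?thesis by simp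
  qed
  have itop': "(\<integral>\<^sup>+x. ?g W x \<partial>\<mu>) \<noteq> \<infinity>" for W
  proof -
    have "(\<integral>\<^sup>+x. ?g W x \<partial>\<mu>) \<le> (\<integral>\<^sup>+x. emeasure \<mu> U0 * indicator V0 x \<partial>\<mu>)" by (intro nn_integral_mono gle)
    also have "\<dots> = emeasure \<mu> U0 * emeasure \<mu> V0" using V0(1) by (intro nn_integral_cmult_indicator) auto
    also have "\<dots> < \<infinity>" using U0 V0 by (simp add: ennreal_mult_less_top)
    finally show ?thesis by simp
  qed
  have opn: "?P W" if o: "open W" for W
  proof -
    have oWR: "open (W \<inter> ?R)" using o oR by auto
    have "Pair y -` (prod.swap -` (W \<inter> ?R)) = (\<lambda>x. (x, y)) -` (W \<inter> ?R)" for y by auto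
    then show ?thesis
      using section_measure_measurable_open[OF oWR] section_measure_measurable_open[OF open_swap[OF oWR]]
        tonelli_open[OF oWR _ U0 V0] by simp
  qed
  have "Int_stable {S :: ('g \<times> 'g) set. open S}" by (auto simp: Int_stable_def)
  moreover have "{S :: ('g \<times> 'g) set. open S} \<subseteq> Pow UNIV" by simp
  ultimately show ?thesis using Wb[OF W]
  proof (induction rule: sigma_sets_induct_disjoint)
    case (basic A) then show ?case using opn by blast
  next
    case empty show ?case by simp
  next
    case (compl A)
    have A: "A \<in> sets borel" by (rule Wb'[OF compl(1)])
    have f: "?f (UNIV - A) x = ?f UNIV x - ?f A x" for x
    proof -
      have "Pair x -` ((UNIV - A) \<inter> ?R) = Pair x -` (UNIV \<inter> ?R) - Pair x -` (A \<inter> ?R)" by auto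
      also have "emeasure \<mu> \<dots> = ?f UNIV x - ?f A x"
      proof (rule emeasure_Diff)
        show "?f A x \<noteq> \<infinity>" using top(1)[where W = A and x = x] by (rule less_imp_neq)
        show "Pair x -` (UNIV \<inter> ?R) \<in> sets \<mu>" "Pair x -` (A \<inter> ?R) \<in> sets \<mu>"
          unfolding sets_mu by (intro sec A borel_open open_UNIV)+
      qed auto
      finally show ?thesis .
    qed
    have g: "?g (UNIV - A) x = ?g UNIV x - ?g A x" for x
    proof -
      have "(\<lambda>z. (z, x)) -` ((UNIV - A) \<inter> ?R) = (\<lambda>z. (z, x)) -` (UNIV \<inter> ?R) - (\<lambda>z. (z, x)) -` (A \<inter> ?R)" by auto
      also have "emeasure \<mu> \<dots> = ?g UNIV x - ?g A x"
      proof (rule emeasure_Diff)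
        show "?g A x \<noteq> \<infinity>" using top(2)[where W = A and x = x] by (rule less_imp_neq)
        show "(\<lambda>z. (z, x)) -` (UNIV \<inter> ?R) \<in> sets \<mu>" "(\<lambda>z. (z, x)) -` (A \<inter> ?R) \<in> sets \<mu>"
          unfolding sets_mu by (intro sec A borel_open open_UNIV)+
      qed auto
      finally show ?thesis .
    qed
    have U: "?P UNIV" by (rule opn) simp
    have fA [measurable]: "?f A \<in> borel_measurable borel" "?g A \<in> borel_measurable borel" using compl(2) by auto
    have fU [measurable]: "?f UNIV \<in> borel_measurable borel" "?g UNIV \<in> borel_measurable borel" using U by auto
    have le: "?f A x \<le> ?f UNIV x" "?g A x \<le> ?g UNIV x" for x
      by (intro emeasure_mono; use sec[of UNIV] in auto)+
    have "(\<integral>\<^sup>+x. ?f UNIV x - ?f A x \<partial>\<mu>) = (\<integral>\<^sup>+x. ?f UNIV x \<partial>\<mu>) - (\<integral>\<^sup>+x. ?f A x \<partial>\<mu>)"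
      by (rule nn_integral_diff[OF _ _ itop AE_I2]) (unfold measurable_mu_iff, (rule fA fU le)+)
    moreover have "(\<integral>\<^sup>+x. ?g UNIV x - ?g A x \<partial>\<mu>) = (\<integral>\<^sup>+x. ?g UNIV x \<partial>\<mu>) - (\<integral>\<^sup>+x. ?g A x \<partial>\<mu>)"
      by (rule nn_integral_diff[OF _ _ itop' AE_I2]) (unfold measurable_mu_iff, (rule fA fU le)+)
    ultimately have "(\<integral>\<^sup>+x. ?f UNIV x - ?f A x \<partial>\<mu>) = (\<integral>\<^sup>+x. ?g UNIV x - ?g A x \<partial>\<mu>)" using U compl(2) by simp
    then show ?case unfolding f g using fA fU by (intro conjI borel_measurable_minus_ennreal)
  next
    case (union A)
    have A: "A i \<in> sets borel" for i using union(2) Wb' by auto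
    have f: "?f (\<Union>i. A i) x = (\<Sum>i. ?f (A i) x)" for x
    proof -
      have "Pair x -` ((\<Union>i. A i) \<inter> ?R) = (\<Union>i. Pair x -` (A i \<inter> ?R))" by auto
      also have "emeasure \<mu> \<dots> = (\<Sum>i. ?f (A i) x)"
      proof (rule suminf_emeasure[symmetric])
        show "range (\<lambda>i. Pair x -` (A i \<inter> ?R)) \<subseteq> sets \<mu>" by (intro image_subsetI) (simp only: sets_mu sec A)
        show "disjoint_family (\<lambda>i. Pair x -` (A i \<inter> ?R))" using union(1) unfolding disjoint_family_on_def by fast
      qed
      finally show ?thesis .
    qed
    have g: "?g (\<Union>i. A i) x = (\<Sum>i. ?g (A i) x)" for x
    proof -
      have "(\<lambda>z. (z, x)) -` ((\<Union>i. A i) \<inter> ?R) = (\<Union>i. (\<lambda>z. (z, x)) -` (A i \<inter> ?R))" by auto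
      also have "emeasure \<mu> \<dots> = (\<Sum>i. ?g (A i) x)"
      proof (rule suminf_emeasure[symmetric])
        show "range (\<lambda>i. (\<lambda>z. (z, x)) -` (A i \<inter> ?R)) \<subseteq> sets \<mu>" by (intro image_subsetI) (simp only: sets_mu sec A)
        show "disjoint_family (\<lambda>i. (\<lambda>z. (z, x)) -` (A i \<inter> ?R))" using union(1) unfolding disjoint_family_on_def by fast
      qed
      finally show ?thesis .
    qed
    have [measurable]: "?f (A i) \<in> borel_measurable borel" "?g (A i) \<in> borel_measurable borel" for i 
      using union(3)[of i] by auto
    have "(\<integral>\<^sup>+x. (\<Sum>i. ?f (A i) x) \<partial>\<mu>) = (\<integral>\<^sup>+x. (\<Sum>i. ?g (A i) x) \<partial>\<mu>)"
      using union(3) by (subst (1 2) nn_integral_suminf) auto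
    moreover have "(\<lambda>x. \<Sum>i. ?f (A i) x) \<in> borel_measurable borel" "(\<lambda>x. \<Sum>i. ?g (A i) x) \<in> borel_measurable borel"
      by measurable
    ultimately show ?case unfolding f g by (intro conjI)
  qed
qed

lemma tonelli_finite:
  fixes h :: "'g \<times> 'g \<Rightarrow> ennreal"
  assumes h: "h \<in> borel_measurable borel"
    and U0: "open U0" "emeasure \<mu> U0 < \<infinity>" and V0: "open V0" "emeasure \<mu> V0 < \<infinity>"
  shows "(\<lambda>x. \<integral>\<^sup>+y. h (x, y) * indicator (U0 \<times> V0) (x, y) \<partial>\<mu>) \<in> borel_measurable borel \<and>
    (\<lambda>y. \<integral>\<^sup>+x. h (x, y) * indicator (U0 \<times> V0) (x, y) \<partial>\<mu>) \<in> borel_measurable borel \<and>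
    (\<integral>\<^sup>+x. \<integral>\<^sup>+y. h (x, y) * indicator (U0 \<times> V0) (x, y) \<partial>\<mu> \<partial>\<mu>) =
    (\<integral>\<^sup>+y. \<integral>\<^sup>+x. h (x, y) * indicator (U0 \<times> V0) (x, y) \<partial>\<mu> \<partial>\<mu>)"
  (is "?P h")
proof -
  let ?R = "U0 \<times> V0"
  let ?f = "\<lambda>h x. \<integral>\<^sup>+y. h (x, y) * indicator ?R (x, y) \<partial>\<mu>"
  let ?g = "\<lambda>h y. \<integral>\<^sup>+x. h (x, y) * indicator ?R (x, y) \<partial>\<mu>"
  have R [measurable]: "?R \<in> sets borel" using U0 V0 by (intro borel_open open_Times)
  show ?thesis using h
  proof (induction rule: borel_measurable_induct)
    case (cong f g)
    then have "f = g" by auto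
    then show ?case using cong by simp
  next
    case (set A)
    have b: "Pair x -` (A \<inter> ?R) \<in> sets borel" "(\<lambda>x. (x, y)) -` (A \<inter> ?R) \<in> sets borel" for x y
      using measurable_sets[OF measurable_Pair_section(1), of "A \<inter> ?R" x] 
        measurable_sets[OF measurable_Pair_section(2), of "A \<inter> ?R" y] set R by auto
    have f: "?f (indicator A) x = emeasure \<mu> (Pair x -` (A \<inter> ?R))" for x
    proof -
      have "?f (indicator A) x = (\<integral>\<^sup>+y. indicator (Pair x -` (A \<inter> ?R)) y \<partial>\<mu>)"
        by (intro nn_integral_cong) (auto simp: indicator_def)
      also have "\<dots> = emeasure \<mu> (Pair x -` (A \<inter> ?R))" by (rule nn_integral_indicator) (simp only: sets_mu b)
      finally show ?thesis .
    qed
    have g: "?g (indicator A) y = emeasure \<mu> ((\<lambda>x. (x, y)) -` (A \<inter> ?R))" for y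
    proof -
      have "?g (indicator A) y = (\<integral>\<^sup>+x. indicator ((\<lambda>x. (x, y)) -` (A \<inter> ?R)) x \<partial>\<mu>)"
        by (intro nn_integral_cong) (auto simp: indicator_def)
      also have "\<dots> = emeasure \<mu> ((\<lambda>x. (x, y)) -` (A \<inter> ?R))" by (rule nn_integral_indicator) (simp only: sets_mu b)
      finally show ?thesis .
    qed
    show ?case unfolding f g by (rule tonelli_borel_set[OF set U0 V0])
  next
    case (mult u c)
    note [measurable] = mult.hyps(2)
    have "?f (\<lambda>x. c * u x) = (\<lambda>x. c * ?f u x)" "?g (\<lambda>x. c * u x) = (\<lambda>x. c * ?g u x)"
      by (auto simp: mult.assoc nn_integral_cmult)
    then show ?case using mult.IH by (auto simp: nn_integral_cmult)
  next
    case (add u v)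
    note [measurable] = add.hyps(1,3)
    have "?f (\<lambda>x. v x + u x) = (\<lambda>x. ?f v x + ?f u x)" "?g (\<lambda>x. v x + u x) = (\<lambda>x. ?g v x + ?g u x)"
      by (auto simp: distrib_right nn_integral_add)
    then show ?case using add.IH by (auto simp: nn_integral_add)
  next
    case (seq U)
    note [measurable] = seq.hyps(1)
    have inc: "incseq (\<lambda>i. U i (x, y) * indicator ?R (x, y))" for x y
      using seq.hyps(3) by (auto simp: incseq_def le_fun_def intro!: mult_right_mono)
    have f: "?f (SUP i. U i) = (\<lambda>x. SUP i. ?f (U i) x)" 
    proof
      fix x
      have "?f (SUP i. U i) x = (\<integral>\<^sup>+y. (SUP i. U i (x, y) * indicator ?R (x, y)) \<partial>\<mu>)"
        by (simp add: SUP_mult_right_ennreal image_comp)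
      also have "\<dots> = (SUP i. ?f (U i) x)"
        using inc by (intro nn_integral_monotone_convergence_SUP) (auto simp: incseq_def le_fun_def)
      finally show "?f (SUP i. U i) x = (SUP i. ?f (U i) x)" .
    qed
    have g: "?g (SUP i. U i) = (\<lambda>y. SUP i. ?g (U i) y)" 
    proof
      fix y
      have "?g (SUP i. U i) y = (\<integral>\<^sup>+x. (SUP i. U i (x, y) * indicator ?R (x, y)) \<partial>\<mu>)"
        by (simp add: SUP_mult_right_ennreal image_comp)
      also have "\<dots> = (SUP i. ?g (U i) y)"
        using inc by (intro nn_integral_monotone_convergence_SUP) (auto simp: incseq_def le_fun_def)
      finally show "?g (SUP i. U i) y = (SUP i. ?g (U i) y)" .
    qed
    have m [measurable]: "?f (U i) \<in> borel_measurable borel" "?g (U i) \<in> borel_measurable borel" for i using seq.IH by auto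
    have "incseq (\<lambda>i. ?f (U i))" "incseq (\<lambda>i. ?g (U i))"
      using inc unfolding incseq_def le_fun_def by (intro allI impI nn_integral_mono; blast)+
    note mc = this[THEN nn_integral_monotone_convergence_SUP]
    have "(\<integral>\<^sup>+x. (SUP i. ?f (U i) x) \<partial>\<mu>) = (SUP i. \<integral>\<^sup>+x. ?f (U i) x \<partial>\<mu>)"
      by (rule mc(1)) (unfold measurable_mu_iff, rule m)
    also have "\<dots> = (SUP i. \<integral>\<^sup>+x. ?g (U i) x \<partial>\<mu>)"
      by (intro SUP_cong refl) (rule conjunct2[OF conjunct2[OF seq.IH]])
    also have "\<dots> = (\<integral>\<^sup>+x. (SUP i. ?g (U i) x) \<partial>\<mu>)"
      by (rule mc(2)[symmetric]) (unfold measurable_mu_iff, rule m)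
    finally have eq: "(\<integral>\<^sup>+x. (SUP i. ?f (U i) x) \<partial>\<mu>) = (\<integral>\<^sup>+x. (SUP i. ?g (U i) x) \<partial>\<mu>)" .
    have "(\<lambda>x. SUP i. ?f (U i) x) \<in> borel_measurable borel" "(\<lambda>x. SUP i. ?g (U i) x) \<in> borel_measurable borel"
      by measurable
    then show ?case unfolding f g using eq by (intro conjI)
  qed
qed

text \<open>
  Monotone convergence along increasing open sets of finite measure whose union contains \<open>H\<close>.
\<close>
theorem tonelli:
  fixes h :: "'g \<times> 'g \<Rightarrow> ennreal"
  assumes h: "h \<in> borel_measurable borel" and H: "sigma_compact H" "\<forall>x y. (x, y) \<notin> H \<times> H \<longrightarrow> h (x, y) = 0"
  shows "(\<lambda>x. \<integral>\<^sup>+y. h (x, y) \<partial>\<mu>) \<in> borel_measurable borel" (is ?m1)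
    and "(\<lambda>y. \<integral>\<^sup>+x. h (x, y) \<partial>\<mu>) \<in> borel_measurable borel" (is ?m2)
    and "(\<integral>\<^sup>+x. \<integral>\<^sup>+y. h (x, y) \<partial>\<mu> \<partial>\<mu>) = (\<integral>\<^sup>+y. \<integral>\<^sup>+x. h (x, y) \<partial>\<mu> \<partial>\<mu>)" (is ?e)
proof -
  obtain K where K: "\<And>n::nat. compact (K n)" "H = (\<Union>n. K n)" using H(1) by (auto simp: sigma_compact_def)
  have "\<exists>U. open U \<and> K n \<subseteq> U \<and> emeasure \<mu> U < \<infinity>" for n
    using outer_regularE[OF compact_borel[OF K(1)] compact_finite[OF K(1)]] by metis
  then obtain B where B: "\<And>n. open (B n)" "\<And>n. K n \<subseteq> B n" "\<And>n. emeasure \<mu> (B n) < \<infinity>" by metis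
  define U where "U n = (\<Union>i\<le>n. B i)" for n
  have U: "open (U n)" "emeasure \<mu> (U n) < \<infinity>" for n
  proof -
    show "open (U n)" unfolding U_def using B by auto
    have "emeasure \<mu> (U n) \<le> (\<Sum>i\<le>n. emeasure \<mu> (B i))" unfolding U_def
      by (rule emeasure_subadditive_finite) (auto intro!: borel_open B)
    also have "\<dots> < \<infinity>" using B(3) by simp
    finally show "emeasure \<mu> (U n) < \<infinity>" .
  qed
  have Umono: "m \<le> n \<Longrightarrow> U m \<subseteq> U n" for m n unfolding U_def by (intro UN_mono) auto
  let ?h = "\<lambda>n z. h z * indicator (U n \<times> U n) z"
  note [measurable] = h
  have [measurable]: "U n \<times> U n \<in> sets borel" for n using U by (intro borel_open open_Times)
  have inc: "incseq (\<lambda>n. ?h n z)" for z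
    unfolding incseq_def
  proof (intro allI impI)
    fix m n :: nat assume "m \<le> n"
    then have "U m \<times> U m \<subseteq> U n \<times> U n" by (intro Sigma_mono Umono)
    then show "?h m z \<le> ?h n z" by (auto split: split_indicator)
  qed
  have sup: "h z = (SUP n. ?h n z)" for z
  proof (cases "z \<in> H \<times> H")
    case True
    then obtain i j where ij: "fst z \<in> K i" "snd z \<in> K j" unfolding K(2) by auto
    have KU: "K n \<subseteq> U n" for n unfolding U_def using B(2)[of n] by (rule order_trans) (rule UN_upper, simp)
    have "fst z \<in> U (max i j)" using ij(1) KU[of i] Umono[of i "max i j"] by auto
    moreover have "snd z \<in> U (max i j)" using ij(2) KU[of j] Umono[of j "max i j"] by auto
    ultimately have "z \<in> U (max i j) \<times> U (max i j)" by (simp add: mem_Times_iff)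
    then have "h z = ?h (max i j) z" by simp
    also have "\<dots> \<le> (SUP n. ?h n z)" by (rule SUP_upper) simp
    finally have "h z \<le> (SUP n. ?h n z)" .
    moreover have "(SUP n. ?h n z) \<le> h z" by (intro SUP_least) (auto split: split_indicator)
    ultimately show ?thesis by (rule antisym)
  next
    case False
    then have "h z = 0" using H(2)[rule_format, of "fst z" "snd z"] by (simp add: mem_Times_iff)
    then show ?thesis by simp
  qed
  note T = tonelli_finite[OF h U U]
  have hm: "(\<lambda>y. ?h n (x, y)) \<in> borel_measurable \<mu>" "(\<lambda>y. ?h n (y, x)) \<in> borel_measurable \<mu>" for n x
    by measurable
  have f: "(\<integral>\<^sup>+y. h (x, y) \<partial>\<mu>) = (SUP n. \<integral>\<^sup>+y. ?h n (x, y) \<partial>\<mu>)" for x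
  proof -
    have "(\<integral>\<^sup>+y. h (x, y) \<partial>\<mu>) = (\<integral>\<^sup>+y. (SUP n. ?h n (x, y)) \<partial>\<mu>)" by (rule nn_integral_cong) (rule sup)
    also have "\<dots> = (SUP n. \<integral>\<^sup>+y. ?h n (x, y) \<partial>\<mu>)"
      using inc unfolding incseq_def by (intro nn_integral_monotone_convergence_SUP hm) (unfold incseq_def le_fun_def, blast)
    finally show ?thesis .
  qed
  have g: "(\<integral>\<^sup>+x. h (x, y) \<partial>\<mu>) = (SUP n. \<integral>\<^sup>+x. ?h n (x, y) \<partial>\<mu>)" for y
  proof -
    have "(\<integral>\<^sup>+x. h (x, y) \<partial>\<mu>) = (\<integral>\<^sup>+x. (SUP n. ?h n (x, y)) \<partial>\<mu>)" by (rule nn_integral_cong) (rule sup)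
    also have "\<dots> = (SUP n. \<integral>\<^sup>+x. ?h n (x, y) \<partial>\<mu>)"
      using inc unfolding incseq_def by (intro nn_integral_monotone_convergence_SUP hm) (unfold incseq_def le_fun_def, blast)
    finally show ?thesis .
  qed
  have fm [measurable]: "(\<lambda>x. \<integral>\<^sup>+y. ?h n (x, y) \<partial>\<mu>) \<in> borel_measurable borel" 
    "(\<lambda>y. \<integral>\<^sup>+x. ?h n (x, y) \<partial>\<mu>) \<in> borel_measurable borel" for n using T[of n n] by auto
  show ?m1 unfolding f by measurable
  show ?m2 unfolding g by measurable
  have "incseq (\<lambda>n x. \<integral>\<^sup>+y. ?h n (x, y) \<partial>\<mu>)" "incseq (\<lambda>n y. \<integral>\<^sup>+x. ?h n (x, y) \<partial>\<mu>)"
    using inc unfolding incseq_def le_fun_def by (intro allI impI nn_integral_mono; blast)+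
  note mc = this[THEN nn_integral_monotone_convergence_SUP]
  have "(\<integral>\<^sup>+x. \<integral>\<^sup>+y. h (x, y) \<partial>\<mu> \<partial>\<mu>) = (\<integral>\<^sup>+x. (SUP n. \<integral>\<^sup>+y. ?h n (x, y) \<partial>\<mu>) \<partial>\<mu>)"
    by (rule nn_integral_cong) (rule f)
  also have "\<dots> = (SUP n. \<integral>\<^sup>+x. \<integral>\<^sup>+y. ?h n (x, y) \<partial>\<mu> \<partial>\<mu>)"
    by (rule mc(1)) (unfold measurable_mu_iff, rule fm)
  also have "\<dots> = (SUP n. \<integral>\<^sup>+y. \<integral>\<^sup>+x. ?h n (x, y) \<partial>\<mu> \<partial>\<mu>)"
    by (intro SUP_cong refl) (rule conjunct2[OF conjunct2[OF T]])
  also have "\<dots> = (\<integral>\<^sup>+y. (SUP n. \<integral>\<^sup>+x. ?h n (x, y) \<partial>\<mu>) \<partial>\<mu>)"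
    by (rule mc(2)[symmetric]) (unfold measurable_mu_iff, rule fm)
  also have "\<dots> = (\<integral>\<^sup>+y. \<integral>\<^sup>+x. h (x, y) \<partial>\<mu> \<partial>\<mu>)"
    by (rule nn_integral_cong) (rule g[symmetric])
  finally show ?e .
qed

end

section \<open>Fubini's theorem and convolution\<close>

context haar_group
begin

lemma fubini_nonneg:
  fixes p :: "'g \<times> 'g \<Rightarrow> real"
  assumes p: "p \<in> borel_measurable borel" "\<And>z. 0 \<le> p z"
    and H: "sigma_compact H" "\<forall>x y. (x, y) \<notin> H \<times> H \<longrightarrow> p (x, y) = 0"
    and fin: "(\<integral>\<^sup>+x. \<integral>\<^sup>+y. ennreal (p (x, y)) \<partial>\<mu> \<partial>\<mu>) < \<infinity>"
  shows "integrable \<mu> (\<lambda>x. LINT y|\<mu>. p (x, y))" "integrable \<mu> (\<lambda>y. LINT x|\<mu>. p (x, y))"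
    "(LINT x|\<mu>. LINT y|\<mu>. p (x, y)) = (LINT y|\<mu>. LINT x|\<mu>. p (x, y))"
proof -
  have pe: "(\<lambda>z. ennreal (p z)) \<in> borel_measurable borel" using p(1) by simp
  have H': "\<forall>x y. (x, y) \<notin> H \<times> H \<longrightarrow> ennreal (p (x, y)) = 0" using H(2) by simp
  note T = tonelli[OF pe H(1) H']
  have m: "(\<lambda>y. p (x, y)) \<in> borel_measurable \<mu>" "(\<lambda>y. p (y, x)) \<in> borel_measurable \<mu>" for x
    unfolding measurable_mu_iff using p(1) by (auto intro: measurable_compose[OF measurable_Pair_section(1)] 
        measurable_compose[OF measurable_Pair_section(2)])
  have aux: "integrable \<mu> (\<lambda>x. enn2real (N x)) \<and> (LINT x|\<mu>. enn2real (N x)) = enn2real (\<integral>\<^sup>+x. N x \<partial>\<mu>)"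
    if N: "N \<in> borel_measurable borel" "(\<integral>\<^sup>+x. N x \<partial>\<mu>) < \<infinity>" for N
  proof -
    have "AE x in \<mu>. N x \<noteq> \<infinity>" using N by (intro nn_integral_noteq_infinite) auto
    then have e: "(\<integral>\<^sup>+x. ennreal (enn2real (N x)) \<partial>\<mu>) = (\<integral>\<^sup>+x. N x \<partial>\<mu>)"
      by (intro nn_integral_cong_AE) (auto simp: less_top)
    have m: "(\<lambda>x. enn2real (N x)) \<in> borel_measurable \<mu>" using N(1) by simp
    have "integrable \<mu> (\<lambda>x. enn2real (N x))" using e N(2) m by (intro integrableI_nonneg) auto
    moreover have "(LINT x|\<mu>. enn2real (N x)) = enn2real (\<integral>\<^sup>+x. N x \<partial>\<mu>)"
      unfolding e[symmetric] by (rule integral_eq_nn_integral[OF m]) simp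
    ultimately show ?thesis by blast
  qed
  have f: "(\<lambda>x. LINT y|\<mu>. p (x, y)) = (\<lambda>x. enn2real (\<integral>\<^sup>+y. ennreal (p (x, y)) \<partial>\<mu>))"
    by (intro ext integral_eq_nn_integral m) (simp add: p(2))
  have g: "(\<lambda>y. LINT x|\<mu>. p (x, y)) = (\<lambda>y. enn2real (\<integral>\<^sup>+x. ennreal (p (x, y)) \<partial>\<mu>))"
    by (intro ext integral_eq_nn_integral m) (simp add: p(2))
  have fin': "(\<integral>\<^sup>+y. \<integral>\<^sup>+x. ennreal (p (x, y)) \<partial>\<mu> \<partial>\<mu>) < \<infinity>" using fin T(3) by simp
  note A1 = aux[OF T(1) fin] and A2 = aux[OF T(2) fin']
  show "integrable \<mu> (\<lambda>x. LINT y|\<mu>. p (x, y))" unfolding f by (rule conjunct1[OF A1])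
  show "integrable \<mu> (\<lambda>y. LINT x|\<mu>. p (x, y))" unfolding g by (rule conjunct1[OF A2])
  show "(LINT x|\<mu>. LINT y|\<mu>. p (x, y)) = (LINT y|\<mu>. LINT x|\<mu>. p (x, y))"
  proof -
    have "(LINT x|\<mu>. LINT y|\<mu>. p (x, y)) = enn2real (\<integral>\<^sup>+x. \<integral>\<^sup>+y. ennreal (p (x, y)) \<partial>\<mu> \<partial>\<mu>)"
      unfolding f by (rule conjunct2[OF A1])
    also have "\<dots> = enn2real (\<integral>\<^sup>+y. \<integral>\<^sup>+x. ennreal (p (x, y)) \<partial>\<mu> \<partial>\<mu>)" by (rule arg_cong[OF T(3)])
    also have "\<dots> = (LINT y|\<mu>. LINT x|\<mu>. p (x, y))"
      unfolding g by (rule conjunct2[OF A2, symmetric])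
    finally show ?thesis .
  qed
qed

text \<open>
  The iterated integral is expressed by those of the positive and negative parts (\<open>t = 1\<close> and
  \<open>t = -1\<close>) of the real and imaginary parts of \<open>h\<close>, for which the order of integration may be
  interchanged.  Only for almost all \<open>x\<close> is \<open>h x\<close> integrable; elsewhere its integral is \<open>0\<close> by
  convention, whence the indicator function in the proof.
\<close>
lemma fubini_one_order:
  fixes h :: "'g \<Rightarrow> 'g \<Rightarrow> complex"
  assumes hx: "\<And>x. h x \<in> borel_measurable \<mu>"
    and Nm: "(\<lambda>x. \<integral>\<^sup>+y. ennreal (cmod (h x y)) \<partial>\<mu>) \<in> borel_measurable borel"
    and fin: "(\<integral>\<^sup>+x. \<integral>\<^sup>+y. ennreal (cmod (h x y)) \<partial>\<mu> \<partial>\<mu>) < \<infinity>"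
    and L: "\<forall>s\<in>{Re, Im}. \<forall>t\<in>{1, -1}. integrable \<mu> (\<lambda>x. LINT y|\<mu>. max 0 (t * s (h x y)))"
  defines "I \<equiv> \<lambda>s t. LINT x|\<mu>. LINT y|\<mu>. max 0 (t * s (h x y))"
  shows "integrable \<mu> (\<lambda>x. LINT y|\<mu>. h x y)"
    "(LINT x|\<mu>. LINT y|\<mu>. h x y) = Complex (I Re 1 - I Re (-1)) (I Im 1 - I Im (-1))"
proof -
  let ?N = "\<lambda>x. \<integral>\<^sup>+y. ennreal (cmod (h x y)) \<partial>\<mu>"
  let ?L = "\<lambda>s t x. LINT y|\<mu>. max 0 (t * s (h x y)) :: real"
  define C where "C x = complex_of_real (?L Re 1 x - ?L Re (-1) x) + \<i> * complex_of_real (?L Im 1 x - ?L Im (-1) x)" for x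
  have C: "(LINT y|\<mu>. h x y) = indicator {x. ?N x < \<infinity>} x *\<^sub>R C x" for x
  proof (cases "?N x < \<infinity>")
    case True
    then have i: "integrable \<mu> (h x)" using hx by (simp add: integrable_iff_bounded)
    have ip: "integrable \<mu> (\<lambda>y. max 0 (t * s (h x y)))" if "s \<in> {Re, Im}" for s and t :: real
      using i that by (intro integrable_max) auto
    have "(LINT y|\<mu>. s (h x y)) = ?L s 1 x - ?L s (-1) x" if "s \<in> {Re, Im}" for s
    proof -
      have "?L s 1 x - ?L s (-1) x = (LINT y|\<mu>. max 0 (1 * s (h x y)) - max 0 (-1 * s (h x y)))"
        using ip[OF that, of 1] ip[OF that, of "-1"] by simp
      also have "\<dots> = (LINT y|\<mu>. s (h x y))" by (intro Bochner_Integration.integral_cong) auto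
      finally show ?thesis by simp
    qed
    then have "C x = complex_of_real (LINT y|\<mu>. Re (h x y)) + \<i> * complex_of_real (LINT y|\<mu>. Im (h x y))"
      unfolding C_def by simp
    also have "\<dots> = (LINT y|\<mu>. h x y)" using i by (simp add: complex_eq_iff)
    finally show ?thesis using True by simp
  next
    case False
    then have "\<not> integrable \<mu> (h x)" by (simp add: integrable_iff_bounded)
    then show ?thesis using False by (simp add: not_integrable_integral_eq)
  qed
  have meas: "{x. ?N x < \<infinity>} \<in> sets \<mu>" using Nm by simp
  have iC: "integrable \<mu> C" unfolding C_def 
    by (intro Bochner_Integration.integrable_add Bochner_Integration.integrable_diff integrable_mult_right integrable_of_real L[rule_format]) auto
  show "integrable \<mu> (\<lambda>x. LINT y|\<mu>. h x y)"
    unfolding C by (rule integrable_mult_indicator[OF meas iC])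
  have ae: "AE x in \<mu>. ?N x \<noteq> \<infinity>" using Nm fin by (intro nn_integral_noteq_infinite) auto
  have "(LINT x|\<mu>. LINT y|\<mu>. h x y) = (LINT x|\<mu>. C x)"
    unfolding C
  proof (rule integral_cong_AE)
    show "(\<lambda>x. indicator {x. ?N x < \<infinity>} x *\<^sub>R C x) \<in> borel_measurable \<mu>"
      by (rule borel_measurable_integrable[OF integrable_mult_indicator[OF meas iC]])
    show "AE x in \<mu>. indicator {x. ?N x < \<infinity>} x *\<^sub>R C x = C x"
      using ae by eventually_elim (simp add: less_top)
  qed (rule borel_measurable_integrable[OF iC])
  also have "\<dots> = Complex (I Re 1 - I Re (-1)) (I Im 1 - I Im (-1))"
    unfolding C_def I_def complex_eq_iff using L iC by (simp add: integral_add)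
  finally show "(LINT x|\<mu>. LINT y|\<mu>. h x y) = Complex (I Re 1 - I Re (-1)) (I Im 1 - I Im (-1))" .
qed

theorem fubini:
  fixes h :: "'g \<times> 'g \<Rightarrow> complex"
  assumes h: "h \<in> borel_measurable borel"
    and H: "sigma_compact H" "\<forall>x y. (x, y) \<notin> H \<times> H \<longrightarrow> h (x, y) = 0"
    and fin: "(\<integral>\<^sup>+x. \<integral>\<^sup>+y. ennreal (cmod (h (x, y))) \<partial>\<mu> \<partial>\<mu>) < \<infinity>"
  shows "integrable \<mu> (\<lambda>x. LINT y|\<mu>. h (x, y))" "integrable \<mu> (\<lambda>y. LINT x|\<mu>. h (x, y))"
    "(LINT x|\<mu>. LINT y|\<mu>. h (x, y)) = (LINT y|\<mu>. LINT x|\<mu>. h (x, y))"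
proof -
  have he: "(\<lambda>z. ennreal (cmod (h z))) \<in> borel_measurable borel" using h by simp
  have H': "\<forall>x y. (x, y) \<notin> H \<times> H \<longrightarrow> ennreal (cmod (h (x, y))) = 0" using H(2) by simp
  note T = tonelli[OF he H(1) H']
  have m: "(\<lambda>y. h (x, y)) \<in> borel_measurable \<mu>" "(\<lambda>y. h (y, x)) \<in> borel_measurable \<mu>" for x
    unfolding measurable_mu_iff using h by (auto intro: measurable_compose[OF measurable_Pair_section(1)] 
        measurable_compose[OF measurable_Pair_section(2)])
  have P: "integrable \<mu> (\<lambda>x. LINT y|\<mu>. max 0 (t * s (h (x, y))))" "integrable \<mu> (\<lambda>y. LINT x|\<mu>. max 0 (t * s (h (x, y))))"
    "(LINT x|\<mu>. LINT y|\<mu>. max 0 (t * s (h (x, y)))) = (LINT y|\<mu>. LINT x|\<mu>. max 0 (t * s (h (x, y))))"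
    if s: "s \<in> {Re, Im}" and t: "t \<in> {1, -1}" for s and t :: real
  proof -
    have b: "max 0 (t * s z) \<le> cmod z" for z
      using s t abs_Re_le_cmod[of z] abs_Im_le_cmod[of z] by (auto simp: abs_le_iff)
    have pm: "(\<lambda>z. max 0 (t * s (h z))) \<in> borel_measurable borel" using s h by auto
    have p0: "0 \<le> max 0 (t * s (h z))" for z by simp
    have pH: "\<forall>x y. (x, y) \<notin> H \<times> H \<longrightarrow> max 0 (t * s (h (x, y))) = 0" using H(2) s by auto
    have "(\<integral>\<^sup>+x. \<integral>\<^sup>+y. ennreal (max 0 (t * s (h (x, y)))) \<partial>\<mu> \<partial>\<mu>) \<le> (\<integral>\<^sup>+x. \<integral>\<^sup>+y. ennreal (cmod (h (x, y))) \<partial>\<mu> \<partial>\<mu>)"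
      by (intro nn_integral_mono ennreal_leI b)
    also note fin
    finally have pf: "(\<integral>\<^sup>+x. \<integral>\<^sup>+y. ennreal (max 0 (t * s (h (x, y)))) \<partial>\<mu> \<partial>\<mu>) < \<infinity>" .
    note F = fubini_nonneg[OF pm p0 H(1) pH pf]
    show "integrable \<mu> (\<lambda>x. LINT y|\<mu>. max 0 (t * s (h (x, y))))" by (rule F(1))
    show "integrable \<mu> (\<lambda>y. LINT x|\<mu>. max 0 (t * s (h (x, y))))" by (rule F(2))
    show "(LINT x|\<mu>. LINT y|\<mu>. max 0 (t * s (h (x, y)))) = (LINT y|\<mu>. LINT x|\<mu>. max 0 (t * s (h (x, y))))"
      by (rule F(3))
  qed
  have fin': "(\<integral>\<^sup>+y. \<integral>\<^sup>+x. ennreal (cmod (h (x, y))) \<partial>\<mu> \<partial>\<mu>) < \<infinity>" using fin T(3) by simp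
  have P1: "\<forall>s\<in>{Re, Im}. \<forall>t\<in>{1, -1}. integrable \<mu> (\<lambda>x. LINT y|\<mu>. max 0 (t * s (h (x, y))))"
    and P2: "\<forall>s\<in>{Re, Im}. \<forall>t\<in>{1, -1}. integrable \<mu> (\<lambda>y. LINT x|\<mu>. max 0 (t * s (h (x, y))))"
    by (intro ballI P; assumption)+
  note A = fubini_one_order[of "\<lambda>x y. h (x, y)", OF m(1) T(1) fin P1]
  note B = fubini_one_order[of "\<lambda>y x. h (x, y)", OF m(2) T(2) fin' P2]
  show "integrable \<mu> (\<lambda>x. LINT y|\<mu>. h (x, y))" by (rule A(1))
  show "integrable \<mu> (\<lambda>y. LINT x|\<mu>. h (x, y))" by (rule B(1))
  show "(LINT x|\<mu>. LINT y|\<mu>. h (x, y)) = (LINT y|\<mu>. LINT x|\<mu>. h (x, y))"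
    by (rule trans[OF A(2) trans[OF _ B(2)[symmetric]]])
      (intro arg_cong2[where f = Complex] arg_cong2[where f = minus] P(3); simp)
qed

lemma L1_measurable: "a \<in> L1 \<mu> \<Longrightarrow> a \<in> borel_measurable borel"
  unfolding L1_def using borel_measurable_integrable[of \<mu> a] by simp

lemma L1_norm_finite: "a \<in> L1 \<mu> \<Longrightarrow> (\<integral>\<^sup>+x. ennreal (cmod (a x)) \<partial>\<mu>) = ennreal (LINT x|\<mu>. cmod (a x))"
  unfolding L1_def by (intro nn_integral_eq_integral) auto

lemma measurable_product_maps:
  fixes a :: "'g \<Rightarrow> 'c::topological_space"
  assumes a: "a \<in> borel_measurable borel"
  shows "(\<lambda>z. a (fst z :: 'g)) \<in> borel_measurable (borel :: ('g \<times> 'g) measure)"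
    "(\<lambda>z. a (snd z :: 'g)) \<in> borel_measurable (borel :: ('g \<times> 'g) measure)"
    "(\<lambda>z. a (- fst z + snd z)) \<in> borel_measurable (borel :: ('g \<times> 'g) measure)"
    "(\<lambda>z. a (fst z + snd z)) \<in> borel_measurable (borel :: ('g \<times> 'g) measure)"
  by (rule measurable_compose[OF _ a], intro borel_measurable_continuous_onI continuous_intros continuous_on_neg)+

text \<open>
  By left invariance the inner integral of \<open>|b(- y + x)|\<close> over \<open>x\<close> does not depend on \<open>y\<close>.
\<close>
lemma convolution_kernel:
  fixes f a b :: "'g \<Rightarrow> complex"
  assumes a: "a \<in> L1 \<mu>" and b: "b \<in> L1 \<mu>" and f: "f \<in> borel_measurable borel" "\<And>x. cmod (f x) \<le> c"
    and H: "sc_subgroup H" "\<And>x. x \<notin> H \<Longrightarrow> a x = 0" "\<And>x. x \<notin> H \<Longrightarrow> b x = 0"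
  defines "h \<equiv> \<lambda>z. f (snd z) * (a (fst z) * b (- fst z + snd z))"
  shows "h \<in> borel_measurable borel" "\<forall>y x. (y, x) \<notin> H \<times> H \<longrightarrow> h (y, x) = 0"
    "(\<integral>\<^sup>+y. \<integral>\<^sup>+x. ennreal (cmod (h (y, x))) \<partial>\<mu> \<partial>\<mu>) \<le> ennreal c * (ennreal (LINT x|\<mu>. cmod (a x)) * ennreal (LINT x|\<mu>. cmod (b x)))"
proof -
  note am = L1_measurable[OF a] and bm = L1_measurable[OF b]
  show "h \<in> borel_measurable borel" unfolding h_def
    by (intro borel_measurable_times measurable_product_maps f am bm)
  show "\<forall>y x. (y, x) \<notin> H \<times> H \<longrightarrow> h (y, x) = 0"
  proof (intro allI impI)
   fix y x assume that: "(y, x) \<notin> H \<times> H"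
   show "h (y, x) = 0"
   proof (cases "y \<in> H")
    case True
    have "- y + x \<notin> H"
    proof
      assume "- y + x \<in> H"
      then have "y + (- y + x) \<in> H" using True H(1) unfolding sc_subgroup_def by blast
      then show False using True that by (simp add: add.assoc[symmetric])
    qed
    then show ?thesis using H(3) by (simp add: h_def)
   qed (use H(2) in \<open>simp add: h_def\<close>)
  qed
  have c0: "0 \<le> c" using f(2)[of 0] norm_ge_zero[of "f 0"] by linarith
  have "(\<integral>\<^sup>+x. ennreal (cmod (h (y, x))) \<partial>\<mu>) \<le> ennreal c * ennreal (LINT x|\<mu>. cmod (b x)) * ennreal (cmod (a y))" for y
  proof -
    have "(\<integral>\<^sup>+x. ennreal (cmod (h (y, x))) \<partial>\<mu>) \<le> (\<integral>\<^sup>+x. ennreal (c * cmod (a y)) * ennreal (cmod (b (- y + x))) \<partial>\<mu>)"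
    proof (rule nn_integral_mono)
      fix x
      have "cmod (h (y, x)) \<le> c * cmod (a y) * cmod (b (- y + x))"
        unfolding h_def by (simp add: norm_mult mult.assoc mult_right_mono f(2))
      then show "ennreal (cmod (h (y, x))) \<le> ennreal (c * cmod (a y)) * ennreal (cmod (b (- y + x)))"
        using c0 by (simp add: ennreal_mult[symmetric] ennreal_leI)
    qed
    also have "\<dots> = ennreal (c * cmod (a y)) * (\<integral>\<^sup>+x. ennreal (cmod (b (- y + x))) \<partial>\<mu>)"
      using bm by (intro nn_integral_cmult) simp
    also have "(\<integral>\<^sup>+x. ennreal (cmod (b (- y + x))) \<partial>\<mu>) = (\<integral>\<^sup>+x. ennreal (cmod (b x)) \<partial>\<mu>)"
      using bm by (intro nn_integral_translate[of "\<lambda>x. ennreal (cmod (b x))"]) simp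
    finally show ?thesis using c0 by (simp add: L1_norm_finite[OF b] ennreal_mult mult_ac)
  qed
  then have "(\<integral>\<^sup>+y. \<integral>\<^sup>+x. ennreal (cmod (h (y, x))) \<partial>\<mu> \<partial>\<mu>) \<le>
      (\<integral>\<^sup>+y. ennreal c * ennreal (LINT x|\<mu>. cmod (b x)) * ennreal (cmod (a y)) \<partial>\<mu>)"
    by (rule nn_integral_mono)
  also have "\<dots> = ennreal c * ennreal (LINT x|\<mu>. cmod (b x)) * ennreal (LINT x|\<mu>. cmod (a x))"
    unfolding L1_norm_finite[OF a, symmetric] using am by (intro nn_integral_cmult) simp
  finally show "(\<integral>\<^sup>+y. \<integral>\<^sup>+x. ennreal (cmod (h (y, x))) \<partial>\<mu> \<partial>\<mu>) \<le> ennreal c * (ennreal (LINT x|\<mu>. cmod (a x)) * ennreal (LINT x|\<mu>. cmod (b x)))"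
    by (simp add: mult_ac)
qed

lemma sc_subgroup_sigma_compact: "sc_subgroup H \<Longrightarrow> sigma_compact H" by (simp add: sc_subgroup_def)

lemma convolution_L1:
  assumes a: "a \<in> L1 \<mu>" and b: "b \<in> L1 \<mu>"
  shows "convolution \<mu> a b \<in> L1 \<mu>"
proof -
  obtain H where H: "sc_subgroup H" "\<And>x. x \<notin> H \<Longrightarrow> a x = 0" "\<And>x. x \<notin> H \<Longrightarrow> b x = 0"
    by (rule common_support[OF a b]) (rule that; assumption)
  have one: "(\<lambda>_. 1) \<in> borel_measurable borel" "cmod 1 \<le> 1" by simp_all
  note k = convolution_kernel[OF a b one H(1,2,3), unfolded mult_1 ennreal_1]
  have k1: "(\<lambda>z. a (fst z) * b (- fst z + snd z)) \<in> borel_measurable borel" by (rule k(1))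
  have k2: "\<forall>y x. (y, x) \<notin> H \<times> H \<longrightarrow> a (fst (y, x)) * b (- fst (y, x) + snd (y, x)) = 0"
    by (rule k(2))
  have k3: "(\<integral>\<^sup>+y. \<integral>\<^sup>+x. ennreal (cmod (a (fst (y, x)) * b (- fst (y, x) + snd (y, x)))) \<partial>\<mu> \<partial>\<mu>) \<le>
      ennreal (LINT x|\<mu>. cmod (a x)) * ennreal (LINT x|\<mu>. cmod (b x))"
    by (rule k(3))
  then have k4: "(\<integral>\<^sup>+y. \<integral>\<^sup>+x. ennreal (cmod (a (fst (y, x)) * b (- fst (y, x) + snd (y, x)))) \<partial>\<mu> \<partial>\<mu>) < \<infinity>"
    by (rule order.strict_trans1) (simp add: ennreal_mult_less_top)
  note F = fubini[OF k1 sc_subgroup_sigma_compact[OF H(1)] k2 k4]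
  have conv: "convolution \<mu> a b = (\<lambda>x. LINT y|\<mu>. a (fst (y, x)) * b (- fst (y, x) + snd (y, x)))"
    by (simp add: convolution_def)
  show ?thesis unfolding conv L1_def mem_Collect_eq by (rule F(2))
qed

section \<open>The action of \<open>L\<^sup>1(G)\<close> on bounded functions\<close>

text \<open>
  Every class in \<open>L\<^sup>\<infinity>(G)\<close> has representatives that are bounded at each point, and for these the
  integrals against elements of \<open>L\<^sup>1(G)\<close> are meaningful at each point.
\<close>
definition bdd_lm :: "('g \<Rightarrow> complex) \<Rightarrow> bool" where
  "bdd_lm f \<longleftrightarrow> locally_measurable_fun \<mu> f \<and> (\<exists>c. \<forall>x. cmod (f x) \<le> c)"

text \<open>
  The function \<open>\<lambda>\<cdot>a\<close> of the first step of the Arens product, defined at each point by an integral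
  rather than as an unspecified member of its class.
\<close>
definition act :: "('g \<Rightarrow> complex) \<Rightarrow> ('g \<Rightarrow> complex) \<Rightarrow> 'g \<Rightarrow> complex" where
  "act f a = (\<lambda>x. LINT y|\<mu>. f (y + x) * a y)"

lemma locally_measurable_fun_cutoff:
  assumes f: "locally_measurable_fun \<mu> f" and S: "sigma_compact S"
  shows "(\<lambda>x. indicator S x * f x) \<in> borel_measurable borel"
proof (rule measurableI)
  fix V :: "complex set" assume V: "V \<in> sets borel"
  have fS: "f -` V \<inter> S \<in> sets borel" 
    using f V S by (intro locally_measurable_sigma_compact) (auto simp: locally_measurable_fun_def)
  have Sb: "S \<in> sets borel" by (rule sigma_compact_borel[OF S])
  have "(\<lambda>x. indicator S x * f x) -` V \<inter> space borel = (f -` V \<inter> S) \<union> (if 0 \<in> V then - S else {})"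
  proof (rule set_eqI)
    fix x show "x \<in> (\<lambda>x. indicator S x * f x) -` V \<inter> space borel \<longleftrightarrow> x \<in> (f -` V \<inter> S) \<union> (if 0 \<in> V then - S else {})"
      by (cases "x \<in> S") auto
  qed
  also have "\<dots> \<in> sets borel" using fS Sb by (auto intro!: sets.Un borel_comp)
  finally show "(\<lambda>x. indicator S x * f x) -` V \<inter> space borel \<in> sets borel" .
qed simp

lemma locally_measurable_funI:
  assumes "\<And>K. compact K \<Longrightarrow> (\<lambda>x. indicator K x * f x) \<in> borel_measurable borel"
  shows "locally_measurable_fun \<mu> f"
  unfolding locally_measurable_fun_def locally_measurable_set_iff
proof (intro ballI allI impI)
  fix V :: "complex set" and K :: "'g set" assume V: "V \<in> sets borel" and K: "compact K"
  have "f -` V \<inter> K = ((\<lambda>x. indicator K x * f x) -` V \<inter> space borel) \<inter> K" by (auto simp: indicator_def)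
  also have "\<dots> \<in> sets borel" using measurable_sets[OF assms[OF K] V] compact_borel[OF K] by auto
  finally show "f -` V \<inter> K \<in> sets borel" .
qed

lemma borel_imp_locally_measurable: "f \<in> borel_measurable borel \<Longrightarrow> locally_measurable_fun \<mu> f"
  by (rule locally_measurable_funI) (auto intro!: borel_measurable_times borel_measurable_indicator compact_borel)

lemma locally_measurable_comp_continuous:
  assumes f: "locally_measurable_fun \<mu> f" and t: "continuous_on UNIV (t :: 'g \<Rightarrow> 'g)"
  shows "locally_measurable_fun \<mu> (\<lambda>x. f (t x))"
proof (rule locally_measurable_funI)
  fix K :: "'g set" assume K: "compact K"
  have c: "compact (t ` K)" using K t by (meson compact_continuous_image continuous_on_subset subset_UNIV)
  have tm: "t \<in> borel_measurable borel" using t by (rule borel_measurable_continuous_onI)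
  have "(\<lambda>x. indicator (t ` K) (t x) * f (t x)) \<in> borel_measurable borel"
    by (rule measurable_compose[OF tm locally_measurable_fun_cutoff[OF f sigma_compact_compact[OF c]]])
  then have "(\<lambda>x. indicator K x * (indicator (t ` K) (t x) * f (t x))) \<in> borel_measurable borel"
    by (rule borel_measurable_times[OF borel_measurable_indicator[OF compact_borel[OF K]]])
  also have "(\<lambda>x. indicator K x * (indicator (t ` K) (t x) * f (t x))) = (\<lambda>x. indicator K x * f (t x))"
    by (intro ext, case_tac "x \<in> K") auto
  finally show "(\<lambda>x. indicator K x * f (t x)) \<in> borel_measurable borel" .
qed

lemma bdd_lm_right_translate: "bdd_lm f \<Longrightarrow> bdd_lm (\<lambda>z. f (z + x))"
  unfolding bdd_lm_def
  by (auto intro!: locally_measurable_comp_continuous[of f "\<lambda>z. z + x"] continuous_intros)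

lemma bdd_lm_times_L1:
  assumes f: "bdd_lm f" and a: "a \<in> L1 \<mu>"
  shows "integrable \<mu> (\<lambda>x. f x * a x)"
proof -
  obtain H where H: "sc_subgroup H" "\<And>x. x \<notin> H \<Longrightarrow> a x = 0"
    by (rule common_support[OF a a]) (rule that; assumption)
  obtain c where c: "\<And>x. cmod (f x) \<le> c" using f by (auto simp: bdd_lm_def)
  have m: "(\<lambda>x. indicator H x * f x) \<in> borel_measurable borel"
    using f H(1) by (intro locally_measurable_fun_cutoff sc_subgroup_sigma_compact) (auto simp: bdd_lm_def)
  have e: "(\<lambda>x. f x * a x) = (\<lambda>x. (indicator H x * f x) * a x)" 
    by (intro ext, case_tac "x \<in> H") (simp_all add: H(2))
  have "integrable \<mu> (\<lambda>x. complex_of_real c * a x)" using a by (simp add: L1_def)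
  then show ?thesis
  proof (rule Bochner_Integration.integrable_bound)
    show "(\<lambda>x. f x * a x) \<in> borel_measurable \<mu>" unfolding e measurable_mu_iff
      by (intro borel_measurable_times m L1_measurable a)
    show "AE x in \<mu>. cmod (f x * a x) \<le> cmod (complex_of_real c * a x)"
      by (rule AE_I2) (auto simp: norm_mult intro!: mult_right_mono order_trans[OF c])
  qed
qed

lemma norm_integral_le:
  fixes f :: "'g \<Rightarrow> complex"
  assumes "integrable \<mu> f" "integrable \<mu> g" "\<And>x. cmod (f x) \<le> g x"
  shows "cmod (LINT x|\<mu>. f x) \<le> (LINT x|\<mu>. g x)"
  by (rule order_trans[OF integral_norm_bound integral_mono]) (use assms in auto)

lemma act_bound:
  assumes f: "bdd_lm f" "\<And>x. cmod (f x) \<le> c" and a: "a \<in> L1 \<mu>"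
  shows "cmod (act f a x) \<le> c * (LINT y|\<mu>. cmod (a y))"
proof -
  have i: "integrable \<mu> (\<lambda>y. f (y + x) * a y)" by (intro bdd_lm_times_L1 bdd_lm_right_translate f a)
  have "cmod (act f a x) \<le> (LINT y|\<mu>. c * cmod (a y))" unfolding act_def
    using i a f(2) by (intro norm_integral_le) (auto simp: L1_def norm_mult mult_right_mono)
  then show ?thesis by simp
qed

text \<open>
  Substitute \<open>y + x\<close> for \<open>x\<close> in the double integral of \<open>f(x) a(y) b(- y + x)\<close>, between two
  applications of Fubini's theorem.  As \<open>f\<close> is only locally measurable, it is first cut off to a
  subgroup supporting \<open>a\<close> and \<open>b\<close>.
\<close>
lemma pairing_convolution:
  assumes f: "bdd_lm f" and a: "a \<in> L1 \<mu>" and b: "b \<in> L1 \<mu>"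
  shows "pairing \<mu> f (convolution \<mu> a b) = pairing \<mu> (act f a) b"
proof -
  obtain H where H: "sc_subgroup H" "\<And>x. x \<notin> H \<Longrightarrow> a x = 0" "\<And>x. x \<notin> H \<Longrightarrow> b x = 0"
    by (rule common_support[OF a b]) (rule that; assumption)
  obtain c where c: "\<And>x. cmod (f x) \<le> c" using f by (auto simp: bdd_lm_def)
  let ?f = "\<lambda>x. indicator H x * f x"
  have fm: "?f \<in> borel_measurable borel"
    using f H(1) by (intro locally_measurable_fun_cutoff sc_subgroup_sigma_compact) (auto simp: bdd_lm_def)
  have fc: "cmod (?f x) \<le> c" for x using c[of x] order_trans[OF norm_ge_zero c[of x]] by (auto simp: indicator_def)
  let ?h = "\<lambda>z. ?f (snd z) * (a (fst z) * b (- fst z + snd z))"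
  have k: "?h \<in> borel_measurable borel" "\<forall>y x. (y, x) \<notin> H \<times> H \<longrightarrow> ?h (y, x) = 0"
    "(\<integral>\<^sup>+y. \<integral>\<^sup>+x. ennreal (cmod (?h (y, x))) \<partial>\<mu> \<partial>\<mu>) \<le> ennreal c * (ennreal (LINT x|\<mu>. cmod (a x)) * ennreal (LINT x|\<mu>. cmod (b x)))"
    by (rule convolution_kernel[OF a b fm fc H(1,2,3)]; assumption)+
  have hy: "(\<lambda>x. ?h (y, x)) \<in> borel_measurable borel" for y
    by (rule measurable_compose[OF measurable_Pair_section(1) k(1)])
  have fin: "(\<integral>\<^sup>+y. \<integral>\<^sup>+x. ennreal (cmod (?h (y, x))) \<partial>\<mu> \<partial>\<mu>) < \<infinity>"
    by (rule order.strict_trans1[OF k(3)]) (simp_all add: ennreal_mult_less_top)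
  note F = fubini[OF k(1) sc_subgroup_sigma_compact[OF H(1)] k(2) fin]
  let ?g = "\<lambda>z. ?f (fst z + snd z) * (a (fst z) * b (snd z))"
  have tr: "(LINT x|\<mu>. ?h (y, x)) = (LINT x|\<mu>. ?g (y, x))" for y
  proof -
    have "(LINT x|\<mu>. ?h (y, x)) = (LINT x|\<mu>. ?h (y, y + x))"
      by (rule integral_translate[symmetric, of "\<lambda>x. ?h (y, x)"]) (rule hy)
    then show ?thesis by (simp add: add.assoc[symmetric])
  qed
  have trn: "(\<integral>\<^sup>+x. ennreal (cmod (?h (y, x))) \<partial>\<mu>) = (\<integral>\<^sup>+x. ennreal (cmod (?g (y, x))) \<partial>\<mu>)" for y
  proof -
    have "(\<integral>\<^sup>+x. ennreal (cmod (?h (y, x))) \<partial>\<mu>) = (\<integral>\<^sup>+x. ennreal (cmod (?h (y, y + x))) \<partial>\<mu>)"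
      by (rule nn_integral_translate[symmetric, of "\<lambda>x. ennreal (cmod (?h (y, x)))"])
        (use hy in simp)
    then show ?thesis by (simp add: add.assoc[symmetric])
  qed
  have gm: "?g \<in> borel_measurable borel"
    by (intro borel_measurable_times measurable_product_maps(1,2) measurable_product_maps(4)[where a = ?f] fm L1_measurable a b)
  have gH: "\<forall>y x. (y, x) \<notin> H \<times> H \<longrightarrow> ?g (y, x) = 0" using H(2,3) by auto
  have gfin: "(\<integral>\<^sup>+y. \<integral>\<^sup>+x. ennreal (cmod (?g (y, x))) \<partial>\<mu> \<partial>\<mu>) < \<infinity>" using fin unfolding trn .
  note G = fubini[OF gm sc_subgroup_sigma_compact[OF H(1)] gH gfin]
  have "pairing \<mu> f (convolution \<mu> a b) = (LINT x|\<mu>. LINT y|\<mu>. ?h (y, x))"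
    unfolding pairing_def
  proof (intro Bochner_Integration.integral_cong refl)
    fix x
    have *: "(LINT y|\<mu>. ?h (y, x)) = ?f x * convolution \<mu> a b x" unfolding convolution_def by simp
    show "f x * convolution \<mu> a b x = (LINT y|\<mu>. ?h (y, x))"
    proof (cases "x \<in> H")
      case False
      have z: "a y * b (- y + x) = 0" for y
        using convolution_kernel(2)[OF a b borel_measurable_const _ H(1,2,3), of 1 1, rule_format, of y x] False
        by simp
      have "convolution \<mu> a b x = 0" unfolding convolution_def z by simp
      then show ?thesis using * by simp
    qed (simp add: convolution_def)
  qed
  also have "\<dots> = (LINT y|\<mu>. LINT x|\<mu>. ?h (y, x))" by (rule F(3)[symmetric])
  also have "\<dots> = (LINT y|\<mu>. LINT x|\<mu>. ?g (y, x))" unfolding tr ..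
  also have "\<dots> = (LINT x|\<mu>. LINT y|\<mu>. ?g (y, x))" by (rule G(3))
  also have "\<dots> = pairing \<mu> (act f a) b"
    unfolding pairing_def act_def
  proof (intro Bochner_Integration.integral_cong refl)
    fix x
    have g: "?g (y, x) = f (y + x) * a y * b x" for y
    proof (cases "x \<in> H \<and> y \<in> H")
      case True
      then have "y + x \<in> H" using H(1) unfolding sc_subgroup_def by blast
      then show ?thesis by simp
    qed (use H(2,3) in auto)
    show "(LINT y|\<mu>. ?g (y, x)) = (LINT y|\<mu>. f (y + x) * a y) * b x" unfolding g by simp
  qed
  finally show ?thesis .
qed

text \<open>
  The value at \<open>x\<close> of both sides is a pairing with the right translate \<open>z \<mapsto> f(z + x)\<close>.
\<close>
lemma act_convolution:
  assumes f: "bdd_lm f" and a: "a \<in> L1 \<mu>" and b: "b \<in> L1 \<mu>"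
  shows "act f (convolution \<mu> a b) = act (act f a) b"
proof
  fix x
  have "act f (convolution \<mu> a b) x = pairing \<mu> (\<lambda>z. f (z + x)) (convolution \<mu> a b)"
    by (simp add: act_def pairing_def)
  also have "\<dots> = pairing \<mu> (act (\<lambda>z. f (z + x)) a) b"
    by (rule pairing_convolution[OF bdd_lm_right_translate[OF f] a b])
  also have "\<dots> = act (act f a) b x" by (simp add: act_def pairing_def add.assoc)
  finally show "act f (convolution \<mu> a b) x = act (act f a) b x" .
qed

end

section \<open>Inversion and continuity of translations\<close>

context haar_group
begin

text \<open>
  Positive measure makes statements that hold almost everywhere hold at some point of \<open>H\<close>; a
  neighbourhood of \<open>0\<close> in \<open>H\<close> allows small translations inside \<open>H\<close>.
\<close>
lemma sc_subgroup_pos: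
  assumes "sigma_compact S"
  obtains H :: "'g set" where "sc_subgroup H" "S \<subseteq> H" "emeasure \<mu> H \<noteq> 0"
    "\<exists>U. open U \<and> 0 \<in> U \<and> U \<subseteq> H"
proof -
  obtain U C :: "'g set" where U: "open U" "compact C" "0 \<in> U" "U \<subseteq> C"
    using compact_neighbourhood[OF lc open_UNIV UNIV_I, of 0] by metis
  obtain H where H: "sc_subgroup H" "S \<union> C \<subseteq> H"
    using sc_subgroup_generated[OF sigma_compact_Un[OF assms sigma_compact_compact[OF U(2)]]] by metis
  have "U \<subseteq> H" using H(2) U(4) by auto
  then have "emeasure \<mu> U \<le> emeasure \<mu> H"
    using H(1) by (intro emeasure_mono) (auto simp: sc_subgroup_def intro: sigma_compact_borel)
  moreover have "emeasure \<mu> U \<noteq> 0" using U by (intro open_pos) auto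
  ultimately have "emeasure \<mu> H \<noteq> 0" by auto
  moreover have "\<exists>U. open U \<and> 0 \<in> U \<and> U \<subseteq> H" using U \<open>U \<subseteq> H\<close> by blast
  ultimately show ?thesis using that[of H] H by simp
qed

text \<open>
  For fixed \<open>y\<close> the set of all \<open>x\<close> with \<open>- y + x \<in> A\<close> is a left translate of \<open>A\<close>, hence null.  By
  Tonelli's theorem there is some \<open>x \<in> H\<close> for which the set of all \<open>y\<close> with \<open>- y + x \<in> A\<close> is null.
  That set is the translate by \<open>x\<close> of the set of inverses of the elements of \<open>A\<close>.
\<close>
lemma neg_null_set:
  assumes A: "A \<in> null_sets \<mu>" and S: "A \<subseteq> S" "sigma_compact S"
  shows "uminus -` A \<in> null_sets \<mu>"
proof -
  obtain H :: "'g set" where H: "sc_subgroup H" "S \<subseteq> H" "emeasure \<mu> H \<noteq> 0" by (rule sc_subgroup_pos[OF S(2)])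
  have Hb: "H \<in> sets borel" using H(1) by (intro sigma_compact_borel sc_subgroup_sigma_compact)
  have Ab: "A \<in> sets borel" and A0: "emeasure \<mu> A = 0" using A by (auto simp: null_sets_def)
  have nb: "uminus -` A \<in> sets borel" using measurable_sets[OF measurable_neg Ab] by simp
  let ?h = "\<lambda>z. indicator H (fst z) * indicator A (- fst z + snd z) :: ennreal"
  have hm: "?h \<in> borel_measurable borel"
    by (intro borel_measurable_times_ennreal measurable_product_maps(1,3)[where a = "indicator H"]
          measurable_product_maps(3)[where a = "indicator A"] borel_measurable_indicator Hb Ab)
  have hH: "\<forall>y x. (y, x) \<notin> H \<times> H \<longrightarrow> ?h (y, x) = 0"
  proof (intro allI impI)
    fix y x assume yx: "(y, x) \<notin> H \<times> H"
    have "\<not> (y \<in> H \<and> - y + x \<in> A)"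
    proof
      assume "y \<in> H \<and> - y + x \<in> A"
      then have "y \<in> H" "- y + x \<in> H" using S(1) H(2) by auto
      then have "y + (- y + x) \<in> H" using H(1) unfolding sc_subgroup_def by blast
      then show False using \<open>y \<in> H\<close> yx by (simp add: add.assoc[symmetric])
    qed
    then show "?h (y, x) = 0" by (auto simp: indicator_def)
  qed
  note T = tonelli[OF hm sc_subgroup_sigma_compact[OF H(1)] hH]
  have "(\<integral>\<^sup>+x. ?h (y, x) \<partial>\<mu>) = 0" for y
  proof -
    have "(\<integral>\<^sup>+x. ?h (y, x) \<partial>\<mu>) = indicator H y * (\<integral>\<^sup>+x. indicator A (- y + x) \<partial>\<mu>)"
      using Ab by (simp add: nn_integral_cmult)
    also have "(\<integral>\<^sup>+x. indicator A (- y + x) \<partial>\<mu>) = (\<integral>\<^sup>+x. indicator A x \<partial>\<mu>)"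
      using Ab by (intro nn_integral_translate) simp
    also have "\<dots> = 0" using Ab A0 by simp
    finally show ?thesis by simp
  qed
  then have "(\<integral>\<^sup>+x. \<integral>\<^sup>+y. ?h (y, x) \<partial>\<mu> \<partial>\<mu>) = 0" using T(3) by simp
  moreover have "(\<lambda>x. \<integral>\<^sup>+y. ?h (y, x) \<partial>\<mu>) \<in> borel_measurable \<mu>" using T(2) unfolding measurable_mu_iff .
  ultimately have ae: "AE x in \<mu>. (\<integral>\<^sup>+y. ?h (y, x) \<partial>\<mu>) = 0" by (subst (asm) nn_integral_0_iff_AE) auto
  have "\<exists>x\<in>H. (\<integral>\<^sup>+y. ?h (y, x) \<partial>\<mu>) = 0"
  proof (rule ccontr)
    assume "\<not> ?thesis"
    with ae have "AE x in \<mu>. x \<notin> H" by (auto elim!: eventually_mono)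
    then have "emeasure \<mu> H = 0" using Hb by (subst (asm) AE_iff_measurable[of H]) auto
    then show False using H(3) by simp
  qed
  then obtain x where x: "x \<in> H" "(\<integral>\<^sup>+y. ?h (y, x) \<partial>\<mu>) = 0" by blast
  have "emeasure \<mu> (uminus -` A) = (\<integral>\<^sup>+y. indicator (uminus -` A) (- x + y) \<partial>\<mu>)"
    using nb nn_integral_translate[of "indicator (uminus -` A)" "- x"] by simp
  also have "\<dots> = (\<integral>\<^sup>+y. ?h (y, x) \<partial>\<mu>)"
  proof (intro nn_integral_cong)
    fix y
    have e: "- (- x + y) = - y + x" by (simp add: minus_add)
    have "y \<in> H" if "- y + x \<in> A"
    proof -
      have "- y + x \<in> H" using that S(1) H(2) by auto
      then have "x + - (- y + x) \<in> H" using x H(1) unfolding sc_subgroup_def by blast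
      then show ?thesis by (simp add: minus_add add.assoc[symmetric])
    qed
    then show "indicator (uminus -` A) (- x + y) = ?h (y, x)" by (auto simp: indicator_def e)
  qed
  finally have "emeasure \<mu> (uminus -` A) = 0" using x by simp
  then show ?thesis using nb by (auto simp: null_sets_def)
qed

lemma locally_null_neg:
  assumes A: "locally_null \<mu> A" shows "locally_null \<mu> (uminus -` A)"
  unfolding locally_null_iff
proof (intro allI impI)
  fix K :: "'g set" assume K: "compact K"
  have nK: "compact (uminus ` K)" by (rule compact_neg[OF K])
  have "A \<inter> uminus ` K \<in> null_sets \<mu>" using A nK unfolding locally_null_iff by blast
  then have "uminus -` (A \<inter> uminus ` K) \<in> null_sets \<mu>"
    by (rule neg_null_set[OF _ _ sigma_compact_compact[OF nK]]) auto
  also have "uminus -` (A \<inter> uminus ` K) = uminus -` A \<inter> K" by (auto simp: image_iff)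
  finally show "uminus -` A \<inter> K \<in> null_sets \<mu>" .
qed

text \<open>
  Inversion maps the measure with density \<open>a\<close> to one that vanishes on null sets, and \<open>\<rho>\<close> is its
  Radon-Nikodym density.  In terms of the modular function \<open>\<Delta>\<close>, it is \<open>\<rho>(y) = a(- y) \<Delta>(- y)\<close>, but
  only its existence matters.
\<close>
lemma neg_density_nonneg:
  fixes a :: "'g \<Rightarrow> real"
  assumes a: "integrable \<mu> a" "\<And>x. 0 \<le> a x"
  obtains \<rho> :: "'g \<Rightarrow> real" where "integrable \<mu> \<rho>"
    "\<And>f :: 'g \<Rightarrow> complex. f \<in> borel_measurable borel \<Longrightarrow> (LINT y|\<mu>. a y *\<^sub>R f (- y)) = (LINT y|\<mu>. \<rho> y *\<^sub>R f y)"
proof -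
  have am: "a \<in> borel_measurable borel" using borel_measurable_integrable[OF a(1)] by simp
  have ca: "(\<lambda>x. complex_of_real (a x)) \<in> L1 \<mu>" using a(1) by (simp add: L1_def)
  obtain H where H: "sc_subgroup H" "\<And>x. x \<notin> H \<Longrightarrow> complex_of_real (a x) = 0"
    by (rule common_support[OF ca ca]) (rule that; assumption)
  have aH: "a x = 0" if "x \<notin> H" for x using H(2)[OF that] by simp
  have Hb: "H \<in> sets borel" using H(1) by (intro sigma_compact_borel sc_subgroup_sigma_compact)
  let ?M = "density \<mu> (indicator H)"
  let ?A = "density \<mu> (\<lambda>x. ennreal (a x))"
  let ?N = "distr ?A borel uminus"
  have eM: "emeasure ?M B = emeasure \<mu> (H \<inter> B)" if "B \<in> sets borel" for B
  proof -
    have "emeasure ?M B = (\<integral>\<^sup>+x. indicator H x * indicator B x \<partial>\<mu>)"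
      using that Hb by (intro emeasure_density) auto
    also have "\<dots> = (\<integral>\<^sup>+x. indicator (H \<inter> B) x \<partial>\<mu>)" by (simp only: indicator_inter_arith)
    also have "\<dots> = emeasure \<mu> (H \<inter> B)" using that Hb by (intro nn_integral_indicator) auto
    finally show ?thesis .
  qed
  interpret M: sigma_finite_measure ?M
  proof
    obtain K where K: "\<And>n::nat. compact (K n)" "H = (\<Union>n. K n)"
      using sc_subgroup_sigma_compact[OF H(1)] unfolding sigma_compact_def by metis
    let ?K = "insert (- H) (range K)"
    have "countable ?K" by simp
    moreover have "?K \<subseteq> sets ?M" using Hb compact_borel[OF K(1)] by (auto intro: borel_comp)
    moreover have "\<Union>?K = space ?M" using K(2) by auto
    moreover have "\<forall>B\<in>?K. emeasure ?M B \<noteq> \<infinity>"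
    proof
      fix B assume "B \<in> ?K"
      then show "emeasure ?M B \<noteq> \<infinity>"
      proof
        assume "B = - H" then show ?thesis using Hb by (simp add: eM borel_comp)
      next
        assume "B \<in> range K"
        then obtain n where n: "B = K n" by (rule rangeE)
        have "emeasure ?M B \<le> emeasure \<mu> (K n)" unfolding n
          by (subst eM[OF compact_borel[OF K(1)]], rule emeasure_mono) (auto intro: compact_borel[OF K(1)])
        also have "\<dots> < \<infinity>" by (rule compact_finite[OF K(1)])
        finally show ?thesis by simp
      qed
    qed
    ultimately show "\<exists>A. countable A \<and> A \<subseteq> sets ?M \<and> \<Union>A = space ?M \<and> (\<forall>a\<in>A. emeasure ?M a \<noteq> \<infinity>)"
      by (intro exI[of _ ?K] conjI)
  qed
  have eN: "emeasure ?N B = (\<integral>\<^sup>+x. ennreal (a x) * indicator (uminus -` B) x \<partial>\<mu>)" if B: "B \<in> sets borel" for B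
  proof -
    have "uminus -` B \<in> sets borel" using measurable_sets[OF measurable_neg B] by simp
    then show ?thesis using B am by (simp add: emeasure_distr emeasure_density)
  qed
  have "absolutely_continuous ?M ?N"
    unfolding absolutely_continuous_def
  proof
    fix B assume "B \<in> null_sets ?M"
    then have B: "B \<in> sets borel" "emeasure \<mu> (H \<inter> B) = 0" using eM[of B] by (auto simp: null_sets_def)
    then have "H \<inter> B \<in> null_sets \<mu>" using Hb by (auto simp: null_sets_def)
    from neg_null_set[OF this _ sc_subgroup_sigma_compact[OF H(1)]]
    have n: "uminus -` (H \<inter> B) \<in> null_sets \<mu>" by auto
    have "emeasure ?N B = (\<integral>\<^sup>+x. 0 \<partial>\<mu>)" unfolding eN[OF B(1)]
    proof (rule nn_integral_cong_AE)
      show "AE x in \<mu>. ennreal (a x) * indicator (uminus -` B) x = 0"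
        using AE_not_in[OF n]
      proof eventually_elim
        case (elim x)
        show ?case
        proof (cases "x \<in> H")
          case True
          then have "- x \<in> H" using H(1) by (simp add: sc_subgroup_def)
          then show ?thesis using elim by (auto simp: indicator_def)
        qed (simp add: aH)
      qed
    qed
    then show "B \<in> null_sets ?N" using B by (auto simp: null_sets_def)
  qed
  then obtain r where r: "r \<in> borel_measurable ?M" "density ?M r = ?N" using M.Radon_Nikodym[of ?N] by auto
  have rm: "r \<in> borel_measurable borel" using r(1) by simp
  define r' where "r' x = indicator H x * r x" for x
  have r'm: "r' \<in> borel_measurable borel" unfolding r'_def using rm Hb by simp
  have r': "density \<mu> r' = ?N" unfolding r(2)[symmetric] r'_def using rm Hb by (subst density_density_eq) auto
  have "(\<integral>\<^sup>+x. r' x \<partial>\<mu>) = emeasure (density \<mu> r') UNIV" using r'm by (subst emeasure_density) auto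
  also have "\<dots> = (\<integral>\<^sup>+x. ennreal (a x) \<partial>\<mu>)" unfolding r' by (subst eN) auto
  also have "\<dots> < \<infinity>" using a by (subst nn_integral_eq_integral) auto
  finally have fin: "(\<integral>\<^sup>+x. r' x \<partial>\<mu>) < \<infinity>" .
  then have ae: "AE x in \<mu>. r' x \<noteq> \<infinity>" using r'm by (intro nn_integral_noteq_infinite) auto
  define \<rho> where "\<rho> x = enn2real (r' x)" for x
  have \<rho>m: "\<rho> \<in> borel_measurable \<mu>" unfolding \<rho>_def using r'm by simp
  have ae\<rho>: "AE x in \<mu>. ennreal (\<rho> x) = r' x" using ae by eventually_elim (simp add: \<rho>_def less_top)
  have \<rho>d: "density \<mu> (\<lambda>x. ennreal (\<rho> x)) = ?N" unfolding r'[symmetric]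
    using ae\<rho> \<rho>m r'm by (intro density_cong) auto
  have \<rho>0: "0 \<le> \<rho> x" for x by (simp add: \<rho>_def)
  show ?thesis
  proof (rule that[of \<rho>])
    have "(\<integral>\<^sup>+x. ennreal (\<rho> x) \<partial>\<mu>) = (\<integral>\<^sup>+x. r' x \<partial>\<mu>)" using ae\<rho> by (rule nn_integral_cong_AE)
    then show "integrable \<mu> \<rho>" using fin \<rho>m by (intro integrableI_nonneg) (auto simp: \<rho>_def)
    fix f :: "'g \<Rightarrow> complex" assume f: "f \<in> borel_measurable borel"
    have fn: "(\<lambda>y. f (- y)) \<in> borel_measurable borel" using f by simp
    have "(LINT y|\<mu>. a y *\<^sub>R f (- y)) = (LINT y|?A. f (- y))"
      using am a(2) fn by (intro integral_density[symmetric]) auto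
    also have "\<dots> = (LINT y|?N. f y)" using f by (intro integral_distr[symmetric]) auto
    also have "\<dots> = (LINT y|\<mu>. \<rho> y *\<^sub>R f y)" unfolding \<rho>d[symmetric]
      using f \<rho>m \<rho>0 by (intro integral_density) auto
    finally show "(LINT y|\<mu>. a y *\<^sub>R f (- y)) = (LINT y|\<mu>. \<rho> y *\<^sub>R f y)" .
  qed
qed

lemma L1_bounded_times:
  assumes a: "a \<in> L1 \<mu>" and f: "f \<in> borel_measurable borel" "\<And>x. cmod (f x) \<le> c"
  shows "integrable \<mu> (\<lambda>y. f y * a y)"
  by (rule bdd_lm_times_L1) (use a f in \<open>auto simp: bdd_lm_def intro: borel_imp_locally_measurable\<close>)

lemma neg_density:
  assumes a: "a \<in> L1 \<mu>"
  shows "\<exists>\<rho>\<in>L1 \<mu>. \<forall>f c. f \<in> borel_measurable borel \<longrightarrow> (\<forall>x. cmod (f x) \<le> c) \<longrightarrow>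
    (LINT y|\<mu>. f (- y) * a y) = (LINT y|\<mu>. f y * \<rho> y)"
proof -
  let ?p = "\<lambda>s t x. max 0 (t * s (a x)) :: real"
  have ai: "integrable \<mu> a" using a by (simp add: L1_def)
  have pi: "integrable \<mu> (?p s t)" if "s \<in> {Re, Im}" for s t
    using ai that by (intro integrable_max) auto
  have ex: "\<exists>\<rho>. integrable \<mu> \<rho> \<and> (\<forall>f :: 'g \<Rightarrow> complex. f \<in> borel_measurable borel \<longrightarrow> 
      (LINT y|\<mu>. ?p s t y *\<^sub>R f (- y)) = (LINT y|\<mu>. \<rho> y *\<^sub>R f y))" if s: "s \<in> {Re, Im}" for s t
  proof -
    obtain \<rho> where "integrable \<mu> \<rho>" 
      "\<And>f :: 'g \<Rightarrow> complex. f \<in> borel_measurable borel \<Longrightarrow> (LINT y|\<mu>. ?p s t y *\<^sub>R f (- y)) = (LINT y|\<mu>. \<rho> y *\<^sub>R f y)"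
      by (rule neg_density_nonneg[OF pi[OF s, of t]]) (simp, rule that, assumption+)
    then show ?thesis by blast
  qed
  obtain p1 where p1: "integrable \<mu> p1" "\<forall>f :: 'g \<Rightarrow> complex. f \<in> borel_measurable borel \<longrightarrow> 
      (LINT y|\<mu>. ?p Re 1 y *\<^sub>R f (- y)) = (LINT y|\<mu>. p1 y *\<^sub>R f y)" using ex[of Re 1] by auto
  obtain p2 where p2: "integrable \<mu> p2" "\<forall>f :: 'g \<Rightarrow> complex. f \<in> borel_measurable borel \<longrightarrow> 
      (LINT y|\<mu>. ?p Re (-1) y *\<^sub>R f (- y)) = (LINT y|\<mu>. p2 y *\<^sub>R f y)" using ex[of Re "-1"] by auto
  obtain p3 where p3: "integrable \<mu> p3" "\<forall>f :: 'g \<Rightarrow> complex. f \<in> borel_measurable borel \<longrightarrow> 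
      (LINT y|\<mu>. ?p Im 1 y *\<^sub>R f (- y)) = (LINT y|\<mu>. p3 y *\<^sub>R f y)" using ex[of Im 1] by auto
  obtain p4 where p4: "integrable \<mu> p4" "\<forall>f :: 'g \<Rightarrow> complex. f \<in> borel_measurable borel \<longrightarrow> 
      (LINT y|\<mu>. ?p Im (-1) y *\<^sub>R f (- y)) = (LINT y|\<mu>. p4 y *\<^sub>R f y)" using ex[of Im "-1"] by auto
  let ?r = "\<lambda>y. complex_of_real (p1 y) - complex_of_real (p2 y) + \<i> * (complex_of_real (p3 y) - complex_of_real (p4 y))"
  show ?thesis
  proof (rule bexI[of _ ?r], intro allI impI)
    show "?r \<in> L1 \<mu>" unfolding L1_def mem_Collect_eq
      by (intro Bochner_Integration.integrable_add Bochner_Integration.integrable_diff integrable_mult_right integrable_of_real p1 p2 p3 p4)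
    fix f :: "'g \<Rightarrow> complex" and c assume f: "f \<in> borel_measurable borel" and "\<forall>x. cmod (f x) \<le> c"
    then have fc: "cmod (f x) \<le> c" for x by simp
    have fn: "(\<lambda>y. f (- y)) \<in> borel_measurable borel" using f by simp
    have i1: "integrable \<mu> (\<lambda>y. ?p s t y *\<^sub>R f (- y))" if "s \<in> {Re, Im}" for s t
      using L1_bounded_times[of "\<lambda>y. complex_of_real (?p s t y)", OF _ fn fc] pi[OF that, of t]
      by (simp add: L1_def scaleR_conv_of_real mult.commute)
    have i2: "integrable \<mu> (\<lambda>y. p y *\<^sub>R f y)" if "integrable \<mu> p" for p
      using L1_bounded_times[of "\<lambda>y. complex_of_real (p y)", OF _ f fc] that
      by (simp add: L1_def scaleR_conv_of_real mult.commute)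
    have dec: "z = complex_of_real (max 0 (1 * Re z)) - complex_of_real (max 0 (-1 * Re z)) 
        + \<i> * (complex_of_real (max 0 (1 * Im z)) - complex_of_real (max 0 (-1 * Im z)))" for z
      by (auto simp: complex_eq_iff)
    have "(LINT y|\<mu>. f (- y) * a y) = (LINT y|\<mu>. (?p Re 1 y *\<^sub>R f (- y) - ?p Re (-1) y *\<^sub>R f (- y))
        + \<i> * (?p Im 1 y *\<^sub>R f (- y) - ?p Im (-1) y *\<^sub>R f (- y)))"
      by (intro Bochner_Integration.integral_cong refl, subst (1) dec) (simp add: scaleR_conv_of_real algebra_simps)
    also have "\<dots> = (LINT y|\<mu>. ?p Re 1 y *\<^sub>R f (- y)) - (LINT y|\<mu>. ?p Re (-1) y *\<^sub>R f (- y))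
        + \<i> * ((LINT y|\<mu>. ?p Im 1 y *\<^sub>R f (- y)) - (LINT y|\<mu>. ?p Im (-1) y *\<^sub>R f (- y)))"
      using i1[of Re 1] i1[of Re "-1"] i1[of Im 1] i1[of Im "-1"] 
      by (simp only: Bochner_Integration.integral_add Bochner_Integration.integral_diff integral_mult_right_zero
          Bochner_Integration.integrable_add Bochner_Integration.integrable_diff integrable_mult_right insert_iff simp_thms)
    also have "\<dots> = (LINT y|\<mu>. p1 y *\<^sub>R f y) - (LINT y|\<mu>. p2 y *\<^sub>R f y)
        + \<i> * ((LINT y|\<mu>. p3 y *\<^sub>R f y) - (LINT y|\<mu>. p4 y *\<^sub>R f y))"
      using p1(2) p2(2) p3(2) p4(2) f by simp
    also have "\<dots> = (LINT y|\<mu>. (p1 y *\<^sub>R f y - p2 y *\<^sub>R f y) + \<i> * (p3 y *\<^sub>R f y - p4 y *\<^sub>R f y))"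
      using i2[OF p1(1)] i2[OF p2(1)] i2[OF p3(1)] i2[OF p4(1)]
      by (simp only: Bochner_Integration.integral_add Bochner_Integration.integral_diff integral_mult_right_zero
          Bochner_Integration.integrable_add Bochner_Integration.integrable_diff integrable_mult_right)
    also have "\<dots> = (LINT y|\<mu>. f y * ?r y)"
      by (intro Bochner_Integration.integral_cong refl) (simp add: scaleR_conv_of_real algebra_simps)
    finally show "(LINT y|\<mu>. f (- y) * a y) = (LINT y|\<mu>. f y * ?r y)" .
  qed
qed

lemma neg_open_nhd: 
  assumes "open V" "(0::'g) \<in> V" 
  shows "open (V \<inter> uminus -` V)" "0 \<in> V \<inter> uminus -` V"
  using assms open_neg[of V] by auto

text \<open>
  Continuity at \<open>0\<close> of the left translation \<open>v \<mapsto> \<rho>(v + y)\<close> as a map from the group to \<open>L\<^sup>1(G)\<close>.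
\<close>
definition left_cont :: "('g \<Rightarrow> complex) \<Rightarrow> bool" where
  "left_cont \<rho> \<longleftrightarrow> (\<forall>\<epsilon>>0. \<exists>V. open V \<and> 0 \<in> V \<and> (\<forall>v\<in>V. (LINT y|\<mu>. cmod (\<rho> (v + y) - \<rho> y)) < \<epsilon>))"

lemma left_contE:
  assumes "left_cont \<rho>" "0 < \<epsilon>"
  obtains V where "open V" "0 \<in> V" "\<And>v. v \<in> V \<Longrightarrow> (LINT y|\<mu>. cmod (\<rho> (v + y) - \<rho> y)) < \<epsilon>"
proof -
  have "\<exists>V. open V \<and> 0 \<in> V \<and> (\<forall>v\<in>V. (LINT y|\<mu>. cmod (\<rho> (v + y) - \<rho> y)) < \<epsilon>)"
    by (rule assms(1)[unfolded left_cont_def, rule_format, OF assms(2)])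
  then obtain V where V: "open V" "0 \<in> V" "\<forall>v\<in>V. (LINT y|\<mu>. cmod (\<rho> (v + y) - \<rho> y)) < \<epsilon>"
    by (elim exE conjE)
  show ?thesis by (rule that[OF V(1,2)]) (rule bspec[OF V(3)])
qed

text \<open>
  Choose \<open>A \<subseteq> U\<close> and \<open>K \<subseteq> U\<close> with \<open>U\<close> open, \<open>K\<close> compact, and both close to \<open>U\<close> in measure.  A
  small translation moves \<open>K\<close> within \<open>U\<close>, so \<open>K\<close>, and therefore \<open>A\<close>, is nearly unchanged.
\<close>
lemma left_cont_indicator:
  assumes A: "A \<in> sets borel" "emeasure \<mu> A < \<infinity>" and e: "0 < \<epsilon>"
  obtains V where "open V" "0 \<in> V" 
    "\<And>v. v \<in> V \<Longrightarrow> (LINT y|\<mu>. \<bar>indicator A (v + y) - indicator A y\<bar>) < (\<epsilon>::real)"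
proof -
  \<comment> \<open>The difference will be bounded by six terms, each with an integral below \<open>d\<close>.\<close>
  define d where "d = \<epsilon> / 8"
  have d: "0 < d" using e by (simp add: d_def)
  have mA: "emeasure \<mu> A = ennreal (measure \<mu> A)" using A by (simp add: emeasure_eq_ennreal_measure)
  have "emeasure \<mu> A < ennreal (measure \<mu> A + d)" unfolding mA using d by (simp add: ennreal_lessI add_pos_nonneg)
  from outer_regularE[OF A(1) this] obtain U where U: "open U" "A \<subseteq> U" "emeasure \<mu> U < ennreal (measure \<mu> A + d)" .
  have Uf: "emeasure \<mu> U < \<infinity>" using U(3) by (rule less_trans) simp
  have mU: "emeasure \<mu> U = ennreal (measure \<mu> U)" using Uf by (simp add: emeasure_eq_ennreal_measure)
  have UA: "measure \<mu> U < measure \<mu> A + d" using U(3) unfolding mU by (subst (asm) ennreal_less_iff) auto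
  obtain K where K: "compact K" "K \<subseteq> U" "measure \<mu> U - d < measure \<mu> K"
  proof (cases "measure \<mu> U < d")
    case True
    show ?thesis by (rule that[of "{}"]) (use True d in auto)
  next
    case False
    have "ennreal (measure \<mu> U - d) < emeasure \<mu> U" unfolding mU using d False by (subst ennreal_less_iff) auto
    from inner_regularE[OF U(1) this] obtain K where K: "compact K" "K \<subseteq> U" "ennreal (measure \<mu> U - d) < emeasure \<mu> K" .
    have "emeasure \<mu> K = ennreal (measure \<mu> K)" using compact_finite[OF K(1)] by (simp add: emeasure_eq_ennreal_measure)
    then have "measure \<mu> U - d < measure \<mu> K" using K(3) by (metis ennreal_leI not_le)
    then show ?thesis using that K by blast
  qed
  let ?W = "{(v, y). v + y \<in> U}"
  have "?W = (\<lambda>z. fst z + snd z) -` U" by auto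
  also have "open \<dots>" using U(1) by (intro open_vimage continuous_intros)
  finally have W: "open ?W" .
  have "{0} \<times> K \<subseteq> ?W" using K(2) by auto
  from Elementary_Topology.tube_lemma[OF K(1) W this] obtain V where V: "0 \<in> V" "open V" "V \<times> K \<subseteq> ?W" by (elim exE conjE)
  have Ub: "U \<in> sets borel" and Kb: "K \<in> sets borel" using U(1) compact_borel[OF K(1)] by auto
  have iU: "integrable \<mu> (indicator U :: 'g \<Rightarrow> real)" using Ub Uf by (simp add: integrable_indicator_iff)
  have iK: "integrable \<mu> (indicator K :: 'g \<Rightarrow> real)" using Kb compact_finite[OF K(1)] by (simp add: integrable_indicator_iff)
  have iA: "integrable \<mu> (indicator A :: 'g \<Rightarrow> real)" using A by (simp add: integrable_indicator_iff)
  have tr: "integrable \<mu> (\<lambda>y. indicator B (v + y) :: real) \<and> (LINT y|\<mu>. indicator B (v + y) :: real) = measure \<mu> B"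
    if B: "B \<in> sets borel" "emeasure \<mu> B < \<infinity>" for B v
  proof -
    have e: "(\<lambda>y. indicator B (v + y) :: real) = indicator ((\<lambda>y. v + y) -` B)" by (auto simp: indicator_def)
    have em: "emeasure \<mu> ((\<lambda>y. v + y) -` B) = emeasure \<mu> B" by (rule emeasure_translate[OF B(1)])
    have m: "(\<lambda>y. v + y) -` B \<in> sets borel" using measurable_sets[OF measurable_left_translation B(1)] by simp
    show ?thesis unfolding e using m em B by (simp add: integrable_indicator_iff measure_def)
  qed
  show ?thesis
  proof (rule that[OF neg_open_nhd[OF V(2,1)]])
    fix v assume v: "v \<in> V \<inter> uminus -` V"
    have pt: "\<bar>indicator A (v + y) - indicator A y\<bar> \<le>
        (indicator U (v + y) - indicator A (v + y)) + (indicator U (v + y) - indicator K (v + y)) +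
        ((indicator U y - indicator K y) + (indicator U y - indicator K (v + y))) + 
        ((indicator U y - indicator K y) + (indicator U y - indicator A y) :: real)" for y
    proof -
      have "v + y \<in> U" if "y \<in> K" using V(3) v that by auto
      moreover have "y \<in> U" if "v + y \<in> K"
      proof -
        have "(- v, v + y) \<in> ?W" using V(3) v that by auto
        then show ?thesis by (simp add: add.assoc[symmetric])
      qed
      ultimately show ?thesis using U(2) K(2) by (auto simp: indicator_def)
    qed
    note t = tr[OF Ub Uf] tr[OF Kb compact_finite[OF K(1)]] tr[OF A]
    note i = iU iK iA t[THEN conjunct1]
    have "(LINT y|\<mu>. \<bar>indicator A (v + y) - indicator A y\<bar>) \<le> (LINT y|\<mu>.
        (indicator U (v + y) - indicator A (v + y)) + (indicator U (v + y) - indicator K (v + y)) +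
        ((indicator U y - indicator K y) + (indicator U y - indicator K (v + y))) + 
        ((indicator U y - indicator K y) + (indicator U y - indicator A y) :: real))"
      by (intro integral_mono integrable_abs Bochner_Integration.integrable_add Bochner_Integration.integrable_diff i pt)
    also have "\<dots> = (measure \<mu> U - measure \<mu> A) + (measure \<mu> U - measure \<mu> K) + 
       ((measure \<mu> U - measure \<mu> K) + (measure \<mu> U - measure \<mu> K)) + 
       ((measure \<mu> U - measure \<mu> K) + (measure \<mu> U - measure \<mu> A))"
      using t i by (simp add: Bochner_Integration.integral_add Bochner_Integration.integral_diff)
    also have "\<dots> < \<epsilon>" using UA K(3) e unfolding d_def by linarith
    finally show "(LINT y|\<mu>. \<bar>indicator A (v + y) - indicator A y\<bar>) < \<epsilon>" .
  qed
qed

text \<open>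
  The property passes from indicator functions to sums and to \<open>L\<^sup>1\<close>-limits, because left
  translations preserve the \<open>L\<^sup>1\<close>-norm.
\<close>
lemma left_cont_L1:
  assumes "integrable \<mu> \<rho>" shows "left_cont \<rho>"
  using assms
proof (induction rule: integrable_induct)
  case (base A c)
  show ?case unfolding left_cont_def
  proof (intro allI impI)
    fix \<epsilon> :: real assume e: "0 < \<epsilon>"
    have "0 < \<epsilon> / (cmod c + 1)" using e by (simp add: add_nonneg_pos)
    from left_cont_indicator[OF _ base(2) this] base(1) obtain V where V: "open V" "0 \<in> V"
      "\<And>v. v \<in> V \<Longrightarrow> (LINT y|\<mu>. \<bar>indicator A (v + y) - indicator A y\<bar>) < \<epsilon> / (cmod c + 1)" by (metis sets_mu)
    have "(LINT y|\<mu>. cmod (indicator A (v + y) *\<^sub>R c - indicator A y *\<^sub>R c)) < \<epsilon>" if "v \<in> V" for v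
    proof -
      have "(LINT y|\<mu>. cmod (indicator A (v + y) *\<^sub>R c - indicator A y *\<^sub>R c)) = 
          (LINT y|\<mu>. \<bar>indicator A (v + y) - indicator A y\<bar>) * cmod c"
        by (simp add: scaleR_diff_left[symmetric])
      also have "\<dots> \<le> (LINT y|\<mu>. \<bar>indicator A (v + y) - indicator A y\<bar>) * (cmod c + 1)"
        by (intro mult_left_mono integral_nonneg_AE) auto
      also have "\<dots> < \<epsilon>" using V(3)[OF that] by (simp add: pos_less_divide_eq add_nonneg_pos)
      finally show ?thesis .
    qed
    then show "\<exists>V. open V \<and> 0 \<in> V \<and> (\<forall>v\<in>V. (LINT y|\<mu>. cmod (indicator A (v + y) *\<^sub>R c - indicator A y *\<^sub>R c)) < \<epsilon>)"
      by (intro exI[of _ V] conjI ballI V(1,2))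
  qed
next
  case (add f g)
  show ?case unfolding left_cont_def
  proof (intro allI impI)
    fix \<epsilon> :: real assume e: "0 < \<epsilon>"
    then have e2: "0 < \<epsilon> / 2" by simp
    obtain V where V: "open V" "0 \<in> V" "\<And>v. v \<in> V \<Longrightarrow> (LINT y|\<mu>. cmod (f (v + y) - f y)) < \<epsilon> / 2"
      by (rule left_contE[OF add.IH(1) e2]) (rule that; assumption)
    obtain W where W: "open W" "0 \<in> W" "\<And>v. v \<in> W \<Longrightarrow> (LINT y|\<mu>. cmod (g (v + y) - g y)) < \<epsilon> / 2"
      by (rule left_contE[OF add.IH(2) e2]) (rule that; assumption)
    have "(LINT y|\<mu>. cmod (f (v + y) + g (v + y) - (f y + g y))) < \<epsilon>" if v: "v \<in> V \<inter> W" for v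
    proof -
      have i: "integrable \<mu> (\<lambda>y. f (v + y))" "integrable \<mu> f" "integrable \<mu> (\<lambda>y. g (v + y))" "integrable \<mu> g"
        using add.hyps by (auto intro: integrable_translate)
      have "(LINT y|\<mu>. cmod (f (v + y) + g (v + y) - (f y + g y))) \<le> (LINT y|\<mu>. cmod (f (v + y) - f y) + cmod (g (v + y) - g y))"
      proof (intro integral_mono)
        fix y show "cmod (f (v + y) + g (v + y) - (f y + g y)) \<le> cmod (f (v + y) - f y) + cmod (g (v + y) - g y)"
          using norm_triangle_ineq[of "f (v + y) - f y" "g (v + y) - g y"] by (simp add: algebra_simps)
      qed (intro integrable_norm Bochner_Integration.integrable_add Bochner_Integration.integrable_diff i)+
      also have "\<dots> = (LINT y|\<mu>. cmod (f (v + y) - f y)) + (LINT y|\<mu>. cmod (g (v + y) - g y))"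
        by (intro Bochner_Integration.integral_add integrable_norm Bochner_Integration.integrable_diff i)
      also have "\<dots> < \<epsilon>" using V(3)[of v] W(3)[of v] v by simp
      finally show ?thesis .
    qed
    then show "\<exists>V. open V \<and> 0 \<in> V \<and> (\<forall>v\<in>V. (LINT y|\<mu>. cmod (f (v + y) + g (v + y) - (f y + g y))) < \<epsilon>)"
      using V(1,2) W(1,2) by (intro exI[of _ "V \<inter> W"] conjI ballI) auto
  qed
next
  case (lim f s)
  show ?case unfolding left_cont_def
  proof (intro allI impI)
    fix \<epsilon> :: real assume e: "0 < \<epsilon>"
    then have e3: "0 < \<epsilon> / 3" by simp
    have "(\<lambda>i. LINT y|\<mu>. cmod (s i y - f y)) \<longlonglongrightarrow> (LINT y|\<mu>. 0)"
    proof (rule integral_dominated_convergence[where w = "\<lambda>y. 3 * cmod (f y)"])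
      show "integrable \<mu> (\<lambda>y. 3 * cmod (f y))" using lim.hyps by auto
      show "AE x in \<mu>. (\<lambda>i. cmod (s i x - f x)) \<longlonglongrightarrow> 0"
        using lim.hyps(2) by (intro AE_I2) (auto intro!: tendsto_norm_zero LIM_zero)
      show "AE x in \<mu>. norm (cmod (s i x - f x)) \<le> 3 * cmod (f x)" for i
      proof (intro AE_I2)
        fix x have "cmod (s i x - f x) \<le> cmod (s i x) + cmod (f x)" by (rule norm_triangle_ineq4)
        then show "norm (cmod (s i x - f x)) \<le> 3 * cmod (f x)" using lim.hyps(3)[of x i] by simp
      qed
    qed (use lim.hyps(1,4) in \<open>auto intro!: borel_measurable_integrable\<close>)
    then have "eventually (\<lambda>i. (LINT y|\<mu>. cmod (s i y - f y)) < \<epsilon> / 3) sequentially"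
      using e by (intro order_tendstoD(2)[of _ "LINT y|\<mu>. 0"]) auto
    then obtain i where i: "(LINT y|\<mu>. cmod (s i y - f y)) < \<epsilon> / 3" by (auto simp: eventually_sequentially)
    obtain V where V: "open V" "0 \<in> V" "\<And>v. v \<in> V \<Longrightarrow> (LINT y|\<mu>. cmod (s i (v + y) - s i y)) < \<epsilon> / 3"
      by (rule left_contE[OF lim.IH[of i] e3]) (rule that; assumption)
    have "(LINT y|\<mu>. cmod (f (v + y) - f y)) < \<epsilon>" if v: "v \<in> V" for v
    proof -
      have it: "integrable \<mu> (\<lambda>y. f (v + y))" "integrable \<mu> f" "integrable \<mu> (\<lambda>y. s i (v + y))" "integrable \<mu> (s i)"
        using lim.hyps by (auto intro: integrable_translate)
      have sf: "integrable \<mu> (\<lambda>y. s i y - f y)" using it by auto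
      have "(LINT y|\<mu>. cmod (f (v + y) - f y)) \<le> (LINT y|\<mu>. cmod (s i (v + y) - f (v + y)) + cmod (s i (v + y) - s i y) + cmod (s i y - f y))"
      proof (intro integral_mono)
        fix y
        have "f (v + y) - f y = - (s i (v + y) - f (v + y)) + (s i (v + y) - s i y) + (s i y - f y)" by simp
        also have "cmod \<dots> \<le> cmod (s i (v + y) - f (v + y)) + cmod (s i (v + y) - s i y) + cmod (s i y - f y)"
          using norm_triangle_ineq[of "- (s i (v + y) - f (v + y)) + (s i (v + y) - s i y)" "s i y - f y"]
            norm_triangle_ineq[of "- (s i (v + y) - f (v + y))" "s i (v + y) - s i y"]
          unfolding norm_minus_cancel by linarith
        finally show "cmod (f (v + y) - f y) \<le> cmod (s i (v + y) - f (v + y)) + cmod (s i (v + y) - s i y) + cmod (s i y - f y)" .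
      qed (intro integrable_norm Bochner_Integration.integrable_add Bochner_Integration.integrable_diff it)+
      also have "\<dots> = (LINT y|\<mu>. cmod (s i (v + y) - f (v + y))) + (LINT y|\<mu>. cmod (s i (v + y) - s i y)) + (LINT y|\<mu>. cmod (s i y - f y))"
      proof -
        have n: "integrable \<mu> (\<lambda>y. cmod (s i (v + y) - f (v + y)))" "integrable \<mu> (\<lambda>y. cmod (s i (v + y) - s i y))"
          "integrable \<mu> (\<lambda>y. cmod (s i y - f y))"
          by (intro integrable_norm Bochner_Integration.integrable_diff it)+
        show ?thesis
          by (simp only: Bochner_Integration.integral_add[OF Bochner_Integration.integrable_add[OF n(1,2)] n(3)]
              Bochner_Integration.integral_add[OF n(1,2)])
      qed
      also have "(LINT y|\<mu>. cmod (s i (v + y) - f (v + y))) = (LINT y|\<mu>. cmod (s i y - f y))"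
      proof -
        have "(LINT y|\<mu>. complex_of_real (cmod (s i (v + y) - f (v + y)))) = (LINT y|\<mu>. complex_of_real (cmod (s i y - f y)))"
          using borel_measurable_integrable[OF sf] by (intro integral_translate[of "\<lambda>y. complex_of_real (cmod (s i y - f y))"]) simp
        then show ?thesis by simp
      qed
      finally show ?thesis using i V(3)[OF v] by simp
    qed
    then show "\<exists>V. open V \<and> 0 \<in> V \<and> (\<forall>v\<in>V. (LINT y|\<mu>. cmod (f (v + y) - f y)) < \<epsilon>)" by (intro exI[of _ V] conjI ballI V(1,2))
  qed
qed

lemma continuous_onI_translate:
  fixes g :: "'g \<Rightarrow> complex"
  assumes "\<And>x \<epsilon>. 0 < \<epsilon> \<Longrightarrow> \<exists>V. open V \<and> 0 \<in> V \<and> (\<forall>v\<in>V. cmod (g (v + x) - g x) < \<epsilon>)"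
  shows "continuous_on UNIV g"
  unfolding continuous_on_eq_continuous_at[OF open_UNIV]
proof
  fix x
  have "(g \<longlongrightarrow> g x) (at x)" unfolding tendsto_iff
  proof (intro allI impI)
    fix e :: real assume "0 < e"
    from assms[OF this, of x] obtain V where V: "open V" "0 \<in> V" "\<forall>v\<in>V. cmod (g (v + x) - g x) < e"
      by (elim exE conjE)
    have "open ((\<lambda>y. y + - x) -` V)" using V(1) by (intro open_vimage continuous_intros)
    moreover have "x \<in> (\<lambda>y. y + - x) -` V" using V(2) by simp
    moreover have "\<forall>y\<in>(\<lambda>y. y + - x) -` V. dist (g y) (g x) < e"
    proof
      fix y assume "y \<in> (\<lambda>y. y + - x) -` V"
      then have "cmod (g ((y + - x) + x) - g x) < e" by (intro V(3)[rule_format]) simp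
      then show "dist (g y) (g x) < e" by (simp add: dist_norm)
    qed
    ultimately have "eventually (\<lambda>y. dist (g y) (g x) < e) (nhds x)" unfolding eventually_nhds
      by (intro exI[of _ "(\<lambda>y. y + - x) -` V"] conjI)
    then show "eventually (\<lambda>y. dist (g y) (g x) < e) (at x)" by (simp add: eventually_nhds_conv_at)
  qed
  then show "isCont g x" unfolding isCont_def .
qed

text \<open>
  With the density \<open>\<rho>\<close> of the inverted \<open>a\<close>, the value at \<open>x\<close> is the integral of
  \<open>f(- z) \<rho>(x + z)\<close>, so that \<open>x\<close> enters only through a left translate of \<open>\<rho>\<close>.  The continuity of
  these translates in \<open>L\<^sup>1(G)\<close> is inherited.
\<close>
theorem act_continuous:
  assumes f: "bdd_lm f" and a: "a \<in> L1 \<mu>"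
  shows "continuous_on UNIV (act f a)"
proof (rule continuous_onI_translate)
  fix x0 and \<epsilon> :: real assume e: "0 < \<epsilon>"
  obtain T where T: "sc_subgroup T" "\<And>x. x \<notin> T \<Longrightarrow> a x = 0" by (rule common_support[OF a a]) (rule that; assumption)
  \<comment> \<open>The subgroup \<open>H\<close>, to which \<open>f\<close> is cut off, has to contain \<open>x0\<close> and its small left translates.\<close>
  have "sigma_compact (T \<union> {x0})" by (intro sigma_compact_Un sc_subgroup_sigma_compact T sigma_compact_compact) simp
  from sc_subgroup_pos[OF this] obtain H where H: "sc_subgroup H" "T \<union> {x0} \<subseteq> H" "\<exists>U. open U \<and> 0 \<in> U \<and> U \<subseteq> H" by metis
  obtain U where U: "open U" "0 \<in> U" "U \<subseteq> H" using H(3) by (elim exE conjE)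
  obtain c where c: "\<And>x. cmod (f x) \<le> c" using f by (auto simp: bdd_lm_def)
  have c0: "0 \<le> c" using order_trans[OF norm_ge_zero c] .
  obtain \<rho> where \<rho>: "\<rho> \<in> L1 \<mu>"
    "\<forall>f c. f \<in> borel_measurable borel \<longrightarrow> (\<forall>x. cmod (f x) \<le> c) \<longrightarrow> (LINT y|\<mu>. f (- y) * a y) = (LINT y|\<mu>. f y * \<rho> y)"
    using neg_density[OF a] by (elim bexE)
  have \<rho>i: "integrable \<mu> \<rho>" using \<rho>(1) by (simp add: L1_def)
  let ?f = "\<lambda>x. indicator H x * f x"
  have fm: "?f \<in> borel_measurable borel"
    using f H(1) by (intro locally_measurable_fun_cutoff sc_subgroup_sigma_compact) (auto simp: bdd_lm_def)
  have fc: "cmod (?f x) \<le> c" for x using c[of x] c0 by (auto simp: indicator_def)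
  have fmn: "(\<lambda>y. ?f (- y)) \<in> borel_measurable borel" by (rule measurable_compose[OF measurable_neg fm])
  have act: "act f a x = (LINT z|\<mu>. ?f (- z) * \<rho> (x + z))" if x: "x \<in> H" for x
  proof -
    have m: "(\<lambda>y. ?f (- y + x)) \<in> borel_measurable borel"
      by (rule measurable_compose[OF measurable_compose[OF measurable_neg measurable_right_translation] fm])
    have "act f a x = (LINT y|\<mu>. ?f (- (- y) + x) * a y)"
      unfolding act_def
    proof (intro Bochner_Integration.integral_cong refl)
      fix y show "f (y + x) * a y = ?f (- (- y) + x) * a y"
      proof (cases "y \<in> T")
        case True
        then have "y \<in> H" using H(2) by auto
        then have "y + x \<in> H" using x H(1) unfolding sc_subgroup_def by blast
        then show ?thesis by simp
      qed (simp add: T(2))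
    qed
    also have "\<dots> = (LINT y|\<mu>. ?f (- y + x) * \<rho> y)"
      by (rule \<rho>(2)[rule_format, OF m fc])
    also have "\<dots> = (LINT z|\<mu>. ?f (- (x + z) + x) * \<rho> (x + z))"
      by (rule integral_translate[symmetric]) (intro borel_measurable_times m L1_measurable \<rho>)
    also have "\<dots> = (LINT z|\<mu>. ?f (- z) * \<rho> (x + z))" by (simp add: minus_add add.assoc)
    finally show ?thesis .
  qed
  have "0 < \<epsilon> / (c + 1)" using e c0 by simp
  then obtain V where V: "open V" "0 \<in> V" "\<And>v. v \<in> V \<Longrightarrow> (LINT y|\<mu>. cmod (\<rho> (v + y) - \<rho> y)) < \<epsilon> / (c + 1)"
    by (rule left_contE[OF left_cont_L1[OF \<rho>i]]) (rule that; assumption)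
  have "cmod (act f a (v + x0) - act f a x0) < \<epsilon>" if v: "v \<in> V \<inter> U" for v
  proof -
    have x0: "x0 \<in> H" using H(2) by simp
    have "v \<in> H" using v U(3) by auto
    then have vx0: "v + x0 \<in> H" using x0 H(1) unfolding sc_subgroup_def by simp
    have i: "integrable \<mu> (\<lambda>z. ?f (- z) * \<rho> (x + z))" for x
    proof (rule L1_bounded_times[OF _ fmn fc])
      show "(\<lambda>z. \<rho> (x + z)) \<in> L1 \<mu>" using integrable_translate[OF \<rho>i] by (simp add: L1_def)
    qed
    have it: "integrable \<mu> (\<lambda>z. \<rho> (x + z))" for x by (rule integrable_translate[OF \<rho>i])
    have ic: "integrable \<mu> (\<lambda>y. cmod (\<rho> (v + y) - \<rho> y))" using it[of v] \<rho>i by auto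
    have ic': "integrable \<mu> (\<lambda>z. cmod (\<rho> (v + x0 + z) - \<rho> (x0 + z)))" 
      by (intro integrable_norm Bochner_Integration.integrable_diff it)
    have "act f a (v + x0) - act f a x0 = (LINT z|\<mu>. ?f (- z) * \<rho> (v + x0 + z) - ?f (- z) * \<rho> (x0 + z))"
      unfolding act[OF x0] act[OF vx0] by (rule Bochner_Integration.integral_diff[symmetric]) (rule i)+
    also have "cmod \<dots> \<le> (LINT z|\<mu>. c * cmod (\<rho> (v + x0 + z) - \<rho> (x0 + z)))"
    proof (rule norm_integral_le)
      fix z
      have "?f (- z) * \<rho> (v + x0 + z) - ?f (- z) * \<rho> (x0 + z) = ?f (- z) * (\<rho> (v + x0 + z) - \<rho> (x0 + z))"
        by (simp add: right_diff_distrib)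
      then show "cmod (?f (- z) * \<rho> (v + x0 + z) - ?f (- z) * \<rho> (x0 + z)) \<le> c * cmod (\<rho> (v + x0 + z) - \<rho> (x0 + z))"
        using mult_right_mono[OF fc norm_ge_zero] by (simp only: norm_mult)
    qed (intro Bochner_Integration.integrable_diff i integrable_mult_right ic')+
    also have "\<dots> = c * (LINT z|\<mu>. cmod (\<rho> (v + x0 + z) - \<rho> (x0 + z)))" by simp
    also have "(LINT z|\<mu>. cmod (\<rho> (v + x0 + z) - \<rho> (x0 + z))) = (LINT y|\<mu>. cmod (\<rho> (v + y) - \<rho> y))"
    proof -
      have "(LINT z|\<mu>. complex_of_real (cmod (\<rho> (v + (x0 + z)) - \<rho> (x0 + z)))) = (LINT y|\<mu>. complex_of_real (cmod (\<rho> (v + y) - \<rho> y)))"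
        using borel_measurable_integrable[OF ic] by (intro integral_translate[of "\<lambda>y. complex_of_real (cmod (\<rho> (v + y) - \<rho> y))"]) simp
      then show ?thesis by (simp add: add.assoc)
    qed
    also have "c * (LINT y|\<mu>. cmod (\<rho> (v + y) - \<rho> y)) \<le> (c + 1) * (LINT y|\<mu>. cmod (\<rho> (v + y) - \<rho> y))"
      by (intro mult_right_mono integral_nonneg_AE) auto
    also have "\<dots> < \<epsilon>" using V(3)[of v] v c0 by (simp add: pos_less_divide_eq mult.commute)
    finally show ?thesis .
  qed
  then show "\<exists>V. open V \<and> 0 \<in> V \<and> (\<forall>v\<in>V. cmod (act f a (v + x0) - act f a x0) < \<epsilon>)"
    using V(1,2) U(1,2) by (intro exI[of _ "V \<inter> U"] conjI ballI) auto
qed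

lemma continuous_bdd_lm:
  assumes "continuous_on UNIV f" "\<And>x. cmod (f x) \<le> c" shows "bdd_lm f"
  using assms unfolding bdd_lm_def by (auto intro!: borel_imp_locally_measurable borel_measurable_continuous_onI)

lemma act_bdd_lm: "bdd_lm f \<Longrightarrow> a \<in> L1 \<mu> \<Longrightarrow> bdd_lm (act f a)"
proof -
  assume f: "bdd_lm f" and a: "a \<in> L1 \<mu>"
  then obtain c where c: "\<And>x. cmod (f x) \<le> c" by (auto simp: bdd_lm_def)
  show ?thesis by (rule continuous_bdd_lm[OF act_continuous[OF f a] act_bound[OF f c a]])
qed

end

section \<open>The space \<open>L\<^sup>\<infinity>(G)\<close> and its dual\<close>

context haar_group
begin

lemma locally_null_mono:
  assumes "locally_null \<mu> A" "B \<subseteq> A" "locally_measurable_set \<mu> B" shows "locally_null \<mu> B"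
  unfolding locally_null_iff
proof (intro allI impI)
  fix K :: "'g set" assume K: "compact K"
  have "A \<inter> K \<in> null_sets \<mu>" using assms(1) K unfolding locally_null_iff by simp
  moreover have "B \<inter> K \<in> sets \<mu>" using assms(3) K unfolding locally_measurable_set_iff by simp
  moreover have "B \<inter> K \<subseteq> A \<inter> K" using assms(2) by auto
  ultimately show "B \<inter> K \<in> null_sets \<mu>" by (rule null_sets_subset)
qed

lemma locally_null_UN:
  assumes "\<And>n::nat. locally_null \<mu> (A n)" shows "locally_null \<mu> (\<Union>n. A n)"
  unfolding locally_null_iff
proof (intro allI impI)
  fix K :: "'g set" assume K: "compact K"
  have "(\<Union>n. A n) \<inter> K = (\<Union>n. A n \<inter> K)" by auto
  also have "\<dots> \<in> null_sets \<mu>" using assms K unfolding locally_null_iff by (intro null_sets_UN) simp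
  finally show "(\<Union>n. A n) \<inter> K \<in> null_sets \<mu>" .
qed

lemma locally_null_Un: "locally_null \<mu> A \<Longrightarrow> locally_null \<mu> B \<Longrightarrow> locally_null \<mu> (A \<union> B)"
  unfolding locally_null_iff by (auto simp: Int_Un_distrib2 simp del: sets_mu intro: null_sets.Un)

lemma locally_null_empty [simp]: "locally_null \<mu> {}" unfolding locally_null_iff by simp

lemma locally_measurable_fun_iff:
  "locally_measurable_fun \<mu> f \<longleftrightarrow> (\<forall>K. compact K \<longrightarrow> (\<lambda>x. indicator K x * f x) \<in> borel_measurable borel)"
  using locally_measurable_funI locally_measurable_fun_cutoff sigma_compact_compact by blast

lemma locally_measurable_comp:
  assumes f: "locally_measurable_fun \<mu> f" and \<phi>: "\<phi> \<in> borel_measurable borel"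
  shows "locally_measurable_fun \<mu> (\<lambda>x. \<phi> (f x))"
  unfolding locally_measurable_fun_def
proof
  fix V :: "complex set" assume "V \<in> sets borel"
  then have "\<phi> -` V \<in> sets borel" using measurable_sets[OF \<phi>] by simp
  then have "locally_measurable_set \<mu> (f -` (\<phi> -` V))" using f unfolding locally_measurable_fun_def by blast
  then show "locally_measurable_set \<mu> ((\<lambda>x. \<phi> (f x)) -` V)" by (simp add: vimage_def)
qed

lemma locally_measurable_add:
  assumes "locally_measurable_fun \<mu> f" "locally_measurable_fun \<mu> g"
  shows "locally_measurable_fun \<mu> (\<lambda>x. f x + g x)"
  using assms unfolding locally_measurable_fun_iff by (auto simp: distrib_left intro!: borel_measurable_add)

lemma locally_measurable_times:
  assumes "locally_measurable_fun \<mu> f" "locally_measurable_fun \<mu> g"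
  shows "locally_measurable_fun \<mu> (\<lambda>x. f x * g x)"
  unfolding locally_measurable_fun_iff
proof (intro allI impI)
  fix K :: "'g set" assume K: "compact K"
  have "(\<lambda>x. (indicator K x * f x) * (indicator K x * g x)) \<in> borel_measurable borel"
    using assms K unfolding locally_measurable_fun_iff
    by (intro borel_measurable_times[of "\<lambda>x. indicator K x * f x" _ "\<lambda>x. indicator K x * g x"]) simp_all
  also have "(\<lambda>x. (indicator K x * f x) * (indicator K x * g x)) = (\<lambda>x. indicator K x * (f x * g x))"
    by (intro ext, case_tac "x \<in> K") auto
  finally show "(\<lambda>x. indicator K x * (f x * g x)) \<in> borel_measurable borel" .
qed

lemma locally_measurable_const: "locally_measurable_fun \<mu> (\<lambda>x. c)"
  by (rule borel_imp_locally_measurable) simp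

lemma locally_measurable_preimage:
  "locally_measurable_fun \<mu> f \<Longrightarrow> V \<in> sets borel \<Longrightarrow> locally_measurable_set \<mu> (f -` V)"
  by (simp add: locally_measurable_fun_def)

lemma locally_measurable_level: 
  assumes "locally_measurable_fun \<mu> f" shows "locally_measurable_set \<mu> {x. c < cmod (f x)}"
proof -
  have "{z::complex. c < cmod z} \<in> sets borel" by measurable
  from locally_measurable_preimage[OF assms this] show ?thesis by (simp add: vimage_def)
qed

lemma locally_measurable_neq: 
  assumes "locally_measurable_fun \<mu> f" "locally_measurable_fun \<mu> g" shows "locally_measurable_set \<mu> {x. f x \<noteq> g x}"
proof -
  have "locally_measurable_fun \<mu> (\<lambda>x. f x + (-1) * g x)"
    by (intro locally_measurable_add locally_measurable_times locally_measurable_const assms)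
  from locally_measurable_level[OF this, of 0] show ?thesis by simp
qed

lemma Linf_D: "f \<in> Linf \<mu> \<Longrightarrow> locally_measurable_fun \<mu> f" by (simp add: Linf_def)

lemma Linf_norm_nonneg: "f \<in> Linf \<mu> \<Longrightarrow> 0 \<le> Linf_norm \<mu> f"
proof -
  assume "f \<in> Linf \<mu>"
  then obtain c where f: "locally_measurable_fun \<mu> f" and c: "locally_null \<mu> {x. c < cmod (f x)}" by (auto simp: Linf_def)
  have "locally_null \<mu> {x. max 0 c < cmod (f x)}"
    by (rule locally_null_mono[OF c _ locally_measurable_level[OF f]]) auto
  then have "max 0 c \<in> {c. 0 \<le> c \<and> locally_null \<mu> {x. c < cmod (f x)}}" by simp
  then have "{c. 0 \<le> c \<and> locally_null \<mu> {x. c < cmod (f x)}} \<noteq> {}" by (rule ex_in_conv[THEN iffD1, OF exI])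
  then show ?thesis unfolding Linf_norm_def by (rule cInf_greatest) simp
qed

lemma Linf_norm_le:
  assumes "0 \<le> c" "locally_null \<mu> {x. c < cmod (f x)}"
  shows "Linf_norm \<mu> f \<le> c"
  unfolding Linf_norm_def by (rule cInf_lower) (use assms in \<open>auto intro!: bdd_belowI[of _ 0]\<close>)

lemma Linf_norm_null:
  assumes "f \<in> Linf \<mu>" shows "locally_null \<mu> {x. Linf_norm \<mu> f < cmod (f x)}"
proof -
  obtain c where f: "locally_measurable_fun \<mu> f" and c: "locally_null \<mu> {x. c < cmod (f x)}" using assms by (auto simp: Linf_def)
  let ?S = "{c. 0 \<le> c \<and> locally_null \<mu> {x. c < cmod (f x)}}"
  have "locally_null \<mu> {x. max 0 c < cmod (f x)}"
    by (rule locally_null_mono[OF c _ locally_measurable_level[OF f]]) auto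
  then have "max 0 c \<in> ?S" by simp
  then have ne: "?S \<noteq> {}" by (rule ex_in_conv[THEN iffD1, OF exI])
  have "locally_null \<mu> {x. Linf_norm \<mu> f + inverse (Suc n) < cmod (f x)}" for n
  proof -
    have "Inf ?S < Linf_norm \<mu> f + inverse (Suc n)" by (simp add: Linf_norm_def)
    from cInf_lessD[OF ne this] obtain d where d: "d \<in> ?S" "d < Linf_norm \<mu> f + inverse (Suc n)" by blast
    then have "locally_null \<mu> {x. d < cmod (f x)}" by simp
    then show ?thesis by (rule locally_null_mono[OF _ _ locally_measurable_level[OF f]]) (use d(2) in auto)
  qed
  then have "locally_null \<mu> (\<Union>n. {x. Linf_norm \<mu> f + inverse (Suc n) < cmod (f x)})" by (rule locally_null_UN)
  then show ?thesis
  proof (rule locally_null_mono[OF _ _ locally_measurable_level[OF f]])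
    show "{x. Linf_norm \<mu> f < cmod (f x)} \<subseteq> (\<Union>n. {x. Linf_norm \<mu> f + inverse (Suc n) < cmod (f x)})"
    proof
      fix x assume "x \<in> {x. Linf_norm \<mu> f < cmod (f x)}"
      then obtain n where "inverse (real (Suc n)) < cmod (f x) - Linf_norm \<mu> f" 
        using reals_Archimedean[of "cmod (f x) - Linf_norm \<mu> f"] by auto
      then show "x \<in> (\<Union>n. {x. Linf_norm \<mu> f + inverse (Suc n) < cmod (f x)})" by (intro UN_I[of n]) auto
    qed
  qed
qed

definition aeq :: "('g \<Rightarrow> complex) \<Rightarrow> ('g \<Rightarrow> complex) \<Rightarrow> bool" where
  "aeq f g \<longleftrightarrow> locally_null \<mu> {x. f x \<noteq> g x}"

lemma aeq_refl [simp]: "aeq f f" by (simp add: aeq_def)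

lemma aeq_sym: "aeq f g \<Longrightarrow> aeq g f" unfolding aeq_def by (simp add: eq_commute)

lemma aeq_trans:
  assumes "aeq f g" "aeq g h" "f \<in> Linf \<mu>" "h \<in> Linf \<mu>" shows "aeq f h"
  unfolding aeq_def
  by (rule locally_null_mono[OF locally_null_Un[OF assms(1,2)[unfolded aeq_def]] _ locally_measurable_neq[OF assms(3,4)[THEN Linf_D]]]) auto

lemma bdd_lm_Linf: "bdd_lm f \<Longrightarrow> f \<in> Linf \<mu>"
proof -
  assume "bdd_lm f"
  then obtain c where "locally_measurable_fun \<mu> f" "\<And>x. cmod (f x) \<le> c" by (auto simp: bdd_lm_def)
  moreover from this(2) have "{x. c < cmod (f x)} = {}" by (auto simp: not_less)
  ultimately show "f \<in> Linf \<mu>" unfolding Linf_def mem_Collect_eq by (intro conjI exI[of _ c]) simp_all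
qed

lemma Linf_norm_bound:
  assumes "\<And>x. cmod (f x) \<le> c" shows "Linf_norm \<mu> f \<le> c"
proof (rule Linf_norm_le)
  show "0 \<le> c" using order_trans[OF norm_ge_zero assms] .
  have "{x. c < cmod (f x)} = {}" using assms by (auto simp: not_less)
  then show "locally_null \<mu> {x. c < cmod (f x)}" by simp
qed

text \<open>
  The values of modulus above the norm are replaced by \<open>0\<close>, which also keeps the zeros of \<open>f\<close>.
\<close>
lemma bounded_representative:
  assumes f: "f \<in> Linf \<mu>"
  obtains g where "bdd_lm g" "aeq f g" "\<And>x. cmod (g x) \<le> Linf_norm \<mu> f" "\<And>x. f x = 0 \<Longrightarrow> g x = 0"
proof -
  let ?c = "Linf_norm \<mu> f"
  let ?\<phi> = "\<lambda>z::complex. if cmod z \<le> ?c then z else 0"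
  let ?g = "\<lambda>x. ?\<phi> (f x)"
  have "?\<phi> \<in> borel_measurable borel" by measurable
  then have m: "locally_measurable_fun \<mu> ?g" by (rule locally_measurable_comp[OF Linf_D[OF f]])
  have b: "cmod (?g x) \<le> ?c" for x using Linf_norm_nonneg[OF f] by simp
  have ae: "aeq f ?g" unfolding aeq_def
    by (rule locally_null_mono[OF Linf_norm_null[OF f] _ locally_measurable_neq[OF Linf_D[OF f] m]]) (auto split: if_splits)
  show ?thesis
  proof (rule that[OF _ ae b])
    show "bdd_lm ?g" unfolding bdd_lm_def using m b by blast
  qed simp
qed

lemma Linf_add:
  assumes "f \<in> Linf \<mu>" "g \<in> Linf \<mu>"
  shows "(\<lambda>x. f x + g x) \<in> Linf \<mu>" "Linf_norm \<mu> (\<lambda>x. f x + g x) \<le> Linf_norm \<mu> f + Linf_norm \<mu> g"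
proof -
  have lm: "locally_measurable_fun \<mu> (\<lambda>x. f x + g x)" by (intro locally_measurable_add Linf_D assms)
  have n: "locally_null \<mu> {x. Linf_norm \<mu> f + Linf_norm \<mu> g < cmod (f x + g x)}"
  proof (rule locally_null_mono[OF locally_null_Un[OF assms[THEN Linf_norm_null]] _ locally_measurable_level[OF lm]])
    show "{x. Linf_norm \<mu> f + Linf_norm \<mu> g < cmod (f x + g x)} \<subseteq> {x. Linf_norm \<mu> f < cmod (f x)} \<union> {x. Linf_norm \<mu> g < cmod (g x)}"
    proof
      fix x assume "x \<in> {x. Linf_norm \<mu> f + Linf_norm \<mu> g < cmod (f x + g x)}"
      then show "x \<in> {x. Linf_norm \<mu> f < cmod (f x)} \<union> {x. Linf_norm \<mu> g < cmod (g x)}"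
        using norm_triangle_ineq[of "f x" "g x"] by auto
    qed
  qed
  show "(\<lambda>x. f x + g x) \<in> Linf \<mu>" unfolding Linf_def using lm n by blast
  show "Linf_norm \<mu> (\<lambda>x. f x + g x) \<le> Linf_norm \<mu> f + Linf_norm \<mu> g"
    by (rule Linf_norm_le[OF _ n]) (intro add_nonneg_nonneg Linf_norm_nonneg assms)
qed

lemma Linf_dominated:
  assumes g: "locally_measurable_fun \<mu> g" and f: "f \<in> Linf \<mu>" and c: "0 \<le> c" and le: "\<And>x. cmod (g x) \<le> c * cmod (f x)"
  shows "g \<in> Linf \<mu>" "Linf_norm \<mu> g \<le> c * Linf_norm \<mu> f"
proof -
  have n: "locally_null \<mu> {x. c * Linf_norm \<mu> f < cmod (g x)}"
  proof (rule locally_null_mono[OF Linf_norm_null[OF f] _ locally_measurable_level[OF g]])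
    show "{x. c * Linf_norm \<mu> f < cmod (g x)} \<subseteq> {x. Linf_norm \<mu> f < cmod (f x)}"
    proof
      fix x assume "x \<in> {x. c * Linf_norm \<mu> f < cmod (g x)}"
      then have "c * Linf_norm \<mu> f < c * cmod (f x)" using le[of x] by simp
      then show "x \<in> {x. Linf_norm \<mu> f < cmod (f x)}" using c by (simp add: mult_less_cancel_left)
    qed
  qed
  show "g \<in> Linf \<mu>" unfolding Linf_def using g n by blast
  show "Linf_norm \<mu> g \<le> c * Linf_norm \<mu> f"
    by (rule Linf_norm_le[OF _ n]) (intro mult_nonneg_nonneg c Linf_norm_nonneg f)
qed

lemma Linf_scale:
  assumes f: "f \<in> Linf \<mu>"
  shows "(\<lambda>x. c * f x) \<in> Linf \<mu>" "Linf_norm \<mu> (\<lambda>x. c * f x) \<le> cmod c * Linf_norm \<mu> f"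
  using Linf_dominated[OF locally_measurable_times[OF locally_measurable_const Linf_D[OF f]] f, of "cmod c" c]
  by (simp_all add: norm_mult)

lemma Linf_mult:
  assumes f: "f \<in> Linf \<mu>" and u: "locally_measurable_fun \<mu> u" "\<And>x. cmod (u x) \<le> c"
  shows "(\<lambda>x. u x * f x) \<in> Linf \<mu>" "Linf_norm \<mu> (\<lambda>x. u x * f x) \<le> c * Linf_norm \<mu> f"
  using Linf_dominated[OF locally_measurable_times[OF u(1) Linf_D[OF f]] f, of c] order_trans[OF norm_ge_zero u(2)] u(2)
  by (simp_all add: norm_mult mult_right_mono)

lemma Linf_indicator:
  assumes f: "f \<in> Linf \<mu>" and K: "compact K"
  shows "(\<lambda>x. indicator K x * f x) \<in> Linf \<mu>" "Linf_norm \<mu> (\<lambda>x. indicator K x * f x) \<le> Linf_norm \<mu> f"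
proof -
  have i: "locally_measurable_fun \<mu> (indicator K)"
    using compact_borel[OF K] by (intro borel_imp_locally_measurable) simp
  show "(\<lambda>x. indicator K x * f x) \<in> Linf \<mu>" "Linf_norm \<mu> (\<lambda>x. indicator K x * f x) \<le> Linf_norm \<mu> f"
    using Linf_mult[OF f i, of 1] by (auto simp: indicator_def)
qed

lemma Linf_zero: "(\<lambda>x. 0) \<in> Linf \<mu>" "Linf_norm \<mu> (\<lambda>x. 0) = 0"
proof -
  show "(\<lambda>x. 0) \<in> Linf \<mu>" by (rule bdd_lm_Linf) (auto simp: bdd_lm_def locally_measurable_const)
  from Linf_norm_nonneg[OF this] Linf_norm_bound[of "\<lambda>x. 0" 0] show "Linf_norm \<mu> (\<lambda>x. 0) = 0" by simp
qed

lemma Linf_diff: "f \<in> Linf \<mu> \<Longrightarrow> g \<in> Linf \<mu> \<Longrightarrow> (\<lambda>x. f x - g x) \<in> Linf \<mu>"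
  using Linf_add(1)[OF _ Linf_scale(1), of f g "-1"] by simp

lemma aeq_norm_zero:
  assumes "aeq f g" shows "Linf_norm \<mu> (\<lambda>x. f x - g x) \<le> 0"
  by (rule Linf_norm_le) (use assms in \<open>simp_all add: aeq_def\<close>)

text \<open>
  The involution of \<open>L\<^sup>\<infinity>(G)\<close> without a modular factor; it is isometric because inversion preserves
  the locally null sets.
\<close>
definition reflect :: "('g \<Rightarrow> complex) \<Rightarrow> 'g \<Rightarrow> complex" where
  "reflect f = (\<lambda>x. cnj (f (- x)))"

lemma reflect_reflect [simp]: "reflect (reflect f) = f" by (simp add: reflect_def)

lemma Linf_reflect:
  assumes f: "f \<in> Linf \<mu>" shows "reflect f \<in> Linf \<mu>" "Linf_norm \<mu> (reflect f) \<le> Linf_norm \<mu> f"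
proof -
  have "locally_measurable_fun \<mu> (\<lambda>x. f (- x))"
    by (intro locally_measurable_comp_continuous[OF Linf_D[OF f]] continuous_on_neg continuous_intros)
  then have lm: "locally_measurable_fun \<mu> (reflect f)" unfolding reflect_def
    by (rule locally_measurable_comp) (intro borel_measurable_continuous_onI continuous_intros)
  have n: "locally_null \<mu> {x. Linf_norm \<mu> f < cmod (reflect f x)}"
    using locally_null_neg[OF Linf_norm_null[OF f]] by (simp add: reflect_def)
  show "reflect f \<in> Linf \<mu>" unfolding Linf_def using lm n by blast
  show "Linf_norm \<mu> (reflect f) \<le> Linf_norm \<mu> f" by (rule Linf_norm_le[OF Linf_norm_nonneg[OF f] n])
qed

lemma Linf_reflect_iff: "reflect f \<in> Linf \<mu> \<longleftrightarrow> f \<in> Linf \<mu>"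
  using Linf_reflect(1)[of f] Linf_reflect(1)[of "reflect f"] by auto

section \<open>Bounded functionals on \<open>L\<^sup>\<infinity>(G)\<close>\<close>

lemma dual_add: "F \<in> Linf_dual \<mu> \<Longrightarrow> f \<in> Linf \<mu> \<Longrightarrow> g \<in> Linf \<mu> \<Longrightarrow> F (\<lambda>x. f x + g x) = F f + F g"
  by (simp add: Linf_dual_def)

lemma dual_scale: "F \<in> Linf_dual \<mu> \<Longrightarrow> f \<in> Linf \<mu> \<Longrightarrow> F (\<lambda>x. c * f x) = c * F f"
  by (simp add: Linf_dual_def)

lemma dual_outside: "F \<in> Linf_dual \<mu> \<Longrightarrow> f \<notin> Linf \<mu> \<Longrightarrow> F f = 0"
  by (simp add: Linf_dual_def)

lemma dual_diff: "F \<in> Linf_dual \<mu> \<Longrightarrow> f \<in> Linf \<mu> \<Longrightarrow> g \<in> Linf \<mu> \<Longrightarrow> F (\<lambda>x. f x - g x) = F f - F g"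
  using dual_add[of F f "\<lambda>x. (-1) * g x"] dual_scale[of F g "-1"] Linf_scale(1)[of g "-1"] by simp

lemma dual_bounded:
  assumes F: "F \<in> Linf_dual \<mu>"
  shows "bdd_above {cmod (F f) | f. f \<in> Linf \<mu> \<and> Linf_norm \<mu> f \<le> 1}" 
    "f \<in> Linf \<mu> \<Longrightarrow> cmod (F f) \<le> dual_norm \<mu> F * Linf_norm \<mu> f" "0 \<le> dual_norm \<mu> F"
proof -
  let ?S = "{cmod (F f) | f. f \<in> Linf \<mu> \<and> Linf_norm \<mu> f \<le> 1}"
  obtain C where C: "\<And>f. f \<in> Linf \<mu> \<Longrightarrow> cmod (F f) \<le> C * Linf_norm \<mu> f" using F unfolding Linf_dual_def by blast
  have bd: "cmod (F f) \<le> \<bar>C\<bar>" if "f \<in> Linf \<mu>" "Linf_norm \<mu> f \<le> 1" for f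
  proof -
    have "C * Linf_norm \<mu> f \<le> \<bar>C\<bar> * 1" using that Linf_norm_nonneg[OF that(1)] by (intro mult_mono) auto
    then show ?thesis using C[OF that(1)] by simp
  qed
  show bdd: "bdd_above ?S" by (rule bdd_aboveI[of _ "\<bar>C\<bar>"]) (use bd in blast)
  have up: "cmod (F f) \<le> dual_norm \<mu> F" if "f \<in> Linf \<mu>" "Linf_norm \<mu> f \<le> 1" for f
    unfolding dual_norm_def by (rule cSup_upper[OF _ bdd]) (use that in blast)
  show "0 \<le> dual_norm \<mu> F" using up[OF Linf_zero(1)] Linf_zero(2) norm_ge_zero[of "F (\<lambda>x. 0)"] by linarith
  show "cmod (F f) \<le> dual_norm \<mu> F * Linf_norm \<mu> f" if f: "f \<in> Linf \<mu>"
  proof (cases "Linf_norm \<mu> f = 0")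
    case True then show ?thesis using C[OF f] by simp
  next
    case False
    let ?n = "Linf_norm \<mu> f"
    have pos: "0 < ?n" using False Linf_norm_nonneg[OF f] by simp
    let ?g = "\<lambda>x. complex_of_real (inverse ?n) * f x"
    have "Linf_norm \<mu> ?g \<le> cmod (complex_of_real (inverse ?n)) * ?n" by (rule Linf_scale(2)[OF f])
    also have "\<dots> = 1" using pos by (simp only: norm_of_real) simp
    finally have le: "cmod (F ?g) \<le> dual_norm \<mu> F" by (intro up Linf_scale f)
    have "cmod (F ?g) = inverse ?n * cmod (F f)" unfolding dual_scale[OF F f] norm_mult norm_of_real using pos by simp
    from ord_eq_le_trans[OF this[symmetric] le] show ?thesis using pos by (simp add: field_simps)
  qed
qed

lemma dual_norm_le:
  assumes "0 \<le> C" "\<And>f. f \<in> Linf \<mu> \<Longrightarrow> cmod (F f) \<le> C * Linf_norm \<mu> f"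
  shows "dual_norm \<mu> F \<le> C"
  unfolding dual_norm_def
proof (rule cSup_least)
  show "{cmod (F f) | f. f \<in> Linf \<mu> \<and> Linf_norm \<mu> f \<le> 1} \<noteq> {}" using Linf_zero by force
  fix t assume "t \<in> {cmod (F f) | f. f \<in> Linf \<mu> \<and> Linf_norm \<mu> f \<le> 1}"
  then obtain f where f: "t = cmod (F f)" "f \<in> Linf \<mu>" "Linf_norm \<mu> f \<le> 1" by blast
  have "cmod (F f) \<le> C * Linf_norm \<mu> f" by (rule assms(2)[OF f(2)])
  also have "\<dots> \<le> C * 1" by (intro mult_left_mono f assms)
  finally show "t \<le> C" using f by simp
qed

lemma dual_cong:
  assumes F: "F \<in> Linf_dual \<mu>" and fg: "aeq f g" "f \<in> Linf \<mu>" "g \<in> Linf \<mu>"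
  shows "F f = F g"
proof -
  have "cmod (F (\<lambda>x. f x - g x)) \<le> dual_norm \<mu> F * Linf_norm \<mu> (\<lambda>x. f x - g x)"
    by (rule dual_bounded(2)[OF F Linf_diff[OF fg(2,3)]])
  also have "\<dots> \<le> dual_norm \<mu> F * 0" by (intro mult_left_mono aeq_norm_zero fg dual_bounded F)
  finally show ?thesis using dual_diff[OF F fg(2,3)] by simp
qed

lemma dual_approx:
  assumes F: "F \<in> Linf_dual \<mu>" and fg: "f \<in> Linf \<mu>" "g \<in> Linf \<mu>" and le: "\<And>x. cmod (f x - g x) \<le> \<epsilon>"
  shows "cmod (F f - F g) \<le> dual_norm \<mu> F * \<epsilon>"
proof -
  have "cmod (F (\<lambda>x. f x - g x)) \<le> dual_norm \<mu> F * Linf_norm \<mu> (\<lambda>x. f x - g x)"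
    by (rule dual_bounded(2)[OF F Linf_diff[OF fg]])
  also have "\<dots> \<le> dual_norm \<mu> F * \<epsilon>" by (intro mult_left_mono Linf_norm_bound le dual_bounded(3) F)
  finally show ?thesis by (simp add: dual_diff[OF F fg])
qed

lemma dual_sum:
  assumes F: "F \<in> Linf_dual \<mu>" and I: "finite I" and f: "\<And>i. i \<in> I \<Longrightarrow> f i \<in> Linf \<mu>"
  shows "(\<lambda>x. \<Sum>i\<in>I. f i x) \<in> Linf \<mu> \<and> F (\<lambda>x. \<Sum>i\<in>I. f i x) = (\<Sum>i\<in>I. F (f i))"
  using I f
proof (induction I rule: finite_induct)
  case empty
  then show ?case using dual_scale[OF F Linf_zero(1), of 0] Linf_zero(1) by simp
next
  case (insert i I)
  then have IH: "(\<lambda>x. \<Sum>i\<in>I. f i x) \<in> Linf \<mu>" "F (\<lambda>x. \<Sum>i\<in>I. f i x) = (\<Sum>i\<in>I. F (f i))" "f i \<in> Linf \<mu>" by auto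
  show ?case using insert.hyps Linf_add(1)[OF IH(3,1)] dual_add[OF F IH(3,1)] IH(2) by simp
qed

lemma Linf_dualI:
  assumes "\<And>f g. f \<in> Linf \<mu> \<Longrightarrow> g \<in> Linf \<mu> \<Longrightarrow> F (\<lambda>x. f x + g x) = F f + F g"
    "\<And>c f. f \<in> Linf \<mu> \<Longrightarrow> F (\<lambda>x. c * f x) = c * F f"
    "\<And>f. f \<in> Linf \<mu> \<Longrightarrow> cmod (F f) \<le> C * Linf_norm \<mu> f" "\<And>f. f \<notin> Linf \<mu> \<Longrightarrow> F f = 0"
  shows "F \<in> Linf_dual \<mu>"
  unfolding Linf_dual_def mem_Collect_eq using assms by (intro conjI ballI allI impI exI[of _ C]) auto

lemma dual_lincomb:
  assumes F: "F \<in> Linf_dual \<mu>" and G: "G \<in> Linf_dual \<mu>"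
  shows "(\<lambda>f. F f + c * G f) \<in> Linf_dual \<mu>" "dual_norm \<mu> (\<lambda>f. F f + c * G f) \<le> dual_norm \<mu> F + cmod c * dual_norm \<mu> G"
proof -
  have b: "cmod (F f + c * G f) \<le> (dual_norm \<mu> F + cmod c * dual_norm \<mu> G) * Linf_norm \<mu> f" if "f \<in> Linf \<mu>" for f
  proof -
    have "cmod (F f + c * G f) \<le> cmod (F f) + cmod c * cmod (G f)" using norm_triangle_ineq[of "F f" "c * G f"] by (simp add: norm_mult)
    also have "\<dots> \<le> dual_norm \<mu> F * Linf_norm \<mu> f + cmod c * (dual_norm \<mu> G * Linf_norm \<mu> f)"
      by (intro add_mono mult_left_mono dual_bounded(2) F G that) simp
    finally show ?thesis by (simp add: algebra_simps)
  qed
  show "(\<lambda>f. F f + c * G f) \<in> Linf_dual \<mu>"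
    by (rule Linf_dualI[OF _ _ b]) (simp_all add: dual_add dual_scale dual_outside F G algebra_simps)
  show "dual_norm \<mu> (\<lambda>f. F f + c * G f) \<le> dual_norm \<mu> F + cmod c * dual_norm \<mu> G"
    by (rule dual_norm_le[OF _ b]) (simp add: dual_bounded(3) F G)
qed

lemma dual_diff_closed: "F \<in> Linf_dual \<mu> \<Longrightarrow> G \<in> Linf_dual \<mu> \<Longrightarrow> (\<lambda>f. F f - G f) \<in> Linf_dual \<mu>"
  using dual_lincomb(1)[of F G "-1"] by simp

section \<open>The pairing between \<open>L\<^sup>\<infinity>(G)\<close> and \<open>L\<^sup>1(G)\<close>\<close>

definition nrm1 :: "('g \<Rightarrow> complex) \<Rightarrow> real" where "nrm1 a = (LINT x|\<mu>. cmod (a x))"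

lemma nrm1_nonneg [simp]: "0 \<le> nrm1 a" unfolding nrm1_def by (rule integral_nonneg_AE) simp

text \<open>
  Off a \<open>\<sigma>\<close>-compact set \<open>a\<close> vanishes, and within that set locally null sets are null.
\<close>
lemma aeq_AE:
  assumes "aeq f g" "a \<in> L1 \<mu>" shows "AE x in \<mu>. f x * a x = g x * a x"
proof -
  obtain H where H: "sc_subgroup H" "\<And>x. x \<notin> H \<Longrightarrow> a x = 0" by (rule common_support[OF assms(2,2)]) (rule that; assumption)
  have "{x. f x \<noteq> g x} \<inter> H \<in> null_sets \<mu>"
    using assms(1) H(1) unfolding aeq_def by (intro locally_null_sigma_compact sc_subgroup_sigma_compact)
  from AE_not_in[OF this] show ?thesis by eventually_elim (use H(2) in auto)
qed

lemma Linf_times_L1: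
  assumes f: "f \<in> Linf \<mu>" and a: "a \<in> L1 \<mu>"
  shows "integrable \<mu> (\<lambda>x. f x * a x)"
proof -
  obtain g where g: "bdd_lm g" "aeq f g" "\<And>x. cmod (g x) \<le> Linf_norm \<mu> f" by (rule bounded_representative[OF f]) (rule that; assumption)
  obtain H where H: "sc_subgroup H" "\<And>x. x \<notin> H \<Longrightarrow> a x = 0" by (rule common_support[OF a a]) (rule that; assumption)
  have e: "(\<lambda>x. f x * a x) = (\<lambda>x. (indicator H x * f x) * a x)" by (intro ext, case_tac "x \<in> H") (simp_all add: H(2))
  have m: "(\<lambda>x. f x * a x) \<in> borel_measurable \<mu>" unfolding e measurable_mu_iff
    by (intro borel_measurable_times locally_measurable_fun_cutoff Linf_D f sc_subgroup_sigma_compact H L1_measurable a)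
  show ?thesis
    by (rule integrable_cong_AE_imp[OF bdd_lm_times_L1[OF g(1) a] m]) (use aeq_AE[OF aeq_sym[OF g(2)] a] in simp)
qed

lemma pairing_cong:
  assumes "aeq f g" "f \<in> Linf \<mu>" "g \<in> Linf \<mu>" "a \<in> L1 \<mu>" shows "pairing \<mu> f a = pairing \<mu> g a"
  unfolding pairing_def
  by (rule integral_cong_AE) (use Linf_times_L1 aeq_AE assms in \<open>auto intro!: borel_measurable_integrable simp del: measurable_mu_iff\<close>)

lemma pairing_bound:
  assumes f: "f \<in> Linf \<mu>" and a: "a \<in> L1 \<mu>"
  shows "cmod (pairing \<mu> f a) \<le> Linf_norm \<mu> f * nrm1 a"
proof -
  obtain g where g: "bdd_lm g" "aeq f g" "\<And>x. cmod (g x) \<le> Linf_norm \<mu> f" by (rule bounded_representative[OF f]) (rule that; assumption)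
  have ai: "integrable \<mu> a" using a by (simp add: L1_def)
  have "pairing \<mu> f a = pairing \<mu> g a" by (rule pairing_cong[OF g(2) f bdd_lm_Linf[OF g(1)] a])
  also have "cmod \<dots> \<le> (LINT x|\<mu>. Linf_norm \<mu> f * cmod (a x))" unfolding pairing_def
  proof (rule norm_integral_le[OF bdd_lm_times_L1[OF g(1) a]])
    show "integrable \<mu> (\<lambda>x. Linf_norm \<mu> f * cmod (a x))" using ai by auto
    show "cmod (g x * a x) \<le> Linf_norm \<mu> f * cmod (a x)" for x unfolding norm_mult by (rule mult_right_mono[OF g(3)]) simp
  qed
  finally show ?thesis by (simp add: nrm1_def)
qed

lemma pairing_add_left:
  assumes f: "f \<in> Linf \<mu>" and g: "g \<in> Linf \<mu>" and a: "a \<in> L1 \<mu>"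
  shows "pairing \<mu> (\<lambda>x. f x + g x) a = pairing \<mu> f a + pairing \<mu> g a"
  unfolding pairing_def distrib_right
  by (rule Bochner_Integration.integral_add[OF Linf_times_L1[OF f a] Linf_times_L1[OF g a]])

lemma pairing_add_right:
  assumes f: "f \<in> Linf \<mu>" and a: "a \<in> L1 \<mu>" and b: "b \<in> L1 \<mu>"
  shows "pairing \<mu> f (\<lambda>x. a x + b x) = pairing \<mu> f a + pairing \<mu> f b"
  unfolding pairing_def distrib_left
  by (rule Bochner_Integration.integral_add[OF Linf_times_L1[OF f a] Linf_times_L1[OF f b]])

lemma pairing_scale:
  "pairing \<mu> (\<lambda>x. c * f x) a = c * pairing \<mu> f a" "pairing \<mu> f (\<lambda>x. c * a x) = c * pairing \<mu> f a"
  unfolding pairing_def by (simp_all add: mult.assoc mult.left_commute)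

lemma L1_indicator:
  assumes "A \<in> sets borel" "emeasure \<mu> A < \<infinity>" shows "(indicator A :: 'g \<Rightarrow> complex) \<in> L1 \<mu>" "nrm1 (indicator A) = measure \<mu> A"
proof -
  have "integrable \<mu> (indicator A :: 'g \<Rightarrow> real)" using assms by (simp add: integrable_indicator_iff)
  then have "integrable \<mu> (\<lambda>x. complex_of_real (indicator A x))" by simp
  then show "(indicator A :: 'g \<Rightarrow> complex) \<in> L1 \<mu>" by (simp add: L1_def of_real_indicator)
  have "nrm1 (indicator A) = (LINT x|\<mu>. indicator A x)" unfolding nrm1_def
    by (intro Bochner_Integration.integral_cong refl) (auto simp: indicator_def)
  then show "nrm1 (indicator A) = measure \<mu> A" using assms by simp
qed

text \<open>
  Test with the function of modulus one that turns \<open>g\<close> into \<open>|g|\<close>, restricted to the part of a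
  compact set on which \<open>|g| > C\<close>.
\<close>
lemma Linf_norm_by_duality:
  assumes h: "h \<in> Linf \<mu>" and C: "0 \<le> C" "\<And>a. a \<in> L1 \<mu> \<Longrightarrow> cmod (pairing \<mu> h a) \<le> C * nrm1 a"
  shows "Linf_norm \<mu> h \<le> C"
proof (rule Linf_norm_le[OF C(1)])
  obtain g where g: "bdd_lm g" "aeq h g" "\<And>x. cmod (g x) \<le> Linf_norm \<mu> h" by (rule bounded_representative[OF h]) (rule that; assumption)
  have gL: "g \<in> Linf \<mu>" by (rule bdd_lm_Linf[OF g(1)])
  have ng: "locally_null \<mu> {x. C < cmod (g x)}" unfolding locally_null_iff
  proof (intro allI impI)
    fix K :: "'g set" assume K: "compact K"
    let ?B = "{x. C < cmod (g x)} \<inter> K"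
    have B: "?B \<in> sets borel" using locally_measurable_level[OF Linf_D[OF gL]] K unfolding locally_measurable_set_iff by blast
    have "emeasure \<mu> ?B \<le> emeasure \<mu> K" using compact_borel[OF K] by (intro emeasure_mono) auto
    then have Bf: "emeasure \<mu> ?B < \<infinity>" using compact_finite[OF K] by (rule order.strict_trans1)
    note iB = L1_indicator[OF B Bf]
    define s where "s x = (if cmod (g x) = 0 then 0 else cnj (g x) / complex_of_real (cmod (g x)))" for x
    have "(\<lambda>z::complex. if cmod z = 0 then 0 else cnj z / complex_of_real (cmod z)) \<in> borel_measurable borel"
      by (intro measurable_If borel_measurable_divide) (auto intro!: borel_measurable_continuous_onI continuous_intros)
    from locally_measurable_comp[OF Linf_D[OF gL] this] have slm: "locally_measurable_fun \<mu> s" unfolding s_def .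
    have sb: "cmod (s x) \<le> 1" for x unfolding s_def by (simp add: norm_divide)
    have gs: "g x * s x = complex_of_real (cmod (g x))" for x
      unfolding s_def by (simp add: complex_norm_square[symmetric] power2_eq_square)
    have sL: "bdd_lm s" using slm sb by (auto simp: bdd_lm_def)
    let ?a = "\<lambda>x. s x * indicator ?B x"
    have a: "?a \<in> L1 \<mu>" using bdd_lm_times_L1[OF sL iB(1)] by (simp add: L1_def)
    have "nrm1 ?a \<le> measure \<mu> ?B" unfolding iB(2)[symmetric] nrm1_def
    proof (rule integral_mono)
      show "integrable \<mu> (\<lambda>x. cmod (?a x))" "integrable \<mu> (\<lambda>x. cmod (indicator ?B x))"
        using a iB(1) by (auto simp: L1_def)
      show "cmod (?a x) \<le> cmod (indicator ?B x)" for x using mult_right_mono[OF sb[of x], of "cmod (indicator ?B x)"] by (simp add: norm_mult)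
    qed
    then have "C * nrm1 ?a \<le> C * measure \<mu> ?B" by (intro mult_left_mono C)
    moreover have "cmod (pairing \<mu> h ?a) \<le> C * nrm1 ?a" by (rule C(2)[OF a])
    moreover have "pairing \<mu> h ?a = pairing \<mu> g ?a" by (rule pairing_cong[OF g(2) h gL a])
    moreover have ib: "integrable \<mu> (\<lambda>x. cmod (g x) * indicator ?B x)"
    proof -
      have "integrable \<mu> (\<lambda>x. cmod (g x * indicator ?B x))" using bdd_lm_times_L1[OF g(1) iB(1)] by (rule integrable_norm)
      also have "(\<lambda>x. cmod (g x * indicator ?B x)) = (\<lambda>x. cmod (g x) * indicator ?B x)"
        by (intro ext, case_tac "x \<in> ?B") simp_all
      finally show ?thesis .
    qed
    moreover have "pairing \<mu> g ?a = complex_of_real (LINT x|\<mu>. cmod (g x) * indicator ?B x)"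
    proof -
      have "pairing \<mu> g ?a = (LINT x|\<mu>. complex_of_real (cmod (g x) * indicator ?B x))" unfolding pairing_def
        by (intro Bochner_Integration.integral_cong refl) (simp add: mult.assoc[symmetric] gs of_real_indicator)
      then show ?thesis unfolding integral_complex_of_real .
    qed
    ultimately have le: "(LINT x|\<mu>. cmod (g x) * indicator ?B x) \<le> C * measure \<mu> ?B"
      using complex_Re_le_cmod[of "complex_of_real (LINT x|\<mu>. cmod (g x) * indicator ?B x)"] by simp
    have iC: "integrable \<mu> (\<lambda>x. C * indicator ?B x)" "(LINT x|\<mu>. C * indicator ?B x) = C * measure \<mu> ?B"
      using B Bf by (auto simp: integrable_indicator_iff)
    have id: "integrable \<mu> (\<lambda>x. cmod (g x) * indicator ?B x - C * indicator ?B x)"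
      by (rule Bochner_Integration.integrable_diff[OF ib iC(1)])
    have nn: "0 \<le> cmod (g x) * indicator ?B x - C * indicator ?B x" for x by (auto simp: indicator_def)
    have "(LINT x|\<mu>. cmod (g x) * indicator ?B x - C * indicator ?B x) \<le> 0"
      using Bochner_Integration.integral_diff[OF ib iC(1)] iC(2) le by simp
    moreover have "0 \<le> (LINT x|\<mu>. cmod (g x) * indicator ?B x - C * indicator ?B x)"
      by (rule integral_nonneg_AE[OF AE_I2[OF nn]])
    ultimately have "AE x in \<mu>. cmod (g x) * indicator ?B x - C * indicator ?B x = 0"
      using integral_nonneg_eq_0_iff_AE[OF id AE_I2[OF nn]] by simp
    then have "AE x in \<mu>. x \<notin> ?B" by eventually_elim (auto simp: indicator_def split: if_splits)
    then show "?B \<in> null_sets \<mu>" using B AE_iff_null_sets[of ?B \<mu>] by simp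
  qed
  show "locally_null \<mu> {x. C < cmod (h x)}"
    by (rule locally_null_mono[OF locally_null_Un[OF ng g(2)[unfolded aeq_def]] _ locally_measurable_level[OF Linf_D[OF h]]]) auto
qed

lemma Linf_unique:
  assumes f: "f \<in> Linf \<mu>" and g: "g \<in> Linf \<mu>" and eq: "\<And>a. a \<in> L1 \<mu> \<Longrightarrow> pairing \<mu> f a = pairing \<mu> g a"
  shows "aeq f g"
proof -
  let ?h = "\<lambda>x. f x - g x"
  have h: "?h \<in> Linf \<mu>" by (rule Linf_diff[OF f g])
  have "Linf_norm \<mu> ?h \<le> 0"
  proof (rule Linf_norm_by_duality[OF h])
    fix a assume a: "a \<in> L1 \<mu>"
    have "pairing \<mu> (\<lambda>x. f x + (-1) * g x) a = pairing \<mu> f a + (-1) * pairing \<mu> g a"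
      by (simp only: pairing_add_left[OF f Linf_scale(1)[OF g] a] pairing_scale(1))
    then show "cmod (pairing \<mu> ?h a) \<le> 0 * nrm1 a" using eq[OF a] by simp
  qed simp
  then have "Linf_norm \<mu> ?h = 0" using Linf_norm_nonneg[OF h] by simp
  then show ?thesis using Linf_norm_null[OF h] by (simp add: aeq_def)
qed

end

section \<open>The dual of \<open>L\<^sup>1(G)\<close>\<close>

context haar_group
begin

definition L1_functional :: "(('g \<Rightarrow> complex) \<Rightarrow> complex) \<Rightarrow> real \<Rightarrow> bool" where
  "L1_functional \<phi> C \<longleftrightarrow> 0 \<le> C \<and> (\<forall>a\<in>L1 \<mu>. \<forall>b\<in>L1 \<mu>. \<phi> (\<lambda>x. a x + b x) = \<phi> a + \<phi> b) \<and>
     (\<forall>c. \<forall>a\<in>L1 \<mu>. \<phi> (\<lambda>x. c * a x) = c * \<phi> a) \<and> (\<forall>a\<in>L1 \<mu>. cmod (\<phi> a) \<le> C * nrm1 a)"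

lemma L1_functional_diff:
  assumes \<phi>: "L1_functional \<phi> C" and a: "a \<in> L1 \<mu>" and b: "b \<in> L1 \<mu>"
  shows "\<phi> (\<lambda>x. a x - b x) = \<phi> a - \<phi> b" "cmod (\<phi> a - \<phi> b) \<le> C * nrm1 (\<lambda>x. a x - b x)"
proof -
  have b': "(\<lambda>x. (-1) * b x) \<in> L1 \<mu>" using b by (simp add: L1_def)
  have "\<phi> (\<lambda>x. a x + (-1) * b x) = \<phi> a + (-1) * \<phi> b"
    using \<phi> a b b' unfolding L1_functional_def by metis
  then show e: "\<phi> (\<lambda>x. a x - b x) = \<phi> a - \<phi> b" by simp
  have "(\<lambda>x. a x - b x) \<in> L1 \<mu>" using a b by (simp add: L1_def)
  then show "cmod (\<phi> a - \<phi> b) \<le> C * nrm1 (\<lambda>x. a x - b x)" 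
    using \<phi> unfolding L1_functional_def e[symmetric] by blast
qed

text \<open>
  The set function that sends \<open>A\<close> to the real or imaginary part of \<open>\<phi>(1\<^sub>A)\<close> is bounded by \<open>C \<mu>(A)\<close>.
  Adding \<open>C \<mu>(A)\<close> makes it a measure \<open>N\<close> between \<open>0\<close> and \<open>2 C \<mu>\<close>, with a Radon-Nikodym density
  between \<open>0\<close> and \<open>2 C\<close>; subtracting the constant \<open>C\<close> at the end leaves a density bounded by
  \<open>C\<close>.
\<close>
lemma density_on_finite_set:
  fixes s :: "complex \<Rightarrow> real"
  assumes \<phi>: "L1_functional \<phi> C" and P: "P \<in> sets borel" "emeasure \<mu> P < \<infinity>" and s: "s = Re \<or> s = Im"
  shows "\<exists>h :: 'g \<Rightarrow> real. h \<in> borel_measurable borel \<and> (\<forall>x. \<bar>h x\<bar> \<le> C) \<and>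
    (\<forall>A\<in>sets borel. A \<subseteq> P \<longrightarrow> (LINT x|\<mu>. h x * indicator A x) = s (\<phi> (indicator A)))"
proof -
  have C0: "0 \<le> C" using \<phi> by (simp add: L1_functional_def)
  have fin: "emeasure \<mu> A < \<infinity>" if "A \<subseteq> P" for A
  proof -
    have "emeasure \<mu> A \<le> emeasure \<mu> P" by (rule emeasure_mono[OF that]) (simp add: P)
    then show ?thesis using P(2) by (rule order.strict_trans1)
  qed
  note L1i = L1_indicator[OF _ fin]
  have sle: "\<bar>s z\<bar> \<le> cmod z" for z using s abs_Re_le_cmod abs_Im_le_cmod by auto
  have sadd: "s (z + w) = s z + s w" for z w using s by auto
  define r where "r A = C * measure \<mu> (A \<inter> P) + s (\<phi> (indicator (A \<inter> P)))" for A
  have PA: "A \<inter> P \<in> sets borel" "A \<inter> P \<subseteq> P" if "A \<in> sets borel" for A using that P by auto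
  have sb: "\<bar>s (\<phi> (indicator A))\<bar> \<le> C * measure \<mu> A" if "A \<in> sets borel" "A \<subseteq> P" for A
  proof -
    have "cmod (\<phi> (indicator A)) \<le> C * nrm1 (indicator A)" using \<phi> L1i(1)[OF that] unfolding L1_functional_def by blast
    then show ?thesis using sle[of "\<phi> (indicator A)"] L1i(2)[OF that] by simp
  qed
  have r0: "0 \<le> r A" and r2: "r A \<le> 2 * C * measure \<mu> (A \<inter> P)" if "A \<in> sets borel" for A
    using sb[OF PA[OF that]] unfolding r_def by (simp_all add: abs_le_iff)
  have radd: "r (A \<union> B) = r A + r B" if AB: "A \<in> sets borel" "B \<in> sets borel" "A \<inter> B = {}" for A B
  proof -
    have "indicator ((A \<union> B) \<inter> P) = (\<lambda>x. indicator (A \<inter> P) x + indicator (B \<inter> P) x :: complex)"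
    proof
      fix x show "indicator ((A \<union> B) \<inter> P) x = (indicator (A \<inter> P) x + indicator (B \<inter> P) x :: complex)"
        using AB(3) by (cases "x \<in> A"; cases "x \<in> B") (auto simp: indicator_def)
    qed
    then have "\<phi> (indicator ((A \<union> B) \<inter> P)) = \<phi> (indicator (A \<inter> P)) + \<phi> (indicator (B \<inter> P))"
      using \<phi> L1i(1)[OF PA[OF AB(1)]] L1i(1)[OF PA[OF AB(2)]] unfolding L1_functional_def by simp
    moreover have "measure \<mu> ((A \<union> B) \<inter> P) = measure \<mu> (A \<inter> P) + measure \<mu> (B \<inter> P)"
      unfolding Int_Un_distrib2 using AB P fin[of "A \<inter> P"] fin[of "B \<inter> P"]
      by (intro measure_Union) (auto simp: less_top)
    ultimately show ?thesis unfolding r_def by (simp add: sadd algebra_simps)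
  qed
  let ?\<nu> = "\<lambda>A. ennreal (r A)"
  have rempty: "r {} = 0" using radd[of "{}" "{}"] by simp
  have pos: "positive (sets borel) ?\<nu>" by (simp add: positive_def rempty)
  have "countably_additive (sets (borel :: 'g measure)) ?\<nu>"
  proof (rule sets.empty_continuous_imp_countably_additive[OF pos])
    show "additive (sets borel) ?\<nu>" unfolding additive_def
      by (auto simp: radd ennreal_plus[symmetric] r0 simp del: ennreal_plus)
    show "\<forall>A\<in>sets borel. ?\<nu> A \<noteq> \<infinity>" by simp
    fix A :: "nat \<Rightarrow> 'g set" assume A: "range A \<subseteq> sets borel" "decseq A" "(\<Inter>i. A i) = {}"
    have Ab: "A i \<in> sets borel" for i using A(1) by auto
    have "(\<lambda>i. measure \<mu> (A i \<inter> P)) \<longlonglongrightarrow> measure \<mu> (\<Inter>i. A i \<inter> P)"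
    proof (rule Lim_measure_decseq)
      show "range (\<lambda>i. A i \<inter> P) \<subseteq> sets \<mu>" using Ab P by auto
      show "decseq (\<lambda>i. A i \<inter> P)" using A(2) unfolding decseq_def by blast
      show "emeasure \<mu> (A i \<inter> P) \<noteq> \<infinity>" for i using fin[of "A i \<inter> P"] by simp
    qed
    also have "(\<Inter>i. A i \<inter> P) = {}" using A(3) by auto
    finally have "(\<lambda>i. 2 * C * measure \<mu> (A i \<inter> P)) \<longlonglongrightarrow> 2 * C * 0" by (intro tendsto_mult tendsto_const) simp
    then have "(\<lambda>i. 2 * C * measure \<mu> (A i \<inter> P)) \<longlonglongrightarrow> 0" by simp
    then have "(\<lambda>i. r (A i)) \<longlonglongrightarrow> 0"
      by (rule tendsto_sandwich[OF _ _ tendsto_const, rotated 2]) (use r0[OF Ab] r2[OF Ab] in auto)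
    then show "(\<lambda>i. ?\<nu> (A i)) \<longlonglongrightarrow> 0" using tendsto_ennrealI by fastforce
  qed
  note ca = this
  define N where "N = measure_of UNIV (sets borel) ?\<nu>"
  have setsN: "sets N = sets borel" unfolding N_def 
    using sets.sigma_sets_eq[of "borel :: 'g measure"] by (simp add: sets_measure_of_conv)
  have eN: "emeasure N A = ?\<nu> A" if "A \<in> sets borel" for A
    using emeasure_measure_of_sigma[OF sets.sigma_algebra_axioms[of "borel :: 'g measure"], of ?\<nu> A] pos ca that
    unfolding N_def by simp
  let ?M = "density \<mu> (indicator P)"
  have eM: "emeasure ?M A = emeasure \<mu> (A \<inter> P)" if "A \<in> sets borel" for A
  proof -
    have "emeasure ?M A = (\<integral>\<^sup>+x. indicator P x * indicator A x \<partial>\<mu>)"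
      using that P by (intro emeasure_density) auto
    also have "\<dots> = (\<integral>\<^sup>+x. indicator (A \<inter> P) x \<partial>\<mu>)" by (intro nn_integral_cong) (auto simp: indicator_def)
    also have "\<dots> = emeasure \<mu> (A \<inter> P)" using that P by (intro nn_integral_indicator) auto
    finally show ?thesis .
  qed
  interpret M: finite_measure ?M by (rule finite_measureI) (use eM[of UNIV] P in auto)
  have "absolutely_continuous ?M N" unfolding absolutely_continuous_def
  proof
    fix A assume A: "A \<in> null_sets ?M"
    then have Ab: "A \<in> sets borel" and "emeasure \<mu> (A \<inter> P) = 0" using eM[of A] by (auto simp: null_sets_def)
    then have "measure \<mu> (A \<inter> P) = 0" by (simp add: measure_def)
    then have "r A = 0" using r0[OF Ab] r2[OF Ab] by simp
    then show "A \<in> null_sets N" using Ab eN[OF Ab] setsN by (auto simp: null_sets_def)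
  qed
  then obtain k where k: "k \<in> borel_measurable ?M" "density ?M k = N" using M.Radon_Nikodym[of N] setsN by auto
  have km: "k \<in> borel_measurable borel" using k(1) by simp
  have rk: "ennreal (r A) = (\<integral>\<^sup>+x. k x * indicator A x \<partial>\<mu>)" if A: "A \<in> sets borel" "A \<subseteq> P" for A
  proof -
    have "ennreal (r A) = (\<integral>\<^sup>+x. k x * indicator A x \<partial>?M)"
      unfolding eN[OF A(1), symmetric] k(2)[symmetric] using km A by (intro emeasure_density) auto
    also have "\<dots> = (\<integral>\<^sup>+x. indicator P x * (k x * indicator A x) \<partial>\<mu>)" using km A P by (intro nn_integral_density) auto
    also have "\<dots> = (\<integral>\<^sup>+x. k x * indicator A x \<partial>\<mu>)" using A(2) by (intro nn_integral_cong) (auto simp: indicator_def)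
    finally show ?thesis .
  qed
  \<comment> \<open>the density of \<open>N\<close> is at most \<open>2 * C\<close> almost everywhere on \<open>P\<close>\<close>
  define k' where "k' x = min (2 * C) (enn2real (min (k x) (ennreal (2 * C))))" for x
  have k'm: "k' \<in> borel_measurable borel" unfolding k'_def using km by simp
  have k'b: "0 \<le> k' x" "k' x \<le> 2 * C" for x unfolding k'_def using C0 by auto
  let ?T = "{x. ennreal (2 * C) < k x} \<inter> P"
  have Tb: "?T \<in> sets borel" using km P by (intro sets.Int) simp_all
  have T: "?T \<in> null_sets \<mu>"
  proof -
    have "(\<integral>\<^sup>+x. k x * indicator ?T x \<partial>\<mu>) = ennreal (r ?T)" using rk[of ?T] Tb by simp
    also have "\<dots> \<le> ennreal (2 * C * measure \<mu> (?T \<inter> P))" by (intro ennreal_leI r2 Tb)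
    also have "\<dots> = ennreal (2 * C) * emeasure \<mu> ?T" using C0 fin[of ?T]
      by (simp add: ennreal_mult emeasure_eq_ennreal_measure Int_assoc)
    also have "\<dots> = (\<integral>\<^sup>+x. ennreal (2 * C) * indicator ?T x \<partial>\<mu>)" using Tb by (simp add: nn_integral_cmult_indicator)
    finally have le: "(\<integral>\<^sup>+x. k x * indicator ?T x \<partial>\<mu>) \<le> (\<integral>\<^sup>+x. ennreal (2 * C) * indicator ?T x \<partial>\<mu>)" .
    have finC: "(\<integral>\<^sup>+x. ennreal (2 * C) * indicator ?T x \<partial>\<mu>) \<noteq> \<infinity>"
      using Tb fin[of ?T] by (simp add: nn_integral_cmult_indicator ennreal_mult_eq_top_iff less_top[symmetric])
    have "(\<integral>\<^sup>+x. k x * indicator ?T x - ennreal (2 * C) * indicator ?T x \<partial>\<mu>) = 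
        (\<integral>\<^sup>+x. k x * indicator ?T x \<partial>\<mu>) - (\<integral>\<^sup>+x. ennreal (2 * C) * indicator ?T x \<partial>\<mu>)"
    proof (rule nn_integral_diff[OF _ _ finC])
      show "(\<lambda>x. k x * indicator ?T x) \<in> borel_measurable \<mu>" "(\<lambda>x. ennreal (2 * C) * indicator ?T x) \<in> borel_measurable \<mu>"
        using km Tb by auto
      show "AE x in \<mu>. ennreal (2 * C) * indicator ?T x \<le> k x * indicator ?T x" by (intro AE_I2) (auto simp: indicator_def)
    qed
    also have "\<dots> = 0" using order.strict_trans1[OF le] finC by (intro diff_eq_0_ennreal[OF _ le]) (simp add: less_top)
    finally have "AE x in \<mu>. k x * indicator ?T x - ennreal (2 * C) * indicator ?T x = 0"
      using km Tb by (subst (asm) nn_integral_0_iff_AE) auto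
    then have "AE x in \<mu>. x \<notin> ?T" by eventually_elim (auto simp: indicator_def diff_eq_0_iff_ennreal split: if_splits)
    then show ?thesis using AE_iff_null_sets[of ?T \<mu>] Tb by simp
  qed
  have k'k: "(\<integral>\<^sup>+x. ennreal (k' x * indicator A x) \<partial>\<mu>) = ennreal (r A)" if A: "A \<in> sets borel" "A \<subseteq> P" for A
    unfolding rk[OF A]
  proof (rule nn_integral_cong_AE)
    show "AE x in \<mu>. ennreal (k' x * indicator A x) = k x * indicator A x"
      using AE_not_in[OF T]
    proof eventually_elim
      case (elim x)
      show ?case
      proof (cases "x \<in> A")
        case True
        then have "k x \<le> ennreal (2 * C)" using elim A(2) by auto
        then have "ennreal (k' x) = k x" unfolding k'_def using C0
          by (cases "k x") (auto simp: min_def ennreal_le_iff top_unique split: if_splits)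
        then show ?thesis using True by simp
      qed simp
    qed
  qed
  show ?thesis
  proof (rule exI[of _ "\<lambda>x. k' x - C"], intro conjI allI ballI impI)
    show "(\<lambda>x. k' x - C) \<in> borel_measurable borel" using k'm by simp
    show "\<bar>k' x - C\<bar> \<le> C" for x using k'b[of x] by (simp add: abs_le_iff)
    fix A assume A: "A \<in> sets borel" "A \<subseteq> P"
    have iA: "integrable \<mu> (indicator A :: 'g \<Rightarrow> real)" using A fin[OF A(2)] by (simp add: integrable_indicator_iff)
    have ik: "integrable \<mu> (\<lambda>x. k' x * indicator A x)"
      by (rule integrableI_nonneg) (use k'm A k'b k'k[OF A] in \<open>auto simp: less_top\<close>)
    have "(LINT x|\<mu>. k' x * indicator A x) = r A"
      using integral_eq_nn_integral[of "\<lambda>x. k' x * indicator A x" \<mu>] k'k[OF A] k'm A k'b r0[OF A(1)] by simp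
    then have "(LINT x|\<mu>. k' x * indicator A x - C * indicator A x) = r A - C * measure \<mu> A"
      using ik iA A by (simp add: Bochner_Integration.integral_diff)
    moreover have "A \<inter> P = A" using A by auto
    ultimately show "(LINT x|\<mu>. (k' x - C) * indicator A x) = s (\<phi> (indicator A))"
      unfolding r_def by (simp add: left_diff_distrib)
  qed
qed

text \<open>
  The densities found on pieces of finite measure are patched together.  The result \<open>H\<close> is locally
  measurable since a compact set meets only countably many pieces.  The pairing with \<open>H\<close> and \<open>\<phi>\<close>
  agree at indicator functions of subsets of a piece, hence of sets of finite measure, which are
  exhausted by countably many pieces, and hence on \<open>L\<^sup>1(G)\<close> by density.
\<close>
theorem L1_dual:
  assumes \<phi>: "L1_functional \<phi> C"
  shows "\<exists>h\<in>Linf \<mu>. \<forall>a\<in>L1 \<mu>. pairing \<mu> h a = \<phi> a"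
proof -
  have C0: "0 \<le> C" using \<phi> by (simp add: L1_functional_def)
  obtain \<pi> :: "'g \<Rightarrow> 'g \<times> nat" where \<pi>: "\<And>i. \<pi> -` {i} \<in> sets borel" "\<And>i. emeasure \<mu> (\<pi> -` {i}) < \<infinity>"
    "\<And>B. B \<in> sets borel \<Longrightarrow> emeasure \<mu> B < \<infinity> \<Longrightarrow> countable (\<pi> ` B)"
    by (rule decomposition_into_finite_pieces) (rule that; assumption)
  have "\<forall>i. \<exists>h :: 'g \<Rightarrow> complex. h \<in> borel_measurable borel \<and> (\<forall>x. cmod (h x) \<le> 2 * C) \<and>
     (\<forall>A\<in>sets borel. A \<subseteq> \<pi> -` {i} \<longrightarrow> pairing \<mu> h (indicator A) = \<phi> (indicator A))"
  proof
    fix i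
    have "Re = Re \<or> Re = Im" by simp
    from density_on_finite_set[OF \<phi> \<pi>(1)[of i] \<pi>(2)[of i] this]
    obtain u where u: "u \<in> borel_measurable borel" "\<forall>x. \<bar>u x\<bar> \<le> C"
      "\<forall>A\<in>sets borel. A \<subseteq> \<pi> -` {i} \<longrightarrow> (LINT x|\<mu>. u x * indicator A x) = Re (\<phi> (indicator A))"
      by (elim exE conjE)
    have "Im = Re \<or> Im = Im" by simp
    from density_on_finite_set[OF \<phi> \<pi>(1)[of i] \<pi>(2)[of i] this]
    obtain v where v: "v \<in> borel_measurable borel" "\<forall>x. \<bar>v x\<bar> \<le> C"
      "\<forall>A\<in>sets borel. A \<subseteq> \<pi> -` {i} \<longrightarrow> (LINT x|\<mu>. v x * indicator A x) = Im (\<phi> (indicator A))"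
      by (elim exE conjE)
    let ?h = "\<lambda>x. complex_of_real (u x) + \<i> * complex_of_real (v x)"
    have hm: "?h \<in> borel_measurable borel" using u(1) v(1) by simp
    have hb: "cmod (?h x) \<le> 2 * C" for x
      using cmod_le[of "?h x"] u(2)[rule_format, of x] v(2)[rule_format, of x] by simp
    have "pairing \<mu> ?h (indicator A) = \<phi> (indicator A)" if A: "A \<in> sets borel" "A \<subseteq> \<pi> -` {i}" for A
    proof -
      have "emeasure \<mu> A \<le> emeasure \<mu> (\<pi> -` {i})" using \<pi>(1) by (intro emeasure_mono A) simp
      then have "emeasure \<mu> A < \<infinity>" using \<pi>(2) by (rule order.strict_trans1)
      note L = L1_indicator(1)[OF A(1) this]
      have int: "integrable \<mu> (\<lambda>x. ?h x * indicator A x)" by (rule L1_bounded_times[OF L hm hb])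
      have "Re (pairing \<mu> ?h (indicator A)) = (LINT x|\<mu>. Re (?h x * indicator A x))" unfolding pairing_def
        by (rule integral_Re[OF int, symmetric])
      also have "\<dots> = (LINT x|\<mu>. u x * indicator A x)" by (intro Bochner_Integration.integral_cong refl) (auto simp: indicator_def)
      finally have re: "Re (pairing \<mu> ?h (indicator A)) = Re (\<phi> (indicator A))" using u(3)[rule_format, OF A] by simp
      have "Im (pairing \<mu> ?h (indicator A)) = (LINT x|\<mu>. Im (?h x * indicator A x))" unfolding pairing_def
        by (rule integral_Im[OF int, symmetric])
      also have "\<dots> = (LINT x|\<mu>. v x * indicator A x)" by (intro Bochner_Integration.integral_cong refl) (auto simp: indicator_def)
      finally have im: "Im (pairing \<mu> ?h (indicator A)) = Im (\<phi> (indicator A))" using v(3)[rule_format, OF A] by simp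
      show ?thesis by (rule complex_eqI[OF re im])
    qed
    then show "\<exists>h :: 'g \<Rightarrow> complex. h \<in> borel_measurable borel \<and> (\<forall>x. cmod (h x) \<le> 2 * C) \<and>
       (\<forall>A\<in>sets borel. A \<subseteq> \<pi> -` {i} \<longrightarrow> pairing \<mu> h (indicator A) = \<phi> (indicator A))"
      using hm hb by (intro exI[of _ ?h] conjI ballI allI impI)
  qed
  from choice[OF this] obtain h where h: "\<forall>i. h i \<in> borel_measurable borel \<and> (\<forall>x. cmod (h i x) \<le> 2 * C) \<and>
     (\<forall>A\<in>sets borel. A \<subseteq> \<pi> -` {i} \<longrightarrow> pairing \<mu> (h i) (indicator A) = \<phi> (indicator A))" by (rule exE)
  define H where "H x = h (\<pi> x) x" for x
  have Hb: "cmod (H x) \<le> 2 * C" for x unfolding H_def using h by blast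
  have "locally_measurable_fun \<mu> H" unfolding locally_measurable_fun_def locally_measurable_set_iff
  proof (intro ballI allI impI)
    fix V :: "complex set" and K :: "'g set" assume V: "V \<in> sets borel" and K: "compact K"
    have J: "countable (\<pi> ` K)" by (rule \<pi>(3)[OF compact_borel[OF K] compact_finite[OF K]])
    have "H -` V \<inter> K = (\<Union>i\<in>\<pi> ` K. h i -` V \<inter> \<pi> -` {i} \<inter> K)" unfolding H_def by auto
    also have "\<dots> \<in> sets borel"
    proof (rule sets.countable_UN'[OF J], rule image_subsetI)
      fix i assume "i \<in> \<pi> ` K"
      show "h i -` V \<inter> \<pi> -` {i} \<inter> K \<in> sets borel"
        using measurable_sets[of "h i" borel borel V] h V \<pi>(1) compact_borel[OF K] by (intro sets.Int) auto
    qed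
    finally show "H -` V \<inter> K \<in> sets borel" .
  qed
  then have Hl: "bdd_lm H" unfolding bdd_lm_def using Hb by blast
  have HL: "H \<in> Linf \<mu>" by (rule bdd_lm_Linf[OF Hl])
  have n2: "Linf_norm \<mu> H \<le> 2 * C" by (rule Linf_norm_bound[OF Hb])
  have H\<phi>: "L1_functional (pairing \<mu> H) (2 * C)" unfolding L1_functional_def
  proof (intro conjI ballI allI)
    fix a assume a: "a \<in> L1 \<mu>"
    show "cmod (pairing \<mu> H a) \<le> 2 * C * nrm1 a"
      by (rule order_trans[OF pairing_bound[OF HL a] mult_right_mono[OF n2 nrm1_nonneg]])
  qed (use C0 pairing_add_right[OF HL] pairing_scale(2) in simp_all)
  have piece: "pairing \<mu> H (indicator A) = \<phi> (indicator A)" if A: "A \<in> sets borel" "A \<subseteq> \<pi> -` {i}" for A i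
  proof -
    have "pairing \<mu> H (indicator A) = pairing \<mu> (h i) (indicator A)" unfolding pairing_def
      by (intro Bochner_Integration.integral_cong refl) (use A(2) in \<open>auto simp: indicator_def H_def\<close>)
    then show ?thesis using h A by simp
  qed
  have base: "pairing \<mu> H (indicator B) = \<phi> (indicator B)" if B: "B \<in> sets borel" "emeasure \<mu> B < \<infinity>" for B
  proof -
    have J: "countable (\<pi> ` B)" by (rule \<pi>(3)[OF B])
    \<comment> \<open>The pieces that meet \<open>B\<close> are numbered; \<open>E n\<close> is the part of \<open>B\<close> in the \<open>n\<close>th piece and \<open>D n\<close> its
      part in the earlier ones.\<close>
    define ix where "ix x = to_nat_on (\<pi> ` B) (\<pi> x)" for x
    define E where "E n = {x\<in>B. ix x = n}" for n
    define D where "D n = {x\<in>B. ix x < n}" for n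
    have Esub: "\<exists>i. E n \<subseteq> \<pi> -` {i} \<and> E n \<in> sets borel" for n
    proof (cases "E n = {}")
      case False
      then obtain z where z: "z \<in> B" "ix z = n" by (auto simp: E_def)
      have "E n = B \<inter> \<pi> -` {\<pi> z}"
      proof (intro set_eqI iffI)
        fix x assume "x \<in> E n"
        then have x: "x \<in> B" "ix x = ix z" using z by (auto simp: E_def)
        then have "\<pi> x = \<pi> z" unfolding ix_def using z(1) J by (subst (asm) to_nat_on_inj) auto
        then show "x \<in> B \<inter> \<pi> -` {\<pi> z}" using x by simp
      next
        fix x assume "x \<in> B \<inter> \<pi> -` {\<pi> z}"
        then show "x \<in> E n" using z by (auto simp: E_def ix_def)
      qed
      then show ?thesis using B(1) \<pi>(1)[of "\<pi> z"] by (intro exI[of _ "\<pi> z"]) (simp add: sets.Int)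
    qed auto
    have Eb: "E n \<in> sets borel" for n using Esub by blast
    have DS: "D (Suc n) = D n \<union> E n" "D n \<inter> E n = {}" for n unfolding D_def E_def by auto
    have Db: "D n \<in> sets borel" for n by (induction n) (simp add: D_def, simp add: DS Eb sets.Un)
    have fin: "emeasure \<mu> A < \<infinity>" if "A \<subseteq> B" for A
      by (rule order.strict_trans1[OF emeasure_mono[OF that] B(2)]) (simp add: B)
    have DL: "indicator (D n) \<in> L1 \<mu>" for n by (rule L1_indicator(1)[OF Db fin]) (auto simp: D_def)
    have EL: "indicator (E n) \<in> L1 \<mu>" for n by (rule L1_indicator(1)[OF Eb fin]) (auto simp: E_def)
    have BL: "indicator B \<in> L1 \<mu>" by (rule L1_indicator(1)[OF B])
    have Deq: "pairing \<mu> H (indicator (D n)) = \<phi> (indicator (D n))" for n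
    proof (induction n)
      case 0
      \<comment> \<open>The set \<open>D 0\<close> is empty and so lies in any piece.\<close>
      show ?case by (rule piece[where i = "undefined"]) (simp_all add: D_def)
    next
      case (Suc n)
      have e: "indicator (D (Suc n)) = (\<lambda>x. indicator (D n) x + indicator (E n) x :: complex)"
      proof
        fix x show "indicator (D (Suc n)) x = (indicator (D n) x + indicator (E n) x :: complex)"
          unfolding DS(1) using DS(2)[of n] by (cases "x \<in> D n"; cases "x \<in> E n") (auto simp: indicator_def)
      qed
      obtain i where i: "E n \<subseteq> \<pi> -` {i}" using Esub by blast
      show ?case unfolding e using H\<phi> \<phi> DL[of n] EL[of n] Suc.IH piece[OF Eb i] unfolding L1_functional_def by simp
    qed
    have "(\<lambda>n. measure \<mu> (B - D n)) \<longlonglongrightarrow> measure \<mu> (\<Inter>n. B - D n)"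
    proof (rule Lim_measure_decseq)
      show "range (\<lambda>n. B - D n) \<subseteq> sets \<mu>" using B Db by auto
      show "decseq (\<lambda>n. B - D n)" unfolding decseq_def D_def by auto
      show "emeasure \<mu> (B - D n) \<noteq> \<infinity>" for n using fin[of "B - D n"] by auto
    qed
    also have "(\<Inter>n. B - D n) = {}" unfolding D_def by auto
    finally have lim0: "(\<lambda>n. measure \<mu> (B - D n)) \<longlonglongrightarrow> 0" by simp
    have lim: "(\<lambda>n. \<psi> (indicator (D n))) \<longlonglongrightarrow> \<psi> (indicator B)" if \<psi>: "L1_functional \<psi> c" for \<psi> c
    proof (rule LIM_zero_cancel, rule tendsto_0_le)
      show "(\<lambda>n. measure \<mu> (B - D n)) \<longlonglongrightarrow> 0" by (rule lim0)
      show "\<forall>\<^sub>F n in sequentially. norm (\<psi> (indicator (D n)) - \<psi> (indicator B)) \<le> norm (measure \<mu> (B - D n)) * c"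
      proof (rule always_eventually, rule allI)
        fix n
        have "(\<lambda>x. indicator B x - indicator (D n) x) = (indicator (B - D n) :: 'g \<Rightarrow> complex)"
        proof
          fix x show "indicator B x - indicator (D n) x = (indicator (B - D n) x :: complex)"
            by (cases "x \<in> B"; cases "x \<in> D n") (auto simp: indicator_def D_def)
        qed
        then have "nrm1 (\<lambda>x. indicator B x - indicator (D n) x) = measure \<mu> (B - D n)"
          using L1_indicator(2)[of "B - D n"] B(1) Db fin[of "B - D n"] by simp
        then show "norm (\<psi> (indicator (D n)) - \<psi> (indicator B)) \<le> norm (measure \<mu> (B - D n)) * c"
          using L1_functional_diff(2)[OF \<psi> BL DL[of n]] by (simp add: norm_minus_commute mult.commute)
      qed
    qed
    show ?thesis
      by (rule LIMSEQ_unique[OF lim[OF H\<phi>]]) (unfold Deq, rule lim[OF \<phi>])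
  qed
  have all: "pairing \<mu> H a = \<phi> a" if "integrable \<mu> a" for a
    using that
  proof (induction rule: integrable_induct)
    case (base A c)
    then have A: "A \<in> sets borel" "emeasure \<mu> A < \<infinity>" by auto
    have e: "(\<lambda>x. indicator A x *\<^sub>R c) = (\<lambda>x. c * indicator A x)" by (auto simp: indicator_def)
    show ?case unfolding e using H\<phi> \<phi> L1_indicator(1)[OF A] \<open>\<And>B. B \<in> sets borel \<Longrightarrow> emeasure \<mu> B < \<infinity> \<Longrightarrow> pairing \<mu> H (indicator B) = \<phi> (indicator B)\<close>[OF A]
      unfolding L1_functional_def by simp
  next
    case (add f g)
    then show ?case using H\<phi> \<phi> unfolding L1_functional_def L1_def by simp
  next
    case (lim f s)
    have f: "f \<in> L1 \<mu>" and s: "s i \<in> L1 \<mu>" for i using lim.hyps by (auto simp: L1_def)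
    have "(\<lambda>i. LINT y|\<mu>. cmod (f y - s i y)) \<longlonglongrightarrow> (LINT y|\<mu>. 0)"
    proof (rule integral_dominated_convergence[where w = "\<lambda>y. 3 * cmod (f y)"])
      show "integrable \<mu> (\<lambda>y. 3 * cmod (f y))" using lim.hyps by auto
      show "AE x in \<mu>. (\<lambda>i. cmod (f x - s i x)) \<longlonglongrightarrow> 0"
      proof (rule AE_I2)
        fix x
        have "(\<lambda>i. s i x) \<longlonglongrightarrow> f x" by (rule lim.hyps(2)) simp
        then have "(\<lambda>i. f x - s i x) \<longlonglongrightarrow> f x - f x" by (intro tendsto_diff tendsto_const)
        then show "(\<lambda>i. cmod (f x - s i x)) \<longlonglongrightarrow> 0" by (intro tendsto_norm_zero) simp
      qed
      show "AE x in \<mu>. norm (cmod (f x - s i x)) \<le> 3 * cmod (f x)" for i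
      proof (intro AE_I2)
        fix x have "cmod (f x - s i x) \<le> cmod (f x) + cmod (s i x)" by (rule norm_triangle_ineq4)
        then show "norm (cmod (f x - s i x)) \<le> 3 * cmod (f x)" using lim.hyps(3)[of x i] by simp
      qed
    qed (use lim.hyps(1,4) in \<open>auto intro!: borel_measurable_integrable\<close>)
    then have n0: "(\<lambda>i. nrm1 (\<lambda>y. f y - s i y)) \<longlonglongrightarrow> 0" unfolding nrm1_def by simp
    have lims: "(\<lambda>i. \<psi> (s i)) \<longlonglongrightarrow> \<psi> f" if \<psi>: "L1_functional \<psi> c" for \<psi> c
    proof (rule LIM_zero_cancel, rule tendsto_0_le[OF n0])
      show "\<forall>\<^sub>F i in sequentially. norm (\<psi> (s i) - \<psi> f) \<le> norm (nrm1 (\<lambda>y. f y - s i y)) * c"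
        using L1_functional_diff(2)[OF \<psi> f s] by (intro always_eventually) (simp add: norm_minus_commute mult.commute)
    qed
    show ?case by (rule LIMSEQ_unique[OF lims[OF H\<phi>]]) (unfold lim.IH, rule lims[OF \<phi>])
  qed
  show ?thesis using HL all by (intro bexI[of _ H] ballI) (auto simp: L1_def)
qed

end

section \<open>The first Arens product\<close>

context haar_group
begin

lemma L1_add: "a \<in> L1 \<mu> \<Longrightarrow> b \<in> L1 \<mu> \<Longrightarrow> (\<lambda>x. a x + b x) \<in> L1 \<mu>"
  by (simp add: L1_def)

lemma L1_scale: "a \<in> L1 \<mu> \<Longrightarrow> (\<lambda>x. c * a x) \<in> L1 \<mu>"
  by (simp add: L1_def)

lemma nrm1_scale: "nrm1 (\<lambda>x. c * a x) = cmod c * nrm1 a"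
  by (simp add: nrm1_def norm_mult)

lemma Linf_rep:
  assumes "L1_functional \<phi> C"
  shows "Linf_rep \<mu> \<phi> \<in> Linf \<mu>" "a \<in> L1 \<mu> \<Longrightarrow> pairing \<mu> (Linf_rep \<mu> \<phi>) a = \<phi> a"
proof -
  have "\<exists>h. h \<in> Linf \<mu> \<and> (\<forall>a\<in>L1 \<mu>. pairing \<mu> h a = \<phi> a)" using L1_dual[OF assms] by blast
  from someI_ex[OF this] have *: "Linf_rep \<mu> \<phi> \<in> Linf \<mu> \<and> (\<forall>a\<in>L1 \<mu>. pairing \<mu> (Linf_rep \<mu> \<phi>) a = \<phi> a)"
    unfolding Linf_rep_def .
  show "Linf_rep \<mu> \<phi> \<in> Linf \<mu>" "a \<in> L1 \<mu> \<Longrightarrow> pairing \<mu> (Linf_rep \<mu> \<phi>) a = \<phi> a" using * by blast+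
qed

lemma bdd_lm_add: "bdd_lm f \<Longrightarrow> bdd_lm g \<Longrightarrow> bdd_lm (\<lambda>x. f x + g x)"
proof -
  assume f: "bdd_lm f" and g: "bdd_lm g"
  obtain c d where "\<And>x. cmod (f x) \<le> c" "\<And>x. cmod (g x) \<le> d" using f g by (auto simp: bdd_lm_def)
  then have "cmod (f x + g x) \<le> c + d" for x by (intro norm_triangle_mono)
  then show ?thesis using f g by (auto simp: bdd_lm_def intro: locally_measurable_add)
qed

lemma bdd_lm_scale: "bdd_lm f \<Longrightarrow> bdd_lm (\<lambda>x. c * f x)"
proof -
  assume f: "bdd_lm f"
  obtain d where "\<And>x. cmod (f x) \<le> d" using f by (auto simp: bdd_lm_def)
  then have "cmod (c * f x) \<le> cmod c * d" for x by (simp add: norm_mult mult_left_mono)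
  then show ?thesis using f by (auto simp: bdd_lm_def intro: locally_measurable_times locally_measurable_const)
qed

lemma aeq_add:
  assumes "aeq f g" "aeq f' g'" "f \<in> Linf \<mu>" "g \<in> Linf \<mu>" "f' \<in> Linf \<mu>" "g' \<in> Linf \<mu>"
  shows "aeq (\<lambda>x. f x + f' x) (\<lambda>x. g x + g' x)"
  unfolding aeq_def
  by (rule locally_null_mono[OF locally_null_Un[OF assms(1,2)[unfolded aeq_def]] _ locally_measurable_neq])
    (auto intro!: Linf_D Linf_add(1) assms)

lemma aeq_scale:
  assumes "aeq f g" "f \<in> Linf \<mu>" "g \<in> Linf \<mu>" shows "aeq (\<lambda>x. c * f x) (\<lambda>x. c * g x)"
  unfolding aeq_def
  by (rule locally_null_mono[OF assms(1)[unfolded aeq_def] _ locally_measurable_neq])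
    (auto intro!: Linf_D Linf_scale(1) assms)

lemma act_add_left:
  assumes f: "bdd_lm f" and g: "bdd_lm g" and a: "a \<in> L1 \<mu>"
  shows "act (\<lambda>x. f x + g x) a = (\<lambda>x. act f a x + act g a x)"
  unfolding act_def distrib_right
  by (intro ext Bochner_Integration.integral_add bdd_lm_times_L1[OF bdd_lm_right_translate] f g a)

lemma act_add_right:
  assumes f: "bdd_lm f" and a: "a \<in> L1 \<mu>" and b: "b \<in> L1 \<mu>"
  shows "act f (\<lambda>x. a x + b x) = (\<lambda>x. act f a x + act f b x)"
  unfolding act_def distrib_left
  by (intro ext Bochner_Integration.integral_add bdd_lm_times_L1[OF bdd_lm_right_translate] f a b)

lemma act_scale:
  "act (\<lambda>x. c * f x) a = (\<lambda>x. c * act f a x)" "act f (\<lambda>x. c * a x) = (\<lambda>x. c * act f a x)"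
  unfolding act_def by (simp_all add: mult.assoc mult.left_commute)

lemma pairing_functional:
  assumes f: "f \<in> Linf \<mu>" shows "L1_functional (pairing \<mu> f) (Linf_norm \<mu> f)"
  unfolding L1_functional_def
  using Linf_norm_nonneg[OF f] pairing_add_right[OF f] pairing_scale(2)[where f = f] pairing_bound[OF f] by blast

text \<open>
  The unspecified representative of \<open>\<lambda>\<cdot>a\<close> is thus replaced by the integral \<open>act\<close>, formed with any
  bounded representative of \<open>\<lambda>\<close>.
\<close>
lemma act_L1_aeq:
  assumes f: "f \<in> Linf \<mu>" and g: "bdd_lm g" "aeq f g" and a: "a \<in> L1 \<mu>"
  shows "act_L1 \<mu> f a \<in> Linf \<mu>" "aeq (act_L1 \<mu> f a) (act g a)"
proof -
  have gL: "g \<in> Linf \<mu>" by (rule bdd_lm_Linf[OF g(1)])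
  have aL: "act g a \<in> Linf \<mu>" by (rule bdd_lm_Linf[OF act_bdd_lm[OF g(1) a]])
  have eq: "pairing \<mu> f (convolution \<mu> a b) = pairing \<mu> (act g a) b" if b: "b \<in> L1 \<mu>" for b
    by (rule trans[OF pairing_cong[OF g(2) f gL convolution_L1[OF a b]] pairing_convolution[OF g(1) a b]])
  have F: "L1_functional (\<lambda>b. pairing \<mu> f (convolution \<mu> a b)) (Linf_norm \<mu> (act g a))"
    using pairing_functional[OF aL] unfolding L1_functional_def by (simp add: eq L1_add L1_scale)
  show r: "act_L1 \<mu> f a \<in> Linf \<mu>" unfolding act_L1_def by (rule Linf_rep(1)[OF F])
  show "aeq (act_L1 \<mu> f a) (act g a)"
    by (rule Linf_unique[OF r aL]) (simp add: act_L1_def Linf_rep(2)[OF F] eq)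
qed

lemma act_dual_functional:
  assumes \<Psi>: "\<Psi> \<in> Linf_dual \<mu>" and f: "f \<in> Linf \<mu>"
  shows "L1_functional (\<lambda>a. \<Psi> (act_L1 \<mu> f a)) (dual_norm \<mu> \<Psi> * Linf_norm \<mu> f)"
proof -
  obtain g where g: "bdd_lm g" "aeq f g" "\<And>x. cmod (g x) \<le> Linf_norm \<mu> f" by (rule bounded_representative[OF f]) (rule that; assumption)
  have aL: "act g a \<in> Linf \<mu>" if "a \<in> L1 \<mu>" for a by (rule bdd_lm_Linf[OF act_bdd_lm[OF g(1) that]])
  have eq: "\<Psi> (act_L1 \<mu> f a) = \<Psi> (act g a)" if "a \<in> L1 \<mu>" for a
    by (rule dual_cong[OF \<Psi> act_L1_aeq(2)[OF f g(1,2) that] act_L1_aeq(1)[OF f g(1,2) that] aL[OF that]])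
  show ?thesis unfolding L1_functional_def
  proof (intro conjI ballI allI)
    show "0 \<le> dual_norm \<mu> \<Psi> * Linf_norm \<mu> f" by (intro mult_nonneg_nonneg dual_bounded(3) \<Psi> Linf_norm_nonneg f)
    fix a assume a: "a \<in> L1 \<mu>"
    show "\<Psi> (act_L1 \<mu> f (\<lambda>x. a x + b x)) = \<Psi> (act_L1 \<mu> f a) + \<Psi> (act_L1 \<mu> f b)" if b: "b \<in> L1 \<mu>" for b
      unfolding eq[OF a] eq[OF b] eq[OF L1_add[OF a b]] act_add_right[OF g(1) a b]
      by (rule dual_add[OF \<Psi> aL[OF a] aL[OF b]])
    show "\<Psi> (act_L1 \<mu> f (\<lambda>x. c * a x)) = c * \<Psi> (act_L1 \<mu> f a)" for c
      unfolding eq[OF a] eq[OF L1_scale[OF a]] act_scale(2)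
      by (rule dual_scale[OF \<Psi> aL[OF a]])
    have "cmod (\<Psi> (act g a)) \<le> dual_norm \<mu> \<Psi> * Linf_norm \<mu> (act g a)" by (rule dual_bounded(2)[OF \<Psi> aL[OF a]])
    also have "\<dots> \<le> dual_norm \<mu> \<Psi> * (Linf_norm \<mu> f * nrm1 a)" unfolding nrm1_def
      by (intro mult_left_mono Linf_norm_bound act_bound g a dual_bounded(3) \<Psi>)
    finally show "cmod (\<Psi> (act_L1 \<mu> f a)) \<le> dual_norm \<mu> \<Psi> * Linf_norm \<mu> f * nrm1 a"
      unfolding eq[OF a] by (simp add: mult.assoc)
  qed
qed

lemma act_dual:
  assumes \<Psi>: "\<Psi> \<in> Linf_dual \<mu>" and f: "f \<in> Linf \<mu>"
  shows "act_dual \<mu> \<Psi> f \<in> Linf \<mu>" "Linf_norm \<mu> (act_dual \<mu> \<Psi> f) \<le> dual_norm \<mu> \<Psi> * Linf_norm \<mu> f"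
    "bdd_lm g \<Longrightarrow> aeq f g \<Longrightarrow> a \<in> L1 \<mu> \<Longrightarrow> pairing \<mu> (act_dual \<mu> \<Psi> f) a = \<Psi> (act g a)"
proof -
  note F = act_dual_functional[OF \<Psi> f]
  show L: "act_dual \<mu> \<Psi> f \<in> Linf \<mu>" unfolding act_dual_def by (rule Linf_rep(1)[OF F])
  have p: "pairing \<mu> (act_dual \<mu> \<Psi> f) a = \<Psi> (act_L1 \<mu> f a)" if "a \<in> L1 \<mu>" for a
    unfolding act_dual_def by (rule Linf_rep(2)[OF F that])
  show "Linf_norm \<mu> (act_dual \<mu> \<Psi> f) \<le> dual_norm \<mu> \<Psi> * Linf_norm \<mu> f"
    by (rule Linf_norm_by_duality[OF L]) (use F p in \<open>auto simp: L1_functional_def\<close>)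
  assume g: "bdd_lm g" "aeq f g" and a: "a \<in> L1 \<mu>"
  show "pairing \<mu> (act_dual \<mu> \<Psi> f) a = \<Psi> (act g a)" unfolding p[OF a]
    by (rule dual_cong[OF \<Psi> act_L1_aeq(2)[OF f g a] act_L1_aeq(1)[OF f g a] bdd_lm_Linf[OF act_bdd_lm[OF g(1) a]]])
qed

text \<open>
  The characterization by which the function \<open>\<Psi>\<cdot>\<lambda>\<close> is identified in all that follows.
\<close>
lemma act_dual_eqI:
  assumes \<Psi>: "\<Psi> \<in> Linf_dual \<mu>" and g: "bdd_lm g" "aeq f g" "f \<in> Linf \<mu>" and h: "h \<in> Linf \<mu>"
    and eq: "\<And>a. a \<in> L1 \<mu> \<Longrightarrow> \<Psi> (act g a) = pairing \<mu> h a"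
  shows "aeq (act_dual \<mu> \<Psi> f) h"
  by (rule Linf_unique[OF act_dual(1)[OF \<Psi> g(3)] h]) (simp add: act_dual(3)[OF \<Psi> g(3,1,2)] eq)

lemma arens_eq: "f \<in> Linf \<mu> \<Longrightarrow> arens \<mu> \<Phi> \<Psi> f = \<Phi> (act_dual \<mu> \<Psi> f)"
  by (simp add: arens_def)

lemma arens_dual:
  assumes \<Phi>: "\<Phi> \<in> Linf_dual \<mu>" and \<Psi>: "\<Psi> \<in> Linf_dual \<mu>"
  shows "arens \<mu> \<Phi> \<Psi> \<in> Linf_dual \<mu>" "dual_norm \<mu> (arens \<mu> \<Phi> \<Psi>) \<le> dual_norm \<mu> \<Phi> * dual_norm \<mu> \<Psi>"
proof -
  have b: "cmod (arens \<mu> \<Phi> \<Psi> f) \<le> (dual_norm \<mu> \<Phi> * dual_norm \<mu> \<Psi>) * Linf_norm \<mu> f" if f: "f \<in> Linf \<mu>" for f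
  proof -
    have "cmod (\<Phi> (act_dual \<mu> \<Psi> f)) \<le> dual_norm \<mu> \<Phi> * Linf_norm \<mu> (act_dual \<mu> \<Psi> f)"
      by (rule dual_bounded(2)[OF \<Phi> act_dual(1)[OF \<Psi> f]])
    also have "\<dots> \<le> dual_norm \<mu> \<Phi> * (dual_norm \<mu> \<Psi> * Linf_norm \<mu> f)"
      by (intro mult_left_mono act_dual(2) \<Psi> f dual_bounded(3) \<Phi>)
    finally show ?thesis by (simp add: arens_eq[OF f] mult.assoc)
  qed
  show "dual_norm \<mu> (arens \<mu> \<Phi> \<Psi>) \<le> dual_norm \<mu> \<Phi> * dual_norm \<mu> \<Psi>"
    by (rule dual_norm_le[OF _ b]) (intro mult_nonneg_nonneg dual_bounded(3) \<Phi> \<Psi>)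
  show "arens \<mu> \<Phi> \<Psi> \<in> Linf_dual \<mu>"
  proof (rule Linf_dualI[OF _ _ b])
    fix f assume f: "f \<in> Linf \<mu>"
    obtain g where g: "bdd_lm g" "aeq f g" "\<And>x. cmod (g x) \<le> Linf_norm \<mu> f" by (rule bounded_representative[OF f]) (rule that; assumption)
    note gL = bdd_lm_Linf[OF g(1)]
    note af = act_dual(1)[OF \<Psi> f]
    have aL: "act g a \<in> Linf \<mu>" if "a \<in> L1 \<mu>" for a by (rule bdd_lm_Linf[OF act_bdd_lm[OF g(1) that]])
    show "arens \<mu> \<Phi> \<Psi> (\<lambda>x. c * f x) = c * arens \<mu> \<Phi> \<Psi> f" for c
    proof -
      have "aeq (act_dual \<mu> \<Psi> (\<lambda>x. c * f x)) (\<lambda>x. c * act_dual \<mu> \<Psi> f x)"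
      proof (rule act_dual_eqI[OF \<Psi> bdd_lm_scale[OF g(1)] aeq_scale[OF g(2) f gL] Linf_scale(1)[OF f] Linf_scale(1)[OF af]])
        fix a assume a: "a \<in> L1 \<mu>"
        show "\<Psi> (act (\<lambda>x. c * g x) a) = pairing \<mu> (\<lambda>x. c * act_dual \<mu> \<Psi> f x) a"
          unfolding act_scale(1) pairing_scale(1) act_dual(3)[OF \<Psi> f g(1,2) a]
          by (rule dual_scale[OF \<Psi> aL[OF a]])
      qed
      from dual_cong[OF \<Phi> this act_dual(1)[OF \<Psi> Linf_scale(1)[OF f]] Linf_scale(1)[OF af]]
      show ?thesis by (simp add: arens_eq Linf_scale(1) f dual_scale[OF \<Phi> af])
    qed
    fix f' assume f': "f' \<in> Linf \<mu>"
    obtain g' where g': "bdd_lm g'" "aeq f' g'" "\<And>x. cmod (g' x) \<le> Linf_norm \<mu> f'" by (rule bounded_representative[OF f']) (rule that; assumption)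
    note g'L = bdd_lm_Linf[OF g'(1)]
    note af' = act_dual(1)[OF \<Psi> f']
    have aL': "act g' a \<in> Linf \<mu>" if "a \<in> L1 \<mu>" for a by (rule bdd_lm_Linf[OF act_bdd_lm[OF g'(1) that]])
    have "aeq (act_dual \<mu> \<Psi> (\<lambda>x. f x + f' x)) (\<lambda>x. act_dual \<mu> \<Psi> f x + act_dual \<mu> \<Psi> f' x)"
    proof (rule act_dual_eqI[OF \<Psi> bdd_lm_add[OF g(1) g'(1)] aeq_add[OF g(2) g'(2) f gL f' g'L] Linf_add(1)[OF f f'] Linf_add(1)[OF af af']])
      fix a assume a: "a \<in> L1 \<mu>"
      show "\<Psi> (act (\<lambda>x. g x + g' x) a) = pairing \<mu> (\<lambda>x. act_dual \<mu> \<Psi> f x + act_dual \<mu> \<Psi> f' x) a"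
        unfolding act_add_left[OF g(1) g'(1) a] pairing_add_left[OF af af' a] act_dual(3)[OF \<Psi> f g(1,2) a] act_dual(3)[OF \<Psi> f' g'(1,2) a]
        by (rule dual_add[OF \<Psi> aL[OF a] aL'[OF a]])
    qed
    from dual_cong[OF \<Phi> this act_dual(1)[OF \<Psi> Linf_add(1)[OF f f']] Linf_add(1)[OF af af']]
    show "arens \<mu> \<Phi> \<Psi> (\<lambda>x. f x + f' x) = arens \<mu> \<Phi> \<Psi> f + arens \<mu> \<Phi> \<Psi> f'"
      by (simp add: arens_eq Linf_add(1) f f' dual_add[OF \<Phi> af af'])
  qed (simp_all add: arens_def)
qed

text \<open>
  The right factor enters the product only through its values at the functions \<open>g\<cdot>a\<close>.
\<close>
lemma arens_cong_right:
  assumes \<Phi>: "\<Phi> \<in> Linf_dual \<mu>" and A: "A \<in> Linf_dual \<mu>" and B: "B \<in> Linf_dual \<mu>"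
    and eq: "\<And>g a. bdd_lm g \<Longrightarrow> a \<in> L1 \<mu> \<Longrightarrow> A (act g a) = B (act g a)"
  shows "arens \<mu> \<Phi> A = arens \<mu> \<Phi> B"
proof
  fix f
  show "arens \<mu> \<Phi> A f = arens \<mu> \<Phi> B f"
  proof (cases "f \<in> Linf \<mu>")
    case f: True
    obtain g where g: "bdd_lm g" "aeq f g" "\<And>x. cmod (g x) \<le> Linf_norm \<mu> f" by (rule bounded_representative[OF f]) (rule that; assumption)
    have "aeq (act_dual \<mu> A f) (act_dual \<mu> B f)"
      by (rule act_dual_eqI[OF A g(1,2) f act_dual(1)[OF B f]]) (simp add: act_dual(3)[OF B f g(1,2)] eq g(1))
    from dual_cong[OF \<Phi> this act_dual(1)[OF A f] act_dual(1)[OF B f]] show ?thesis by (simp add: arens_eq f)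
  qed (simp add: arens_def)
qed

lemma arens_lincomb_right:
  assumes \<Phi>: "\<Phi> \<in> Linf_dual \<mu>" and A: "A \<in> Linf_dual \<mu>" and B: "B \<in> Linf_dual \<mu>"
  shows "arens \<mu> \<Phi> (\<lambda>f. A f + c * B f) = (\<lambda>f. arens \<mu> \<Phi> A f + c * arens \<mu> \<Phi> B f)"
proof
  fix f
  show "arens \<mu> \<Phi> (\<lambda>f. A f + c * B f) f = arens \<mu> \<Phi> A f + c * arens \<mu> \<Phi> B f"
  proof (cases "f \<in> Linf \<mu>")
    case f: True
    obtain g where g: "bdd_lm g" "aeq f g" "\<And>x. cmod (g x) \<le> Linf_norm \<mu> f" by (rule bounded_representative[OF f]) (rule that; assumption)
    note aA = act_dual(1)[OF A f] and aB = act_dual(1)[OF B f]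
    note cB = Linf_scale(1)[OF aB, of c]
    have "aeq (act_dual \<mu> (\<lambda>f. A f + c * B f) f) (\<lambda>x. act_dual \<mu> A f x + c * act_dual \<mu> B f x)"
    proof (rule act_dual_eqI[OF dual_lincomb(1)[OF A B] g(1,2) f Linf_add(1)[OF aA cB]])
      fix a assume a: "a \<in> L1 \<mu>"
      show "A (act g a) + c * B (act g a) = pairing \<mu> (\<lambda>x. act_dual \<mu> A f x + c * act_dual \<mu> B f x) a"
        unfolding pairing_add_left[OF aA cB a] pairing_scale(1) act_dual(3)[OF A f g(1,2) a] act_dual(3)[OF B f g(1,2) a] ..
    qed
    from dual_cong[OF \<Phi> this act_dual(1)[OF dual_lincomb(1)[OF A B] f] Linf_add(1)[OF aA cB]]
    show ?thesis by (simp add: arens_eq f dual_add[OF \<Phi> aA cB] dual_scale[OF \<Phi> aB])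
  qed (simp add: arens_def)
qed

text \<open>
  The rule \<open>\<Psi>\<cdot>(g\<cdot>a) = (\<Psi>\<cdot>g)\<cdot>a\<close>; both sides, paired with \<open>b\<close>, give \<open>\<Psi>(g\<cdot>(a * b))\<close>.
\<close>
lemma act_dual_act:
  assumes \<Psi>: "\<Psi> \<in> Linf_dual \<mu>" and g: "bdd_lm g" and a: "a \<in> L1 \<mu>" and h: "bdd_lm h" "aeq (act_dual \<mu> \<Psi> g) h"
  shows "aeq (act_dual \<mu> \<Psi> (act g a)) (act h a)"
proof -
  note gL = bdd_lm_Linf[OF g] and hL = bdd_lm_Linf[OF h(1)]
  note ga = act_bdd_lm[OF g a]
  show ?thesis
  proof (rule act_dual_eqI[OF \<Psi> ga aeq_refl bdd_lm_Linf[OF ga] bdd_lm_Linf[OF act_bdd_lm[OF h(1) a]]])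
    fix b assume b: "b \<in> L1 \<mu>"
    have "\<Psi> (act (act g a) b) = \<Psi> (act g (convolution \<mu> a b))" by (simp add: act_convolution[OF g a b])
    also have "\<dots> = pairing \<mu> (act_dual \<mu> \<Psi> g) (convolution \<mu> a b)"
      by (rule act_dual(3)[OF \<Psi> gL g aeq_refl convolution_L1[OF a b], symmetric])
    also have "\<dots> = pairing \<mu> h (convolution \<mu> a b)"
      by (rule pairing_cong[OF h(2) act_dual(1)[OF \<Psi> gL] hL convolution_L1[OF a b]])
    also have "\<dots> = pairing \<mu> (act h a) b" by (rule pairing_convolution[OF h(1) a b])
    finally show "\<Psi> (act (act g a) b) = pairing \<mu> (act h a) b" .
  qed
qed

lemma arens_act:
  assumes \<Phi>: "\<Phi> \<in> Linf_dual \<mu>" and \<Psi>: "\<Psi> \<in> Linf_dual \<mu>" and g: "bdd_lm g" and a: "a \<in> L1 \<mu>" 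
    and h: "bdd_lm h" "aeq (act_dual \<mu> \<Psi> g) h"
  shows "arens \<mu> \<Phi> \<Psi> (act g a) = \<Phi> (act h a)"
proof -
  note ga = bdd_lm_Linf[OF act_bdd_lm[OF g a]]
  show ?thesis unfolding arens_eq[OF ga]
    by (rule dual_cong[OF \<Phi> act_dual_act[OF \<Psi> g a h] act_dual(1)[OF \<Psi> ga] bdd_lm_Linf[OF act_bdd_lm[OF h(1) a]]])
qed

lemma L1_in_dual:
  assumes a: "a \<in> L1 \<mu>"
  shows "(\<lambda>f. if f \<in> Linf \<mu> then pairing \<mu> f a else 0) \<in> Linf_dual \<mu>" (is "?\<Phi> \<in> _")
proof (rule Linf_dualI[where C = "nrm1 a"])
  fix f assume f: "f \<in> Linf \<mu>"
  show "?\<Phi> (\<lambda>x. f x + g x) = ?\<Phi> f + ?\<Phi> g" if "g \<in> Linf \<mu>" for g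
    using Linf_add(1)[OF f that] f that pairing_add_left[OF f that a] by simp
  show "?\<Phi> (\<lambda>x. c * f x) = c * ?\<Phi> f" for c
    using Linf_scale(1)[OF f, of c] f pairing_scale(1)[of c f a] by simp
  show "cmod (?\<Phi> f) \<le> nrm1 a * Linf_norm \<mu> f" using f pairing_bound[OF f a] by (simp add: mult.commute)
qed simp

definition right_identity :: "(('g \<Rightarrow> complex) \<Rightarrow> complex) \<Rightarrow> bool" where
  "right_identity E \<longleftrightarrow> E \<in> Linf_dual \<mu> \<and> (\<forall>\<Phi>\<in>Linf_dual \<mu>. arens \<mu> \<Phi> E = \<Phi>)"

text \<open>
  Apply \<open>\<Phi> \<box> E = \<Phi>\<close> to the functional \<open>\<Phi>\<close> given by \<open>a\<close>.
\<close>
lemma right_identity_act: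
  assumes E: "right_identity E" and g: "bdd_lm g" and a: "a \<in> L1 \<mu>"
  shows "E (act g a) = pairing \<mu> g a"
proof -
  have ED: "E \<in> Linf_dual \<mu>" using E by (simp add: right_identity_def)
  let ?\<Phi> = "\<lambda>f. if f \<in> Linf \<mu> then pairing \<mu> f a else 0"
  have \<Phi>: "?\<Phi> \<in> Linf_dual \<mu>" by (rule L1_in_dual[OF a])
  note gL = bdd_lm_Linf[OF g]
  have "pairing \<mu> g a = arens \<mu> ?\<Phi> E g" using E \<Phi> gL unfolding right_identity_def by simp
  also have "\<dots> = pairing \<mu> (act_dual \<mu> E g) a" by (simp add: arens_eq[OF gL] act_dual(1)[OF ED gL])
  also have "\<dots> = E (act g a)" by (rule act_dual(3)[OF ED gL g aeq_refl a])
  finally show ?thesis by simp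
qed

text \<open>
  Both sides equal \<open>\<langle>F\<cdot>g, a\<rangle>\<close>: the left one is \<open>E((F\<cdot>g)\<cdot>a)\<close>.  Thus \<open>E\<close>, which need not be a left
  identity, acts as one as far as the functions \<open>g\<cdot>a\<close> are concerned.
\<close>
lemma right_identity_arens_act:
  assumes E: "right_identity E" and F: "F \<in> Linf_dual \<mu>" and g: "bdd_lm g" and a: "a \<in> L1 \<mu>"
  shows "arens \<mu> E F (act g a) = F (act g a)"
proof -
  have ED: "E \<in> Linf_dual \<mu>" using E by (simp add: right_identity_def)
  note gL = bdd_lm_Linf[OF g]
  note aL = act_dual(1)[OF F gL]
  obtain h where h: "bdd_lm h" "aeq (act_dual \<mu> F g) h" "\<And>x. cmod (h x) \<le> Linf_norm \<mu> (act_dual \<mu> F g)"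
    by (rule bounded_representative[OF aL]) (rule that; assumption)
  have "arens \<mu> E F (act g a) = E (act h a)" by (rule arens_act[OF ED F g a h(1,2)])
  also have "\<dots> = pairing \<mu> h a" by (rule right_identity_act[OF E h(1) a])
  also have "\<dots> = pairing \<mu> (act_dual \<mu> F g) a" by (rule pairing_cong[OF h(2) aL bdd_lm_Linf[OF h(1)] a, symmetric])
  also have "\<dots> = F (act g a)" by (rule act_dual(3)[OF F gL g aeq_refl a])
  finally show ?thesis .
qed

text \<open>
  The inner \<open>E\<close> disappears because \<open>E \<box> B\<close> and \<open>B\<close> agree at all functions \<open>g\<cdot>a\<close>; what remains is the
  associative law for \<open>E\<close>, \<open>A\<close> and \<open>B\<close>.
\<close>
lemma right_identity_arens_arens:
  assumes E: "right_identity E" and A: "A \<in> Linf_dual \<mu>" and B: "B \<in> Linf_dual \<mu>"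
  shows "arens \<mu> (arens \<mu> E A) (arens \<mu> E B) = arens \<mu> E (arens \<mu> A B)"
proof
  have ED: "E \<in> Linf_dual \<mu>" using E by (simp add: right_identity_def)
  note EA = arens_dual(1)[OF ED A] and EB = arens_dual(1)[OF ED B] and AB = arens_dual(1)[OF A B]
  have 1: "arens \<mu> (arens \<mu> E A) (arens \<mu> E B) = arens \<mu> (arens \<mu> E A) B"
    by (rule arens_cong_right[OF EA EB B]) (rule right_identity_arens_act[OF E B])
  fix f
  show "arens \<mu> (arens \<mu> E A) (arens \<mu> E B) f = arens \<mu> E (arens \<mu> A B) f"
  proof (cases "f \<in> Linf \<mu>")
    case f: True
    obtain g where g: "bdd_lm g" "aeq f g" "\<And>x. cmod (g x) \<le> Linf_norm \<mu> f" by (rule bounded_representative[OF f]) (rule that; assumption)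
    note gL = bdd_lm_Linf[OF g(1)]
    note p = act_dual(1)[OF B f]
    obtain h where h: "bdd_lm h" "aeq (act_dual \<mu> B f) h" "\<And>x. cmod (h x) \<le> Linf_norm \<mu> (act_dual \<mu> B f)"
      by (rule bounded_representative[OF p]) (rule that; assumption)
    have "aeq (act_dual \<mu> B g) (act_dual \<mu> B f)"
      by (rule act_dual_eqI[OF B g(1) aeq_refl gL p]) (simp add: act_dual(3)[OF B f g(1,2)])
    then have h': "aeq (act_dual \<mu> B g) h" by (rule aeq_trans[OF _ h(2) act_dual(1)[OF B gL] bdd_lm_Linf[OF h(1)]])
    have "aeq (act_dual \<mu> (arens \<mu> A B) f) (act_dual \<mu> A (act_dual \<mu> B f))"
    proof (rule act_dual_eqI[OF AB g(1,2) f act_dual(1)[OF A p]])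
      fix a assume a: "a \<in> L1 \<mu>"
      show "arens \<mu> A B (act g a) = pairing \<mu> (act_dual \<mu> A (act_dual \<mu> B f)) a"
        unfolding act_dual(3)[OF A p h(1,2) a] by (rule arens_act[OF A B g(1) a h(1) h'])
    qed
    from dual_cong[OF ED this act_dual(1)[OF AB f] act_dual(1)[OF A p]]
    show ?thesis unfolding 1 by (simp add: arens_eq f p)
  qed (simp add: arens_def)
qed

end

section \<open>Functionals vanishing at infinity\<close>

context haar_group
begin

lemma Cc_bdd_lm: "g \<in> Cc \<Longrightarrow> bdd_lm g"
proof -
  assume g: "g \<in> Cc"
  obtain B where "\<And>x. cmod (g x) \<le> B" by (rule Cc_bounded[OF g]) (rule that; assumption)
  moreover have "continuous_on UNIV g" using g by (simp add: Cc_def)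
  ultimately show ?thesis by (intro continuous_bdd_lm)
qed

lemma Cc_Linf: "g \<in> Cc \<Longrightarrow> g \<in> Linf \<mu>" by (intro bdd_lm_Linf Cc_bdd_lm)

lemma Cc_reflect: "g \<in> Cc \<Longrightarrow> reflect g \<in> Cc" unfolding reflect_def by (intro Cc_cnj Cc_neg)

text \<open>
  Take \<open>a\<close> to be the normalized indicator function of a small neighbourhood \<open>U\<close> of \<open>0\<close>: then
  \<open>g\<cdot>a\<close> averages the values \<open>g(y + x)\<close> over \<open>y \<in> U\<close>.
\<close>
lemma Cc_approximate_identity:
  assumes g: "g \<in> Cc" and e: "0 < \<epsilon>"
  obtains a where "a \<in> L1 \<mu>" "\<And>x. cmod (g x - act g a x) \<le> \<epsilon>" "cmod (g 0 - pairing \<mu> g a) \<le> \<epsilon>"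
proof -
  obtain V where V: "open V" "0 \<in> V" "\<And>v x. v \<in> V \<Longrightarrow> cmod (g (v + x) - g x) < \<epsilon>"
    by (rule Cc_left_uniformly_continuous[OF g e]) (rule that; assumption)
  obtain U C where U: "open U" "compact C" "0 \<in> U" "U \<subseteq> C" "C \<subseteq> V"
    by (rule compact_neighbourhood[OF lc V(1,2)]) (rule that; assumption)
  have Ub: "U \<in> sets borel" using U by simp
  have "emeasure \<mu> U \<le> emeasure \<mu> C" using U compact_borel[OF U(2)] by (intro emeasure_mono) auto
  then have Uf: "emeasure \<mu> U < \<infinity>" using compact_finite[OF U(2)] by (rule order.strict_trans1)
  have "emeasure \<mu> U \<noteq> 0" using U by (intro open_pos) auto
  then have m: "0 < measure \<mu> U" using Uf by (simp add: measure_def enn2real_positive_iff less_top zero_less_iff_neq_zero)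
  define k where "k = complex_of_real (inverse (measure \<mu> U))"
  let ?a = "\<lambda>x. k * indicator U x"
  note iU = L1_indicator[OF Ub Uf]
  have a: "?a \<in> L1 \<mu>" by (rule L1_scale[OF iU(1)])
  have ia: "integrable \<mu> ?a" using a by (simp only: L1_def mem_Collect_eq)
  have n: "nrm1 ?a = 1" unfolding nrm1_scale iU(2) k_def using m by (simp only: norm_of_real) simp
  have I: "(LINT y|\<mu>. ?a y) = 1"
  proof -
    have "(LINT y|\<mu>. indicator U y :: complex) = complex_of_real (LINT y|\<mu>. indicator U y)"
      unfolding integral_complex_of_real[symmetric] by (simp add: of_real_indicator)
    then show ?thesis unfolding k_def using m Ub Uf by simp
  qed
  note gb = Cc_bdd_lm[OF g]
  have ap: "cmod (g x - act g a x) \<le> \<epsilon>" if "a = ?a" for a x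
  proof -
    have i: "integrable \<mu> (\<lambda>y. g (y + x) * ?a y)" by (rule bdd_lm_times_L1[OF bdd_lm_right_translate[OF gb] a])
    have i2: "integrable \<mu> (\<lambda>y. g x * ?a y)" using a by (simp add: L1_def)
    have "g x - act g ?a x = (LINT y|\<mu>. g x * ?a y) - (LINT y|\<mu>. g (y + x) * ?a y)"
      unfolding act_def using I by simp
    also have "\<dots> = (LINT y|\<mu>. g x * ?a y - g (y + x) * ?a y)"
      by (rule Bochner_Integration.integral_diff[OF i2 i, symmetric])
    also have "cmod \<dots> \<le> (LINT y|\<mu>. \<epsilon> * cmod (?a y))"
    proof (rule norm_integral_le[OF Bochner_Integration.integrable_diff[OF i2 i]])
      show "integrable \<mu> (\<lambda>y. \<epsilon> * cmod (?a y))" by (rule integrable_mult_right[OF integrable_norm[OF ia]])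
      fix y
      show "cmod (g x * ?a y - g (y + x) * ?a y) \<le> \<epsilon> * cmod (?a y)"
      proof (cases "y \<in> U")
        case True
        then have "y \<in> V" using U by auto
        then have "cmod (g x - g (y + x)) \<le> \<epsilon>" using V(3)[of y x] by (simp add: norm_minus_commute)
        from mult_right_mono[OF this, of "cmod (?a y)"] show ?thesis
          unfolding left_diff_distrib[symmetric] norm_mult[of "g x - g (y + x)"] by simp
      qed simp
    qed
    also have "\<dots> = \<epsilon>" using n unfolding nrm1_def by simp
    finally show ?thesis using that by simp
  qed
  have "act g ?a 0 = pairing \<mu> g ?a" by (simp add: act_def pairing_def)
  then have "cmod (g 0 - pairing \<mu> g ?a) \<le> \<epsilon>" using ap[OF refl, of 0] by simp
  then show ?thesis using that[OF a ap[OF refl]] by simp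
qed

lemma eq_if_norm_le_all_eps:
  fixes z w :: complex
  assumes "\<And>\<epsilon>. 0 < \<epsilon> \<Longrightarrow> cmod (z - w) \<le> C * \<epsilon>"
  shows "z = w"
proof (rule ccontr)
  assume "z \<noteq> w"
  then have p: "0 < cmod (z - w)" by simp
  define d where "d = cmod (z - w) / (2 * (\<bar>C\<bar> + 1))"
  have d: "0 < d" unfolding d_def using p by simp
  have "cmod (z - w) \<le> C * d" by (rule assms[OF d])
  also have "\<dots> \<le> (\<bar>C\<bar> + 1) * d" using d by (intro mult_right_mono) auto
  also have "\<dots> = cmod (z - w) / 2" unfolding d_def by (simp add: field_simps)
  finally show False using p by simp
qed

lemma agree_on_Cc:
  assumes A: "A \<in> Linf_dual \<mu>" and B: "B \<in> Linf_dual \<mu>" and g: "g \<in> Cc"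
    and eq: "\<And>a. a \<in> L1 \<mu> \<Longrightarrow> A (act g a) = B (act g a)"
  shows "A g = B g"
proof (rule eq_if_norm_le_all_eps)
  fix \<epsilon> :: real assume e: "0 < \<epsilon>"
  obtain a where a: "a \<in> L1 \<mu>" "\<And>x. cmod (g x - act g a x) \<le> \<epsilon>" "cmod (g 0 - pairing \<mu> g a) \<le> \<epsilon>"
    by (rule Cc_approximate_identity[OF g e]) (rule that; assumption)
  note gb = Cc_bdd_lm[OF g]
  note aL = bdd_lm_Linf[OF act_bdd_lm[OF gb a(1)]]
  have "cmod (A g - A (act g a)) \<le> dual_norm \<mu> A * \<epsilon>" by (rule dual_approx[OF A bdd_lm_Linf[OF gb] aL a(2)])
  moreover have "cmod (B g - B (act g a)) \<le> dual_norm \<mu> B * \<epsilon>" by (rule dual_approx[OF B bdd_lm_Linf[OF gb] aL a(2)])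
  moreover have "A g - B g = (A g - A (act g a)) - (B g - B (act g a))" using eq[OF a(1)] by simp
  then have "cmod (A g - B g) \<le> cmod (A g - A (act g a)) + cmod (B g - B (act g a))"
    by (simp only: norm_triangle_ineq4)
  ultimately show "cmod (A g - B g) \<le> (dual_norm \<mu> A + dual_norm \<mu> B) * \<epsilon>" by (simp add: distrib_right)
qed

text \<open>
  The function \<open>g\<close> is a uniform limit of functions \<open>g\<cdot>a\<close>, and \<open>E(g\<cdot>a) = \<langle>g, a\<rangle>\<close> is an average of \<open>g\<close>
  near \<open>0\<close>.
\<close>
lemma right_identity_Cc:
  assumes E: "right_identity E" and g: "g \<in> Cc"
  shows "E g = g 0"
proof (rule eq_if_norm_le_all_eps)
  have ED: "E \<in> Linf_dual \<mu>" using E by (simp add: right_identity_def)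
  fix \<epsilon> :: real assume e: "0 < \<epsilon>"
  obtain a where a: "a \<in> L1 \<mu>" "\<And>x. cmod (g x - act g a x) \<le> \<epsilon>" "cmod (g 0 - pairing \<mu> g a) \<le> \<epsilon>"
    by (rule Cc_approximate_identity[OF g e]) (rule that; assumption)
  note gb = Cc_bdd_lm[OF g]
  note aL = bdd_lm_Linf[OF act_bdd_lm[OF gb a(1)]]
  have "cmod (E g - E (act g a)) \<le> dual_norm \<mu> E * \<epsilon>" by (rule dual_approx[OF ED bdd_lm_Linf[OF gb] aL a(2)])
  moreover have "E g - g 0 = (E g - E (act g a)) - (g 0 - pairing \<mu> g a)" using right_identity_act[OF E gb a(1)] by simp
  then have "cmod (E g - g 0) \<le> cmod (E g - E (act g a)) + cmod (g 0 - pairing \<mu> g a)"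
    by (simp only: norm_triangle_ineq4)
  ultimately show "cmod (E g - g 0) \<le> (dual_norm \<mu> E + 1) * \<epsilon>" using a(3) by (simp add: distrib_right)
qed

lemma right_identity_arens_Cc:
  assumes E: "right_identity E" and F: "F \<in> Linf_dual \<mu>" and g: "g \<in> Cc"
  shows "arens \<mu> E F g = F g"
proof (rule agree_on_Cc[OF _ F g])
  show "arens \<mu> E F \<in> Linf_dual \<mu>" using E F by (intro arens_dual) (simp_all add: right_identity_def)
qed (rule right_identity_arens_act[OF E F Cc_bdd_lm[OF g]])

definition tail_small :: "(('g \<Rightarrow> complex) \<Rightarrow> complex) \<Rightarrow> 'g set \<Rightarrow> real \<Rightarrow> bool" where
  "tail_small F K \<epsilon> \<longleftrightarrow> (\<forall>f\<in>Linf \<mu>. (\<forall>x\<in>K. f x = 0) \<longrightarrow> cmod (F f) \<le> \<epsilon> * Linf_norm \<mu> f)"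

lemma tail_smallD:
  "tail_small F K \<epsilon> \<Longrightarrow> f \<in> Linf \<mu> \<Longrightarrow> \<forall>x\<in>K. f x = 0 \<Longrightarrow> cmod (F f) \<le> \<epsilon> * Linf_norm \<mu> f"
  unfolding tail_small_def by (drule bspec, assumption) (erule mp, assumption)

lemma Linf_split:
  assumes f: "f \<in> Linf \<mu>" and K: "compact K"
  shows "(\<lambda>x. f x - indicator K x * f x) \<in> Linf \<mu>" "Linf_norm \<mu> (\<lambda>x. f x - indicator K x * f x) \<le> Linf_norm \<mu> f"
proof -
  have i: "locally_measurable_fun \<mu> (\<lambda>x. 1 - indicator K x)"
    using compact_borel[OF K] by (intro borel_imp_locally_measurable) simp
  have b: "cmod (1 - indicator K x) \<le> 1" for x by (auto simp: indicator_def)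
  have e: "(\<lambda>x. f x - indicator K x * f x) = (\<lambda>x. (1 - indicator K x) * f x)" by (simp add: left_diff_distrib)
  show "(\<lambda>x. f x - indicator K x * f x) \<in> Linf \<mu>" "Linf_norm \<mu> (\<lambda>x. f x - indicator K x * f x) \<le> Linf_norm \<mu> f"
    unfolding e using Linf_mult[OF f i b] by (simp_all only: mult_1)
qed

text \<open>
  If \<open>F\<close> is nearly carried by the compact set \<open>K\<close>, then it is close in norm to its restriction
  \<open>f \<mapsto> F(1\<^sub>K f)\<close>, which has compact carrier.  In this form, membership in \<open>L\<^sub>0\<^sup>\<infinity>(G)\<^sup>*\<close> refers to \<open>F\<close>
  alone.
\<close>
theorem Linf0_dual_iff:
  "F \<in> Linf0_dual \<mu> \<longleftrightarrow> F \<in> Linf_dual \<mu> \<and> (\<forall>\<epsilon>>0. \<exists>K. compact K \<and> tail_small F K \<epsilon>)"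
proof
  assume F0: "F \<in> Linf0_dual \<mu>"
  then have F: "F \<in> Linf_dual \<mu>" by (simp add: Linf0_dual_def)
  have "\<exists>K. compact K \<and> tail_small F K \<epsilon>" if "0 < \<epsilon>" for \<epsilon>
  proof -
    have "\<forall>\<epsilon>>0. \<exists>H\<in>Linf_dual \<mu>. compact_carrier \<mu> H \<and> dual_norm \<mu> (\<lambda>f. F f - H f) < \<epsilon>"
      using F0 unfolding Linf0_dual_def mem_Collect_eq by (rule conjunct2)
    then have "\<exists>H\<in>Linf_dual \<mu>. compact_carrier \<mu> H \<and> dual_norm \<mu> (\<lambda>f. F f - H f) < \<epsilon>"
      using that by (elim allE impE)
    then obtain H where H: "H \<in> Linf_dual \<mu>" "compact_carrier \<mu> H" "dual_norm \<mu> (\<lambda>f. F f - H f) < \<epsilon>"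
      by (elim bexE conjE)
    obtain K where K: "compact K" "\<forall>f\<in>Linf \<mu>. H f = H (\<lambda>x. indicator K x * f x)"
      using H(2) unfolding compact_carrier_def by (elim exE conjE)
    have "cmod (F f) \<le> \<epsilon> * Linf_norm \<mu> f" if f: "f \<in> Linf \<mu>" "\<forall>x\<in>K. f x = 0" for f
    proof -
      have "(\<lambda>x. indicator K x * f x) = (\<lambda>x. 0 * f x)" using f(2) by (auto simp: indicator_def)
      then have "H f = 0" using K(2) f(1) dual_scale[OF H(1) f(1), of 0] by simp
      then have "cmod (F f) \<le> dual_norm \<mu> (\<lambda>f. F f - H f) * Linf_norm \<mu> f"
        using dual_bounded(2)[OF dual_diff_closed[OF F H(1)] f(1)] by simp
      also have "\<dots> \<le> \<epsilon> * Linf_norm \<mu> f" using H(3) Linf_norm_nonneg[OF f(1)] by (intro mult_right_mono) auto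
      finally show ?thesis .
    qed
    then show ?thesis unfolding tail_small_def using K(1) by (intro exI[of _ K] conjI ballI impI)
  qed
  then show "F \<in> Linf_dual \<mu> \<and> (\<forall>\<epsilon>>0. \<exists>K. compact K \<and> tail_small F K \<epsilon>)" using F by (intro conjI allI impI)
next
  assume R: "F \<in> Linf_dual \<mu> \<and> (\<forall>\<epsilon>>0. \<exists>K. compact K \<and> tail_small F K \<epsilon>)"
  then have F: "F \<in> Linf_dual \<mu>" by (rule conjunct1)
  have "\<exists>H\<in>Linf_dual \<mu>. compact_carrier \<mu> H \<and> dual_norm \<mu> (\<lambda>f. F f - H f) < \<epsilon>" if "0 < \<epsilon>" for \<epsilon>
  proof -
    have "0 < \<epsilon> / 2" using that by simp
    with conjunct2[OF R] have "\<exists>K. compact K \<and> tail_small F K (\<epsilon> / 2)" by (elim allE impE)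
    then obtain K where K: "compact K" "tail_small F K (\<epsilon> / 2)" by (elim exE conjE)
    let ?H = "\<lambda>f. if f \<in> Linf \<mu> then F (\<lambda>x. indicator K x * f x) else 0"
    note i = Linf_indicator[OF _ K(1)]
    have H: "?H \<in> Linf_dual \<mu>"
    proof (rule Linf_dualI[where C = "dual_norm \<mu> F"])
      fix f assume f: "f \<in> Linf \<mu>"
      show "?H (\<lambda>x. f x + g x) = ?H f + ?H g" if "g \<in> Linf \<mu>" for g
        using Linf_add(1)[OF f that] f that dual_add[OF F i(1)[OF f] i(1)[OF that]] by (simp add: distrib_left)
      show "?H (\<lambda>x. c * f x) = c * ?H f" for c
        using Linf_scale(1)[OF f, of c] f dual_scale[OF F i(1)[OF f], of c] by (simp add: mult.left_commute)
      have "cmod (F (\<lambda>x. indicator K x * f x)) \<le> dual_norm \<mu> F * Linf_norm \<mu> (\<lambda>x. indicator K x * f x)"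
        by (rule dual_bounded(2)[OF F i(1)[OF f]])
      also have "\<dots> \<le> dual_norm \<mu> F * Linf_norm \<mu> f" by (intro mult_left_mono i(2) f dual_bounded(3) F)
      finally show "cmod (?H f) \<le> dual_norm \<mu> F * Linf_norm \<mu> f" using f by simp
    qed simp
    have "compact_carrier \<mu> ?H" unfolding compact_carrier_def
    proof (intro exI[of _ K] conjI K(1) ballI)
      fix f assume f: "f \<in> Linf \<mu>"
      have "(\<lambda>x. indicator K x * (indicator K x * f x)) = (\<lambda>x. indicator K x * f x)" by (auto simp: indicator_def)
      then show "?H f = ?H (\<lambda>x. indicator K x * f x)" using f i(1)[OF f] by simp
    qed
    moreover have "dual_norm \<mu> (\<lambda>f. F f - ?H f) \<le> \<epsilon> / 2"
    proof (rule dual_norm_le)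
      fix f assume f: "f \<in> Linf \<mu>"
      have "F f - ?H f = F (\<lambda>x. f x - indicator K x * f x)" using f dual_diff[OF F f i(1)[OF f]] by simp
      moreover have "\<forall>x\<in>K. f x - indicator K x * f x = 0" by simp
      ultimately have "cmod (F f - ?H f) \<le> \<epsilon> / 2 * Linf_norm \<mu> (\<lambda>x. f x - indicator K x * f x)"
        using K(2) Linf_split(1)[OF f K(1)] unfolding tail_small_def by simp
      also have "\<dots> \<le> \<epsilon> / 2 * Linf_norm \<mu> f" using that by (intro mult_left_mono Linf_split(2) f K(1)) simp
      finally show "cmod (F f - ?H f) \<le> \<epsilon> / 2 * Linf_norm \<mu> f" .
    qed (use that in simp)
    then have "dual_norm \<mu> (\<lambda>f. F f - ?H f) < \<epsilon>" using that by simp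
    ultimately show ?thesis using H by (intro bexI[of _ ?H] conjI)
  qed
  then show "F \<in> Linf0_dual \<mu>" unfolding Linf0_dual_def using F by (intro CollectI conjI allI impI)
qed

lemma Linf0_dual_tail:
  assumes "F \<in> Linf0_dual \<mu>" "0 < \<epsilon>"
  obtains K where "compact K" "tail_small F K \<epsilon>"
proof -
  have "\<forall>\<epsilon>>0. \<exists>K. compact K \<and> tail_small F K \<epsilon>" using assms(1) unfolding Linf0_dual_iff by (rule conjunct2)
  then have "\<exists>K. compact K \<and> tail_small F K \<epsilon>" using assms(2) by (elim allE impE)
  then show ?thesis by (elim exE conjE) (rule that)
qed

lemma Linf0_dual_dual: "F \<in> Linf0_dual \<mu> \<Longrightarrow> F \<in> Linf_dual \<mu>" by (simp add: Linf0_dual_def)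

lemma tail_estimate:
  assumes F: "F \<in> Linf_dual \<mu>" and K: "compact K" "tail_small F K \<epsilon>" and e: "0 \<le> \<epsilon>" and d: "d \<in> Linf \<mu>" "Linf_norm \<mu> d \<le> \<beta>"
    "Linf_norm \<mu> (\<lambda>x. indicator K x * d x) \<le> \<alpha>"
  shows "cmod (F d) \<le> dual_norm \<mu> F * \<alpha> + \<epsilon> * \<beta>"
proof -
  note i = Linf_indicator(1)[OF d(1) K(1)]
  have "F d = F (\<lambda>x. indicator K x * d x) + F (\<lambda>x. d x - indicator K x * d x)"
    using dual_diff[OF F d(1) i] by simp
  also have "cmod \<dots> \<le> cmod (F (\<lambda>x. indicator K x * d x)) + cmod (F (\<lambda>x. d x - indicator K x * d x))" by (rule norm_triangle_ineq)
  also have "cmod (F (\<lambda>x. indicator K x * d x)) \<le> dual_norm \<mu> F * \<alpha>"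
    by (rule order_trans[OF dual_bounded(2)[OF F i] mult_left_mono[OF d(3) dual_bounded(3)[OF F]]])
  also have "cmod (F (\<lambda>x. d x - indicator K x * d x)) \<le> \<epsilon> * \<beta>"
  proof -
    have "cmod (F (\<lambda>x. d x - indicator K x * d x)) \<le> \<epsilon> * Linf_norm \<mu> (\<lambda>x. d x - indicator K x * d x)"
      using K(2) Linf_split(1)[OF d(1) K(1)] unfolding tail_small_def by simp
    also have "\<dots> \<le> \<epsilon> * \<beta>" by (intro mult_left_mono order_trans[OF Linf_split(2)[OF d(1) K(1)] d(2)] e)
    finally show ?thesis .
  qed
  finally show ?thesis by simp
qed

lemma tail_estimate_pointwise:
  assumes F: "F \<in> Linf_dual \<mu>" and K: "compact K" "tail_small F K \<epsilon>" and e: "0 \<le> \<epsilon>" and d: "d \<in> Linf \<mu>" "\<And>x. cmod (d x) \<le> \<beta>"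
    and \<alpha>: "0 \<le> \<alpha>" "\<And>x. x \<in> K \<Longrightarrow> cmod (d x) \<le> \<alpha>"
  shows "cmod (F d) \<le> dual_norm \<mu> F * \<alpha> + \<epsilon> * \<beta>"
proof (rule tail_estimate[OF F K e d(1) Linf_norm_bound[OF d(2)] Linf_norm_bound])
  show "cmod (indicator K x * d x) \<le> \<alpha>" for x using \<alpha> by (cases "x \<in> K") simp_all
qed

text \<open>
  Multiply \<open>f\<close> by a cutoff function that equals \<open>1\<close> on a compact set nearly carrying both
  functionals.
\<close>
lemma Linf0_dual_agree:
  assumes A: "A \<in> Linf0_dual \<mu>" and B: "B \<in> Linf0_dual \<mu>" and eq: "\<And>g. g \<in> Cc \<Longrightarrow> A g = B g"
    and f: "continuous_on UNIV f" "\<And>x. cmod (f x) \<le> c"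
  shows "A f = B f"
proof (rule eq_if_norm_le_all_eps)
  fix \<epsilon> :: real assume e: "0 < \<epsilon>"
  note fL = bdd_lm_Linf[OF continuous_bdd_lm[OF f]]
  obtain K where K: "compact K" "tail_small A K \<epsilon>" by (rule Linf0_dual_tail[OF A e]) 
  obtain L where L: "compact L" "tail_small B L \<epsilon>" by (rule Linf0_dual_tail[OF B e])
  obtain u :: "'g \<Rightarrow> real" and C where u: "continuous_on UNIV u" "\<And>x. 0 \<le> u x" "\<And>x. u x \<le> 1"
    "\<And>x. x \<in> K \<union> L \<Longrightarrow> u x = 1" "compact C" "C \<subseteq> UNIV" "\<And>x. x \<notin> C \<Longrightarrow> u x = 0"
    by (rule compact_support_cutoff[OF lc compact_Un[OF K(1) L(1)] open_UNIV subset_UNIV]) (rule that; assumption)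
  let ?g = "\<lambda>x. complex_of_real (u x) * f x"
  have g: "?g \<in> Cc" unfolding Cc_def using u(5,7) by (auto intro!: continuous_intros u(1) f(1))
  note gL = Cc_Linf[OF g]
  let ?d = "\<lambda>x. f x - ?g x"
  have dL: "?d \<in> Linf \<mu>" by (rule Linf_diff[OF fL gL])
  have db: "cmod (?d x) \<le> c" for x
  proof -
    have "?d x = complex_of_real (1 - u x) * f x" by (simp add: left_diff_distrib)
    then have "cmod (?d x) = (1 - u x) * cmod (f x)" using u(3)[of x] by (simp only: norm_mult norm_of_real; simp)
    also have "\<dots> \<le> 1 * cmod (f x)" using u(2)[of x] by (intro mult_right_mono) auto
    finally show ?thesis using f(2)[of x] by simp
  qed
  have dn: "Linf_norm \<mu> ?d \<le> c" by (rule Linf_norm_bound[OF db])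
  have K0: "\<forall>x\<in>K. ?d x = 0" and L0: "\<forall>x\<in>L. ?d x = 0" using u(4) by auto
  have "cmod (A ?d) \<le> \<epsilon> * Linf_norm \<mu> ?d" by (rule tail_smallD[OF K(2) dL K0])
  moreover have "cmod (B ?d) \<le> \<epsilon> * Linf_norm \<mu> ?d" by (rule tail_smallD[OF L(2) dL L0])
  moreover have "\<epsilon> * Linf_norm \<mu> ?d \<le> \<epsilon> * c" using mult_left_mono[OF dn, of \<epsilon>] e by linarith
  ultimately have "cmod (A ?d) \<le> \<epsilon> * c" "cmod (B ?d) \<le> \<epsilon> * c" by linarith+
  moreover have "A f - B f = A ?d - B ?d"
    using dual_diff[OF Linf0_dual_dual[OF A] fL gL] dual_diff[OF Linf0_dual_dual[OF B] fL gL] eq[OF g] by simp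
  then have "cmod (A f - B f) \<le> cmod (A ?d) + cmod (B ?d)" by (simp only: norm_triangle_ineq4)
  ultimately show "cmod (A f - B f) \<le> (2 * c) * \<epsilon>" by (simp add: algebra_simps)
qed

lemma Linf0_arens_cong:
  assumes \<Phi>: "\<Phi> \<in> Linf_dual \<mu>" and A: "A \<in> Linf0_dual \<mu>" and B: "B \<in> Linf0_dual \<mu>" and eq: "\<And>g. g \<in> Cc \<Longrightarrow> A g = B g"
  shows "arens \<mu> \<Phi> A = arens \<mu> \<Phi> B"
proof (rule arens_cong_right[OF \<Phi> A[THEN Linf0_dual_dual] B[THEN Linf0_dual_dual]])
  fix g a assume g: "bdd_lm g" and a: "a \<in> L1 \<mu>"
  obtain c where c: "\<And>x. cmod (g x) \<le> c" using g by (auto simp: bdd_lm_def)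
  show "A (act g a) = B (act g a)"
    by (rule Linf0_dual_agree[OF A B eq act_continuous[OF g a] act_bound[OF g c a]])
qed

text \<open>
  If \<open>\<Phi>\<close> and \<open>\<Psi>\<close> are nearly carried by \<open>K\<close> and \<open>L\<close>, then \<open>\<Phi> \<box> \<Psi>\<close> is nearly carried by \<open>K + L\<close>: for
  \<open>f\<close> vanishing there and \<open>a\<close> living on \<open>K\<close>, the function \<open>f\<cdot>a\<close> vanishes on \<open>L\<close>, so \<open>\<Psi>\<cdot>f\<close> is small on
  \<open>K\<close>.
\<close>
lemma Linf0_dual_arens:
  assumes \<Phi>: "\<Phi> \<in> Linf0_dual \<mu>" and \<Psi>: "\<Psi> \<in> Linf0_dual \<mu>"
  shows "arens \<mu> \<Phi> \<Psi> \<in> Linf0_dual \<mu>"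
  unfolding Linf0_dual_iff
proof (intro conjI allI impI)
  note \<Phi>D = Linf0_dual_dual[OF \<Phi>] and \<Psi>D = Linf0_dual_dual[OF \<Psi>]
  show "arens \<mu> \<Phi> \<Psi> \<in> Linf_dual \<mu>" by (rule arens_dual(1)[OF \<Phi>D \<Psi>D])
  fix \<epsilon> :: real assume e: "0 < \<epsilon>"
  let ?p = "dual_norm \<mu> \<Phi>" and ?q = "dual_norm \<mu> \<Psi>"
  note p0 = dual_bounded(3)[OF \<Phi>D] and q0 = dual_bounded(3)[OF \<Psi>D]
  \<comment> \<open>The two error terms below add up to \<open>(?p + ?q) * d * \<parallel>f\<parallel>\<close>; the summand \<open>1\<close> keeps the denominator
    positive.\<close>
  define d where "d = \<epsilon> / (?p + ?q + 1)"
  have d: "0 < d" unfolding d_def using e p0 q0 by (intro divide_pos_pos) auto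
  obtain K where K: "compact K" "tail_small \<Phi> K d" by (rule Linf0_dual_tail[OF \<Phi> d]) 
  obtain L where L: "compact L" "tail_small \<Psi> L d" by (rule Linf0_dual_tail[OF \<Psi> d])
  let ?M = "(\<lambda>(x,y). x + y) ` (K \<times> L)"
  have "tail_small (arens \<mu> \<Phi> \<Psi>) ?M \<epsilon>" unfolding tail_small_def
  proof (intro ballI impI)
    fix f assume f: "f \<in> Linf \<mu>" and f0: "\<forall>x\<in>?M. f x = 0"
    obtain g where g: "bdd_lm g" "aeq f g" "\<And>x. cmod (g x) \<le> Linf_norm \<mu> f" "\<And>x. f x = 0 \<Longrightarrow> g x = 0"
      by (rule bounded_representative[OF f]) (rule that; assumption)
    note h = act_dual(1)[OF \<Psi>D f]
    have KL: "Linf_norm \<mu> (\<lambda>x. indicator K x * act_dual \<mu> \<Psi> f x) \<le> d * Linf_norm \<mu> f"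
    proof (rule Linf_norm_by_duality[OF Linf_indicator(1)[OF h K(1)]])
      show "0 \<le> d * Linf_norm \<mu> f" using d Linf_norm_nonneg[OF f] by simp
      fix a assume a: "a \<in> L1 \<mu>"
      let ?a = "\<lambda>x. indicator K x * a x"
      have Ka: "?a \<in> L1 \<mu>" unfolding L1_def mem_Collect_eq
        by (rule L1_bounded_times[OF a, where c = 1]) (use compact_borel[OF K(1)] in \<open>auto simp: indicator_def[abs_def] measurable_If\<close>)
      have na: "nrm1 ?a \<le> nrm1 a" unfolding nrm1_def
      proof (rule integral_mono)
        show "integrable \<mu> (\<lambda>x. cmod (?a x))" "integrable \<mu> (\<lambda>x. cmod (a x))" using Ka a by (auto simp: L1_def)
        show "cmod (?a x) \<le> cmod (a x)" for x by (cases "x \<in> K") auto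
      qed
      have "pairing \<mu> (\<lambda>x. indicator K x * act_dual \<mu> \<Psi> f x) a = pairing \<mu> (act_dual \<mu> \<Psi> f) ?a"
        unfolding pairing_def by (simp add: ac_simps)
      also have "\<dots> = \<Psi> (act g ?a)" by (rule act_dual(3)[OF \<Psi>D f g(1,2) Ka])
      finally have eq: "pairing \<mu> (\<lambda>x. indicator K x * act_dual \<mu> \<Psi> f x) a = \<Psi> (act g ?a)" .
      have van: "\<forall>x\<in>L. act g ?a x = 0"
      proof
        fix x assume x: "x \<in> L"
        have z: "g (y + x) * ?a y = 0" for y
        proof (cases "y \<in> K")
          case True
          then have "(y, x) \<in> K \<times> L" using x by (rule SigmaI)
          then have "(\<lambda>(x,y). x + y) (y, x) \<in> ?M" by (rule imageI)
          then have "y + x \<in> ?M" by (simp only: prod.case)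
          then have "f (y + x) = 0" by (rule bspec[OF f0])
          then show ?thesis by (simp add: g(4))
        qed simp
        show "act g ?a x = 0" unfolding act_def z by simp
      qed
      have "cmod (\<Psi> (act g ?a)) \<le> d * Linf_norm \<mu> (act g ?a)"
        by (rule tail_smallD[OF L(2) bdd_lm_Linf[OF act_bdd_lm[OF g(1) Ka]] van])
      also have "Linf_norm \<mu> (act g ?a) \<le> Linf_norm \<mu> f * nrm1 ?a" unfolding nrm1_def
        by (intro Linf_norm_bound act_bound g(1,3) Ka)
      also have "\<dots> \<le> Linf_norm \<mu> f * nrm1 a" by (intro mult_left_mono na Linf_norm_nonneg f)
      finally show "cmod (pairing \<mu> (\<lambda>x. indicator K x * act_dual \<mu> \<Psi> f x) a) \<le> d * Linf_norm \<mu> f * nrm1 a"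
        unfolding eq using d by (simp add: mult.assoc)
    qed
    have "cmod (arens \<mu> \<Phi> \<Psi> f) \<le> ?p * (d * Linf_norm \<mu> f) + d * (?q * Linf_norm \<mu> f)"
      unfolding arens_eq[OF f] by (rule tail_estimate[OF \<Phi>D K _ h act_dual(2)[OF \<Psi>D f] KL]) (use d in simp)
    also have "\<dots> = (?p + ?q) * d * Linf_norm \<mu> f" by (simp add: algebra_simps)
    also have "\<dots> \<le> (?p + ?q + 1) * d * Linf_norm \<mu> f" using d Linf_norm_nonneg[OF f] by (intro mult_right_mono) auto
    also have "(?p + ?q + 1) * d = \<epsilon>" unfolding d_def using p0 q0 by simp
    finally show "cmod (arens \<mu> \<Phi> \<Psi> f) \<le> \<epsilon> * Linf_norm \<mu> f" .
  qed
  then show "\<exists>K. compact K \<and> tail_small (arens \<mu> \<Phi> \<Psi>) K \<epsilon>" by (intro exI[of _ ?M] conjI compact_plus K L)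
qed

text \<open>
  Let \<open>u\<close> have values in \<open>[0,1]\<close>, compact support \<open>C\<close> and \<open>u(0) = 1\<close>, so that \<open>E(u) = 1\<close>.  If \<open>g\<close>
  vanishes on \<open>C\<close> and \<open>c g\<close> is bounded by \<open>1\<close>, then so is \<open>u + c g\<close>.  Hence \<open>|1 + c E(g)| \<le> 1\<close> for
  every phase of \<open>c\<close>, which forces \<open>E(g) = 0\<close>.
\<close>
lemma right_identity_norm_one_Linf0:
  assumes E: "right_identity E" and n: "dual_norm \<mu> E = 1"
  shows "E \<in> Linf0_dual \<mu>"
  unfolding Linf0_dual_iff
proof (intro conjI allI impI)
  show ED: "E \<in> Linf_dual \<mu>" using E by (simp add: right_identity_def)
  fix \<epsilon> :: real assume e: "0 < \<epsilon>"
  have c0: "compact {0 :: 'g}" by simp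
  obtain u :: "'g \<Rightarrow> real" and C where u: "continuous_on UNIV u" "\<And>x. 0 \<le> u x" "\<And>x. u x \<le> 1"
    "\<And>x. x \<in> {0} \<Longrightarrow> u x = 1" "compact C" "C \<subseteq> UNIV" "\<And>x. x \<notin> C \<Longrightarrow> u x = 0"
    by (rule compact_support_cutoff[OF lc c0 open_UNIV subset_UNIV]) (rule that; assumption)
  let ?u = "\<lambda>x. complex_of_real (u x)"
  have uC: "?u \<in> Cc" unfolding Cc_def using u(5,7) by (auto intro!: continuous_intros u(1))
  have Eu: "E ?u = 1" using right_identity_Cc[OF E uC] u(4) by simp
  note uL = Cc_Linf[OF uC]
  have "tail_small E C \<epsilon>" unfolding tail_small_def
  proof (intro ballI impI)
    fix f assume f: "f \<in> Linf \<mu>" and f0: "\<forall>x\<in>C. f x = 0"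
    obtain g where g: "bdd_lm g" "aeq f g" "\<And>x. cmod (g x) \<le> Linf_norm \<mu> f" "\<And>x. f x = 0 \<Longrightarrow> g x = 0"
      by (rule bounded_representative[OF f]) (rule that; assumption)
    note gL = bdd_lm_Linf[OF g(1)]
    \<comment> \<open>Adding \<open>1\<close> to the norm makes the bound \<open>m\<close> positive.\<close>
    define m where "m = Linf_norm \<mu> f + 1"
    have m: "0 < m" "cmod (g x) \<le> m" for x unfolding m_def using Linf_norm_nonneg[OF f] g(3)[of x] by linarith+
    have Efg: "E f = E g" by (rule dual_cong[OF ED g(2) f gL])
    have "E g = 0"
    proof (rule ccontr)
      assume nz: "E g \<noteq> 0"
      \<comment> \<open>The phase of \<open>c\<close> makes \<open>c * E g\<close> positive.\<close>
      define c where "c = cnj (E g) / complex_of_real (cmod (E g)) / complex_of_real m"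
      have cm: "cmod c = 1 / m" unfolding c_def using nz m(1) by (simp add: norm_divide norm_mult)
      have cE: "c * E g = complex_of_real (cmod (E g) / m)"
        unfolding c_def using nz m(1) by (simp add: complex_norm_square[symmetric] power2_eq_square mult.commute field_simps)
      let ?w = "\<lambda>x. ?u x + c * g x"
      have "cmod (?w x) \<le> 1" for x
      proof (cases "x \<in> C")
        case True
        then have "g x = 0" using f0 g(4) by simp
        then show ?thesis using u(2,3)[of x] by simp
      next
        case False
        have "cmod (c * g x) = cmod (g x) / m" by (simp add: norm_mult cm)
        also have "\<dots> \<le> 1" using m by simp
        finally show ?thesis using u(7)[OF False] by simp
      qed
      then have "Linf_norm \<mu> ?w \<le> 1" by (rule Linf_norm_bound)
      moreover have wL: "?w \<in> Linf \<mu>" by (intro Linf_add(1) uL Linf_scale(1) gL)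
      ultimately have "cmod (E ?w) \<le> 1" using dual_bounded(2)[OF ED wL] n by simp
      moreover have "E ?w = complex_of_real (1 + cmod (E g) / m)"
        using dual_add[OF ED uL Linf_scale(1)[OF gL]] dual_scale[OF ED gL] Eu cE by simp
      ultimately have "\<bar>1 + cmod (E g) / m\<bar> \<le> 1" by (simp only: norm_of_real)
      then show False using nz m by (simp add: field_simps)
    qed
    then show "cmod (E f) \<le> \<epsilon> * Linf_norm \<mu> f" using Efg e Linf_norm_nonneg[OF f] by simp
  qed
  then show "\<exists>K. compact K \<and> tail_small E K \<epsilon>" using u(5) by (intro exI[of _ C] conjI)
qed

lemma L1_compact_approximation:
  assumes a: "a \<in> L1 \<mu>" and e: "0 < \<epsilon>"
  obtains K where "compact K" "nrm1 (\<lambda>x. a x - indicator K x * a x) < \<epsilon>"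
proof -
  have ai: "integrable \<mu> a" using a by (simp add: L1_def)
  obtain S where S: "sigma_compact S" "\<And>x. x \<notin> S \<Longrightarrow> a x = 0"
    by (rule integrable_sigma_compact_support[OF ai]) (rule that; assumption)
  obtain K where K: "\<And>n::nat. compact (K n)" "S = (\<Union>n. K n)" using S(1) unfolding sigma_compact_def by metis
  define U where "U n = (\<Union>i\<le>n. K i)" for n
  have U: "compact (U n)" for n unfolding U_def by (intro compact_UN K) simp
  have "(\<lambda>n. LINT x|\<mu>. cmod (a x - indicator (U n) x * a x)) \<longlonglongrightarrow> (LINT x|\<mu>. 0)"
  proof (rule integral_dominated_convergence[where w = "\<lambda>x. cmod (a x)"])
    show "integrable \<mu> (\<lambda>x. cmod (a x))" using ai by simp
    have am: "a \<in> borel_measurable borel" by (rule L1_measurable[OF a])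
    show "(\<lambda>x. cmod (a x - indicator (U n) x * a x)) \<in> borel_measurable \<mu>" for n
      using am compact_borel[OF U[of n]] by simp
    show "AE x in \<mu>. norm (cmod (a x - indicator (U n) x * a x)) \<le> cmod (a x)" for n
      by (rule AE_I2) (auto simp: indicator_def)
    show "AE x in \<mu>. (\<lambda>n. cmod (a x - indicator (U n) x * a x)) \<longlonglongrightarrow> 0"
    proof (rule AE_I2)
      fix x
      show "(\<lambda>n. cmod (a x - indicator (U n) x * a x)) \<longlonglongrightarrow> 0"
      proof (cases "x \<in> S")
        case True
        then obtain k where "x \<in> K k" unfolding K(2) by (rule UN_E)
        then have "cmod (a x - indicator (U n) x * a x) = 0" if "k \<le> n" for n
          using that unfolding U_def by (subst indicator_simps(1)) (auto intro!: bexI[of _ k])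
        then show ?thesis by (intro tendsto_eventually) (auto simp: eventually_sequentially)
      qed (simp add: S(2))
    qed
  qed simp
  then have "eventually (\<lambda>n. (LINT x|\<mu>. cmod (a x - indicator (U n) x * a x)) < \<epsilon>) sequentially"
    using e by (intro order_tendstoD(2)) auto
  then obtain n where "(LINT x|\<mu>. cmod (a x - indicator (U n) x * a x)) < \<epsilon>" by (auto simp: eventually_sequentially)
  then show ?thesis using that[OF U[of n]] unfolding nrm1_def by simp
qed

text \<open>
  Through this embedding \<open>functional_fubini\<close> applies to integration against \<open>a\<close>.
\<close>
lemma L1_in_Linf0_dual:
  assumes a: "a \<in> L1 \<mu>"
  shows "(\<lambda>f. if f \<in> Linf \<mu> then pairing \<mu> f a else 0) \<in> Linf0_dual \<mu>" (is "?\<Phi> \<in> _")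
  unfolding Linf0_dual_iff
proof (intro conjI allI impI)
  show "?\<Phi> \<in> Linf_dual \<mu>" by (rule L1_in_dual[OF a])
  fix \<epsilon> :: real assume e: "0 < \<epsilon>"
  obtain K where K: "compact K" "nrm1 (\<lambda>x. a x - indicator K x * a x) < \<epsilon>"
    by (rule L1_compact_approximation[OF a e])
  let ?b = "\<lambda>x. a x - indicator K x * a x"
  have "integrable \<mu> (\<lambda>x. indicator K x * a x)"
    by (rule L1_bounded_times[OF a, where c = 1]) (use compact_borel[OF K(1)] in \<open>auto simp: indicator_def[abs_def] measurable_If\<close>)
  then have b: "?b \<in> L1 \<mu>" using a by (simp add: L1_def)
  have "tail_small ?\<Phi> K \<epsilon>" unfolding tail_small_def
  proof (intro ballI impI)
    fix f assume f: "f \<in> Linf \<mu>" and f0: "\<forall>x\<in>K. f x = 0"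
    have "f x * a x = f x * ?b x" for x using f0 by (cases "x \<in> K") auto
    then have "pairing \<mu> f a = pairing \<mu> f ?b" unfolding pairing_def by (rule Bochner_Integration.integral_cong[OF refl])
    also have "cmod \<dots> \<le> Linf_norm \<mu> f * nrm1 ?b" by (rule pairing_bound[OF f b])
    also have "\<dots> \<le> Linf_norm \<mu> f * \<epsilon>" using K(2) Linf_norm_nonneg[OF f] by (intro mult_left_mono) auto
    finally show "cmod (?\<Phi> f) \<le> \<epsilon> * Linf_norm \<mu> f" using f by (simp add: mult.commute)
  qed
  then show "\<exists>K. compact K \<and> tail_small ?\<Phi> K \<epsilon>" using K(1) by (intro exI[of _ K] conjI)
qed

end

section \<open>The trivolution\<close>

context haar_group
begin

text \<open>
  Continuity comes from the uniform continuity of \<open>g\<close> under left translations: for small \<open>v\<close> the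
  slices at \<open>v + x\<close> and \<open>x\<close> are uniformly close.
\<close>
lemma Cc_slice_left:
  assumes H: "H \<in> Linf_dual \<mu>" and g: "g \<in> Cc" and B: "\<And>x. cmod (g x) \<le> B"
  shows "bdd_lm (\<lambda>x. H (\<lambda>y. g (x + y)))" "cmod (H (\<lambda>y. g (x + y))) \<le> dual_norm \<mu> H * B"
proof -
  have L: "(\<lambda>y. g (x + y)) \<in> Linf \<mu>" for x by (intro Cc_Linf Cc_translate g)
  show b: "cmod (H (\<lambda>y. g (x + y))) \<le> dual_norm \<mu> H * B" for x
    by (rule order_trans[OF dual_bounded(2)[OF H L] mult_left_mono[OF Linf_norm_bound[OF B] dual_bounded(3)[OF H]]])
  have "continuous_on UNIV (\<lambda>x. H (\<lambda>y. g (x + y)))"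
  proof (rule continuous_onI_translate)
    fix x and \<epsilon> :: real assume e: "0 < \<epsilon>"
    let ?d = "\<epsilon> / (dual_norm \<mu> H + 1)"
    have p: "0 < dual_norm \<mu> H + 1" using dual_bounded(3)[OF H] by simp
    have d: "0 < ?d" using e p by simp
    obtain V where V: "open V" "0 \<in> V" "\<And>v x. v \<in> V \<Longrightarrow> cmod (g (v + x) - g x) < ?d"
      by (rule Cc_left_uniformly_continuous[OF g d]) (rule that; assumption)
    have "cmod (H (\<lambda>y. g (v + x + y)) - H (\<lambda>y. g (x + y))) < \<epsilon>" if v: "v \<in> V" for v
    proof -
      have "cmod (g (v + x + y) - g (x + y)) \<le> ?d" for y using V(3)[OF v, of "x + y"] by (simp add: add.assoc)
      then have "cmod (H (\<lambda>y. g (v + x + y)) - H (\<lambda>y. g (x + y))) \<le> dual_norm \<mu> H * ?d"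
        by (rule dual_approx[OF H L L])
      also have "\<dots> < (dual_norm \<mu> H + 1) * ?d" by (intro mult_strict_right_mono d) simp
      also have "\<dots> = \<epsilon>" using p by simp
      finally show ?thesis .
    qed
    then show "\<exists>V. open V \<and> 0 \<in> V \<and> (\<forall>v\<in>V. cmod (H (\<lambda>y. g (v + x + y)) - H (\<lambda>y. g (x + y))) < \<epsilon>)"
      using V(1,2) by (intro exI[of _ V] conjI ballI)
  qed
  then show "bdd_lm (\<lambda>x. H (\<lambda>y. g (x + y)))" by (rule continuous_bdd_lm[OF _ b])
qed

lemma dual_reflect:
  assumes F: "F \<in> Linf_dual \<mu>"
  shows "(\<lambda>f. cnj (F (reflect f))) \<in> Linf_dual \<mu>" "dual_norm \<mu> (\<lambda>f. cnj (F (reflect f))) \<le> dual_norm \<mu> F"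
proof -
  have b: "cmod (cnj (F (reflect f))) \<le> dual_norm \<mu> F * Linf_norm \<mu> f" if f: "f \<in> Linf \<mu>" for f
    using order_trans[OF dual_bounded(2)[OF F Linf_reflect(1)[OF f]] mult_left_mono[OF Linf_reflect(2)[OF f] dual_bounded(3)[OF F]]] by simp
  show "dual_norm \<mu> (\<lambda>f. cnj (F (reflect f))) \<le> dual_norm \<mu> F" by (rule dual_norm_le[OF dual_bounded(3)[OF F] b])
  show "(\<lambda>f. cnj (F (reflect f))) \<in> Linf_dual \<mu>"
  proof (rule Linf_dualI[OF _ _ b])
    fix f assume f: "f \<in> Linf \<mu>"
    show "cnj (F (reflect (\<lambda>x. f x + g x))) = cnj (F (reflect f)) + cnj (F (reflect g))" if g: "g \<in> Linf \<mu>" for g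
    proof -
      have "reflect (\<lambda>x. f x + g x) = (\<lambda>x. reflect f x + reflect g x)" by (simp add: reflect_def)
      then show ?thesis using dual_add[OF F Linf_reflect(1)[OF f] Linf_reflect(1)[OF g]] by simp
    qed
    show "cnj (F (reflect (\<lambda>x. c * f x))) = c * cnj (F (reflect f))" for c
    proof -
      have "reflect (\<lambda>x. c * f x) = (\<lambda>x. cnj c * reflect f x)" by (simp add: reflect_def)
      then show ?thesis using dual_scale[OF F Linf_reflect(1)[OF f]] by simp
    qed
  next
    fix f assume "f \<notin> Linf \<mu>"
    then show "cnj (F (reflect f)) = 0" using dual_outside[OF F] by (simp add: Linf_reflect_iff)
  qed
qed

definition star :: "(('g \<Rightarrow> complex) \<Rightarrow> complex) \<Rightarrow> ('g \<Rightarrow> complex) \<Rightarrow> complex" where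
  "star F = (\<lambda>f. cnj (F (reflect f)))"

lemma star_star [simp]: "star (star F) = F" by (simp add: star_def)

lemma star_lincomb: "star (\<lambda>f. F f + c * G f) = (\<lambda>f. star F f + cnj c * star G f)"
  by (simp add: star_def)

lemma star_dual: "F \<in> Linf_dual \<mu> \<Longrightarrow> star F \<in> Linf_dual \<mu>" "F \<in> Linf_dual \<mu> \<Longrightarrow> dual_norm \<mu> (star F) \<le> dual_norm \<mu> F"
  unfolding star_def by (rule dual_reflect; assumption)+

lemma star_Linf0:
  assumes F: "F \<in> Linf0_dual \<mu>" shows "star F \<in> Linf0_dual \<mu>"
  unfolding Linf0_dual_iff
proof (intro conjI allI impI)
  show "star F \<in> Linf_dual \<mu>" by (rule star_dual(1)[OF Linf0_dual_dual[OF F]])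
  fix \<epsilon> :: real assume e: "0 < \<epsilon>"
  obtain K where K: "compact K" "tail_small F K \<epsilon>" by (rule Linf0_dual_tail[OF F e])
  have "tail_small (star F) (uminus ` K) \<epsilon>" unfolding tail_small_def
  proof (intro ballI impI)
    fix f assume f: "f \<in> Linf \<mu>" and f0: "\<forall>x\<in>uminus ` K. f x = 0"
    have "\<forall>x\<in>K. reflect f x = 0" using f0 by (simp add: reflect_def)
    then have "cmod (F (reflect f)) \<le> \<epsilon> * Linf_norm \<mu> (reflect f)"
      using K(2) Linf_reflect(1)[OF f] unfolding tail_small_def by simp
    also have "\<dots> \<le> \<epsilon> * Linf_norm \<mu> f" using e by (intro mult_left_mono Linf_reflect(2) f) simp
    finally show "cmod (star F f) \<le> \<epsilon> * Linf_norm \<mu> f" by (simp add: star_def)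
  qed
  then show "\<exists>K. compact K \<and> tail_small (star F) K \<epsilon>" by (intro exI[of _ "uminus ` K"] conjI compact_neg K(1))
qed

text \<open>
  The reflection turns the right slices of \<open>g\<close> into left slices of \<open>g\<^sup>~\<close>.
\<close>
lemma Cc_slice_right:
  assumes H: "H \<in> Linf_dual \<mu>" and g: "g \<in> Cc" and B: "\<And>x. cmod (g x) \<le> B"
  shows "bdd_lm (\<lambda>y. H (\<lambda>x. g (x + y)))"
proof -
  have SB: "cmod (reflect g x) \<le> B" for x using B[of "- x"] by (simp add: reflect_def)
  note S = Cc_slice_left(1)[OF star_dual(1)[OF H] Cc_reflect[OF g] SB]
  have "reflect (\<lambda>x. star H (\<lambda>y. reflect g (x + y))) = (\<lambda>y. H (\<lambda>x. g (x + y)))"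
    by (simp add: reflect_def star_def minus_add)
  moreover have "bdd_lm (reflect f)" if fb: "bdd_lm f" for f
  proof -
    obtain c where c: "\<forall>x. cmod (f x) \<le> c" using fb unfolding bdd_lm_def by blast
    have "cmod (reflect f x) \<le> c" for x using c by (simp add: reflect_def)
    then show ?thesis using Linf_D[OF Linf_reflect(1)[OF bdd_lm_Linf[OF fb]]] unfolding bdd_lm_def by blast
  qed
  ultimately show ?thesis using S by metis
qed

text \<open>
  Round \<open>x\<close> to finitely many points \<open>i\<close> on a compact set \<open>K\<close> that nearly carries \<open>F\<close>.  Both iterated
  values are then close to \<open>?S\<close>, the sum over \<open>i\<close> of \<open>H(y \<mapsto> g(i + y))\<close> times the value of \<open>F\<close> at the
  indicator function of the set of points rounded to \<open>i\<close>.  The rounding is good uniformly in \<open>y\<close>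
  because \<open>g\<close> is uniformly continuous under left translations, and so \<open>H\<close> may be any bounded
  functional.
\<close>
theorem functional_fubini:
  assumes F0: "F \<in> Linf0_dual \<mu>" and H: "H \<in> Linf_dual \<mu>" and g: "g \<in> Cc"
  shows "F (\<lambda>x. H (\<lambda>y. g (x + y))) = H (\<lambda>y. F (\<lambda>x. g (x + y)))"
proof -
  obtain B where B: "\<And>x. cmod (g x) \<le> B" by (rule Cc_bounded[OF g]) (rule that; assumption)
  show ?thesis
  proof (rule eq_if_norm_le_all_eps)
    fix \<epsilon> :: real assume e: "0 < \<epsilon>"
    note F = Linf0_dual_dual[OF F0]
    let ?p = "dual_norm \<mu> F" and ?q = "dual_norm \<mu> H"
    note q0 = dual_bounded(3)[OF H]
    have B0: "0 \<le> B" using order_trans[OF norm_ge_zero B] .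
    obtain K where K: "compact K" "tail_small F K \<epsilon>" by (rule Linf0_dual_tail[OF F0 e])
    obtain V where V: "open V" "0 \<in> V" "\<And>v x. v \<in> V \<Longrightarrow> cmod (g (v + x) - g x) < \<epsilon>"
      by (rule Cc_left_uniformly_continuous[OF g e]) (rule that; assumption)
    obtain I r where r: "finite I" "\<And>x. x \<in> K \<Longrightarrow> r x \<in> I" "\<And>x. x \<in> K \<Longrightarrow> x - r x \<in> V" "\<And>i. {x\<in>K. r x = i} \<in> sets borel"
      by (rule Borel_rounding[OF K(1) V(1,2)]) (rule that; assumption)
    let ?A = "\<lambda>i. {x\<in>K. r x = i}"
    define P where "P x = H (\<lambda>y. g (x + y))" for x
    define Q where "Q y = F (\<lambda>x. g (x + y))" for y
    have PL: "P \<in> Linf \<mu>" unfolding P_def by (intro bdd_lm_Linf Cc_slice_left[OF H g B])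
    have QL: "Q \<in> Linf \<mu>" unfolding Q_def by (intro bdd_lm_Linf Cc_slice_right[OF F g B])
    have Pb: "cmod (P x) \<le> ?q * B" for x unfolding P_def by (rule Cc_slice_left(2)[OF H g B])
    have gxL: "(\<lambda>y. g (x + y)) \<in> Linf \<mu>" for x by (intro Cc_Linf Cc_translate g)
    have gyL: "(\<lambda>x. g (x + y)) \<in> Linf \<mu>" for y by (intro Cc_Linf Cc_right_translate g)
    have iA: "(indicator (?A i) :: 'g \<Rightarrow> complex) \<in> Linf \<mu>" for i
    proof (rule bdd_lm_Linf)
      have "locally_measurable_fun \<mu> (indicator (?A i))" using r(4)[of i] by (intro borel_imp_locally_measurable) simp
      moreover have "cmod (indicator (?A i) x) \<le> 1" for x by (simp add: indicator_def)
      ultimately show "bdd_lm (indicator (?A i))" unfolding bdd_lm_def by blast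
    qed
    have step: "(\<Sum>i\<in>I. c i * indicator (?A i) x) = (if x \<in> K then c (r x) else 0)" for c :: "'g \<Rightarrow> complex" and x
    proof (cases "x \<in> K")
      case True
      have "(\<Sum>i\<in>I. c i * indicator (?A i) x) = (\<Sum>i\<in>I. if i = r x then c i else 0)"
        by (rule sum.cong) (use True in \<open>auto simp: indicator_def\<close>)
      then show ?thesis using True r(1,2) by simp
    qed (simp add: indicator_def)
    have Fstep: "(\<lambda>x. \<Sum>i\<in>I. c i * indicator (?A i) x) \<in> Linf \<mu>" 
      "F (\<lambda>x. \<Sum>i\<in>I. c i * indicator (?A i) x) = (\<Sum>i\<in>I. c i * F (indicator (?A i)))" for c :: "'g \<Rightarrow> complex"
      using dual_sum[OF F r(1), of "\<lambda>i x. c i * indicator (?A i) x"] Linf_scale(1)[OF iA] dual_scale[OF F iA] by simp_all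
    have near: "cmod (g (x + y) - g (r x + y)) \<le> \<epsilon>" if "x \<in> K" for x y
      using V(3)[OF r(3)[OF that], of "r x + y"] by (simp add: add.assoc[symmetric])
    let ?S = "\<Sum>i\<in>I. P i * F (indicator (?A i))"
    have 1: "cmod (F P - ?S) \<le> ?p * (?q * \<epsilon>) + \<epsilon> * (?q * (2 * B))"
    proof -
      let ?d = "\<lambda>x. P x - (\<Sum>i\<in>I. P i * indicator (?A i) x)"
      have dL: "?d \<in> Linf \<mu>" by (rule Linf_diff[OF PL Fstep(1)])
      have dK: "cmod (?d x) \<le> ?q * \<epsilon>" if "x \<in> K" for x
      proof -
        have "cmod (P x - P (r x)) \<le> ?q * \<epsilon>" unfolding P_def by (rule dual_approx[OF H gxL gxL near[OF that]])
        then show ?thesis unfolding step using that by simp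
      qed
      have db: "cmod (?d x) \<le> ?q * (2 * B)" for x
      proof (cases "x \<in> K")
        case True
        then show ?thesis unfolding step using norm_triangle_ineq4[of "P x" "P (r x)"] Pb[of x] Pb[of "r x"] by simp
      next
        case False
        have "cmod (P x) \<le> ?q * (2 * B)" by (rule order_trans[OF Pb mult_left_mono[OF _ q0]]) (use B0 in simp)
        then show ?thesis unfolding step using False by simp
      qed
      have "0 \<le> \<epsilon>" "0 \<le> ?q * \<epsilon>" using e q0 by simp_all
      then have "cmod (F ?d) \<le> ?p * (?q * \<epsilon>) + \<epsilon> * (?q * (2 * B))"
        by (rule tail_estimate_pointwise[OF F K _ dL db]) (rule dK)
      moreover have "F ?d = F P - ?S" using dual_diff[OF F PL Fstep(1)] Fstep(2) by simp
      ultimately show ?thesis by simp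
    qed
    have 2: "cmod (H Q - ?S) \<le> ?q * (?p * \<epsilon> + \<epsilon> * (2 * B))"
    proof -
      let ?T = "\<lambda>y. \<Sum>i\<in>I. F (indicator (?A i)) * g (i + y)"
      have L: "(\<lambda>y. F (indicator (?A i)) * g (i + y)) \<in> Linf \<mu>" for i by (rule Linf_scale(1)[OF gxL])
      note T = dual_sum[OF H r(1), of "\<lambda>i y. F (indicator (?A i)) * g (i + y)", OF L]
      have HT: "H ?T = ?S" unfolding conjunct2[OF T] dual_scale[OF H gxL] P_def by (simp only: mult.commute)
      have "cmod (Q y - ?T y) \<le> ?p * \<epsilon> + \<epsilon> * (2 * B)" for y
      proof -
        let ?d = "\<lambda>x. g (x + y) - (\<Sum>i\<in>I. g (i + y) * indicator (?A i) x)"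
        have dL: "?d \<in> Linf \<mu>" by (rule Linf_diff[OF gyL Fstep(1)])
        have dK: "cmod (?d x) \<le> \<epsilon>" if "x \<in> K" for x unfolding step using near[OF that, of y] that by simp
        have db: "cmod (?d x) \<le> 2 * B" for x
        proof (cases "x \<in> K")
          case True
          then show ?thesis unfolding step using norm_triangle_ineq4[of "g (x + y)" "g (r x + y)"] B[of "x + y"] B[of "r x + y"] by simp
        next
          case False then show ?thesis unfolding step using B[of "x + y"] B0 by simp
        qed
        have "0 \<le> \<epsilon>" using e by simp
        from this this have "cmod (F ?d) \<le> ?p * \<epsilon> + \<epsilon> * (2 * B)"
          by (rule tail_estimate_pointwise[OF F K _ dL db]) (rule dK)
        moreover have "F ?d = Q y - ?T y" unfolding Q_def using dual_diff[OF F gyL Fstep(1)] Fstep(2) by (simp add: mult.commute)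
        ultimately show ?thesis by simp
      qed
      from dual_approx[OF H QL conjunct1[OF T] this] show ?thesis unfolding HT .
    qed
    have "F P - H Q = (F P - ?S) - (H Q - ?S)" by simp
    then have "cmod (F P - H Q) \<le> cmod (F P - ?S) + cmod (H Q - ?S)" by (simp only: norm_triangle_ineq4)
    with 1 2 have "cmod (F P - H Q) \<le> (?p * (?q * \<epsilon>) + \<epsilon> * (?q * (2 * B))) + ?q * (?p * \<epsilon> + \<epsilon> * (2 * B))" by linarith
    also have "\<dots> = (2 * ?q * (?p + 2 * B)) * \<epsilon>" by (simp add: algebra_simps)
    finally show "cmod (F (\<lambda>x. H (\<lambda>y. g (x + y))) - H (\<lambda>y. F (\<lambda>x. g (x + y)))) \<le> (2 * ?q * (?p + 2 * B)) * \<epsilon>"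
      unfolding P_def Q_def .
  qed
qed

text \<open>
  Interchange \<open>H\<close> with the integration against \<open>a\<close>.
\<close>
lemma act_dual_Cc:
  assumes H: "H \<in> Linf_dual \<mu>" and g: "g \<in> Cc"
  shows "aeq (act_dual \<mu> H g) (\<lambda>x. H (\<lambda>y. g (x + y)))"
proof -
  obtain B where B: "\<And>x. cmod (g x) \<le> B" by (rule Cc_bounded[OF g]) (rule that; assumption)
  note PL = bdd_lm_Linf[OF Cc_slice_left(1)[OF H g B]]
  show ?thesis
  proof (rule act_dual_eqI[OF H Cc_bdd_lm[OF g] aeq_refl Cc_Linf[OF g] PL])
    fix a assume a: "a \<in> L1 \<mu>"
    have L: "(\<lambda>x. g (x + y)) \<in> Linf \<mu>" for y by (intro Cc_Linf Cc_right_translate g)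
    show "H (act g a) = pairing \<mu> (\<lambda>x. H (\<lambda>y. g (x + y))) a"
      using functional_fubini[OF L1_in_Linf0_dual[OF a] H g] PL L by (simp add: act_def pairing_def)
  qed
qed

lemma arens_Cc:
  assumes F: "F \<in> Linf_dual \<mu>" and H: "H \<in> Linf_dual \<mu>" and g: "g \<in> Cc"
  shows "arens \<mu> F H g = F (\<lambda>x. H (\<lambda>y. g (x + y)))"
proof -
  obtain B where B: "\<And>x. cmod (g x) \<le> B" by (rule Cc_bounded[OF g]) (rule that; assumption)
  note PL = bdd_lm_Linf[OF Cc_slice_left(1)[OF H g B]]
  show ?thesis unfolding arens_eq[OF Cc_Linf[OF g]]
    by (rule dual_cong[OF F act_dual_Cc[OF H g] act_dual(1)[OF H Cc_Linf[OF g]] PL])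
qed

text \<open>
  The reflection of a product \<open>x + y\<close> is \<open>- y - x\<close>, so it reverses the order in which the two
  functionals are applied; the interchange of the two restores it.
\<close>
lemma star_arens_Cc:
  assumes F: "F \<in> Linf0_dual \<mu>" and H: "H \<in> Linf0_dual \<mu>" and g: "g \<in> Cc"
  shows "star (arens \<mu> F H) g = arens \<mu> (star H) (star F) g"
proof -
  note FD = Linf0_dual_dual[OF F] and HD = Linf0_dual_dual[OF H]
  have "star (arens \<mu> F H) g = cnj (F (\<lambda>x. H (\<lambda>y. reflect g (x + y))))"
    unfolding star_def arens_Cc[OF FD HD Cc_reflect[OF g]] ..
  also have "\<dots> = cnj (H (\<lambda>y. F (\<lambda>x. reflect g (x + y))))"
    unfolding functional_fubini[OF F HD Cc_reflect[OF g]] ..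
  also have "\<dots> = star H (\<lambda>x. star F (\<lambda>y. g (x + y)))"
    by (simp add: star_def reflect_def minus_add)
  also have "\<dots> = arens \<mu> (star H) (star F) g"
    by (rule arens_Cc[OF star_dual(1)[OF HD] star_dual(1)[OF FD] g, symmetric])
  finally show ?thesis .
qed

text \<open>
  On continuous functions of compact support \<open>\<tau>(F)\<close> coincides with \<open>F\<^sup>*\<close>, and these values of
  \<open>\<tau>(F)\<close> and of \<open>F\<close> are all that a product with left factor \<open>E\<close> retains.
\<close>
theorem trivolution_exists:
  assumes E: "right_identity E" and n: "dual_norm \<mu> E = 1"
  shows "trivolution_onto (Linf0_dual_alg \<mu>) {arens \<mu> E F | F. F \<in> Linf0_dual \<mu>} (\<lambda>F. arens \<mu> E (star F))"
proof -
  define \<tau> where "\<tau> F = arens \<mu> E (star F)" for F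
  have ED: "E \<in> Linf_dual \<mu>" using E by (simp add: right_identity_def)
  have E0: "E \<in> Linf0_dual \<mu>" by (rule right_identity_norm_one_Linf0[OF E n])
  note D = Linf0_dual_dual
  have \<tau>0: "\<tau> F \<in> Linf0_dual \<mu>" if "F \<in> Linf0_dual \<mu>" for F
    unfolding \<tau>_def by (intro Linf0_dual_arens E0 star_Linf0 that)
  have lin: "\<tau> (\<lambda>f. F f + c * G f) = (\<lambda>f. \<tau> F f + cnj c * \<tau> G f)" if "F \<in> Linf0_dual \<mu>" "G \<in> Linf0_dual \<mu>" for F G c
    unfolding \<tau>_def star_lincomb by (intro arens_lincomb_right ED star_dual(1) D that)
  have add: "\<tau> (\<lambda>f. F f + G f) = (\<lambda>f. \<tau> F f + \<tau> G f)" if "F \<in> Linf0_dual \<mu>" "G \<in> Linf0_dual \<mu>" for F G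
    using lin[OF that, of 1] by simp
  have scale: "\<tau> (\<lambda>f. c * F f) = (\<lambda>f. cnj c * \<tau> F f)" if "F \<in> Linf0_dual \<mu>" for F c
    \<comment> \<open>The function \<open>c F\<close> is written as \<open>F + (c - 1) F\<close>.\<close>
    using lin[OF that that, of "c - 1"] by (simp add: algebra_simps)
  have anti: "\<tau> (arens \<mu> F G) = arens \<mu> (\<tau> G) (\<tau> F)" if F: "F \<in> Linf0_dual \<mu>" and G: "G \<in> Linf0_dual \<mu>" for F G
  proof -
    have "\<tau> (arens \<mu> F G) = arens \<mu> E (arens \<mu> (star G) (star F))" unfolding \<tau>_def
      by (rule Linf0_arens_cong[OF ED star_Linf0[OF Linf0_dual_arens[OF F G]] Linf0_dual_arens[OF star_Linf0[OF G] star_Linf0[OF F]]])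
        (rule star_arens_Cc[OF F G])
    also have "\<dots> = arens \<mu> (\<tau> G) (\<tau> F)" unfolding \<tau>_def
      by (rule right_identity_arens_arens[OF E star_dual(1)[OF D[OF G]] star_dual(1)[OF D[OF F]], symmetric])
    finally show ?thesis .
  qed
  have EE: "\<tau> E = E"
  proof -
    have "star E g = E g" if g: "g \<in> Cc" for g
      unfolding star_def right_identity_Cc[OF E Cc_reflect[OF g]] right_identity_Cc[OF E g] by (simp add: reflect_def)
    then have "\<tau> E = arens \<mu> E E" unfolding \<tau>_def by (rule Linf0_arens_cong[OF ED star_Linf0[OF E0] E0])
    then show ?thesis using E by (simp add: right_identity_def)
  qed
  have Ene: "E \<noteq> (\<lambda>f. 0)"
  proof
    assume z: "E = (\<lambda>f. 0)"
    have "dual_norm \<mu> E \<le> 0" by (rule dual_norm_le) (simp_all add: z)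
    then show False using n by simp
  qed
  have sq: "\<tau> (\<tau> F) = arens \<mu> E F" if F: "F \<in> Linf0_dual \<mu>" for F
  proof -
    have "star (\<tau> F) g = F g" if g: "g \<in> Cc" for g
    proof -
      have "star (\<tau> F) g = cnj (star F (reflect g))"
        unfolding \<tau>_def star_def[of "arens \<mu> E (star F)"] right_identity_arens_Cc[OF E star_dual(1)[OF D[OF F]] Cc_reflect[OF g]] ..
      then show ?thesis by (simp add: star_def)
    qed
    then show ?thesis unfolding \<tau>_def[of "\<tau> F"]
      by (rule Linf0_arens_cong[OF ED star_Linf0[OF \<tau>0[OF F]] F])
  qed
  have cube: "\<tau> (\<tau> (\<tau> F)) = \<tau> F" if F: "F \<in> Linf0_dual \<mu>" for F
  proof -
    have "\<tau> (\<tau> (\<tau> F)) = arens \<mu> E (\<tau> F)" by (rule sq[OF \<tau>0[OF F]])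
    also have "\<dots> = arens \<mu> E (star F)" unfolding \<tau>_def
      by (rule arens_cong_right[OF ED arens_dual(1)[OF ED star_dual(1)[OF D[OF F]]] star_dual(1)[OF D[OF F]]])
        (rule right_identity_arens_act[OF E star_dual(1)[OF D[OF F]]])
    finally show ?thesis by (simp add: \<tau>_def)
  qed
  have nrm: "dual_norm \<mu> (\<tau> F) \<le> dual_norm \<mu> F" if F: "F \<in> Linf0_dual \<mu>" for F
  proof -
    have "dual_norm \<mu> (\<tau> F) \<le> dual_norm \<mu> E * dual_norm \<mu> (star F)"
      unfolding \<tau>_def by (rule arens_dual(2)[OF ED star_dual(1)[OF D[OF F]]])
    then show ?thesis using star_dual(2)[OF D[OF F]] n by simp
  qed
  let ?N = "{dual_norm \<mu> (\<tau> F) | F. F \<in> Linf0_dual \<mu> \<and> dual_norm \<mu> F \<le> 1}"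
  have N1: "t \<le> 1" if "t \<in> ?N" for t
  proof -
    obtain F where "t = dual_norm \<mu> (\<tau> F)" "F \<in> Linf0_dual \<mu>" "dual_norm \<mu> F \<le> 1" using \<open>t \<in> ?N\<close> by blast
    then show ?thesis using nrm[of F] by simp
  qed
  \<comment> \<open>The supremum is attained at the fixed point \<open>E\<close>.\<close>
  have "1 \<in> ?N" unfolding mem_Collect_eq by (rule exI[of _ E]) (simp add: EE n E0)
  then have sup: "Sup ?N = 1" by (rule cSup_eq_maximum) (rule N1)
  have bdd: "bdd_above ?N" by (rule bdd_aboveI) (rule N1)
  have triv: "trivolution (Linf0_dual_alg \<mu>) \<tau>"
    unfolding trivolution_def Linf0_dual_alg_def normed_alg.simps
    using E0 EE Ene by (intro conjI ballI allI \<tau>0 add scale anti cube sup bdd bexI[of _ E]) simp_all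
  have "\<tau> ` Linf0_dual \<mu> = {arens \<mu> E F | F. F \<in> Linf0_dual \<mu>}"
  proof (intro equalityI subsetI)
    fix x assume "x \<in> \<tau> ` Linf0_dual \<mu>"
    then obtain F where F: "F \<in> Linf0_dual \<mu>" "x = \<tau> F" by blast
    then show "x \<in> {arens \<mu> E F | F. F \<in> Linf0_dual \<mu>}" unfolding mem_Collect_eq \<tau>_def by (intro exI[of _ "star F"] conjI star_Linf0)
  next
    fix x assume "x \<in> {arens \<mu> E F | F. F \<in> Linf0_dual \<mu>}"
    then obtain F where F: "F \<in> Linf0_dual \<mu>" "x = arens \<mu> E F" by blast
    then have "x = \<tau> (star F)" by (simp add: \<tau>_def)
    then show "x \<in> \<tau> ` Linf0_dual \<mu>" using star_Linf0[OF F(1)] by (rule image_eqI)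
  qed
  moreover have "{arens \<mu> E F | F. F \<in> Linf0_dual \<mu>} \<subseteq> Linf0_dual \<mu>"
    using Linf0_dual_arens[OF E0] by blast
  ultimately have "trivolution_onto (Linf0_dual_alg \<mu>) {arens \<mu> E F | F. F \<in> Linf0_dual \<mu>} \<tau>"
    unfolding trivolution_onto_def using triv by (simp add: Linf0_dual_alg_def)
  then show ?thesis unfolding \<tau>_def[abs_def] .
qed

end

theorem theorem4p7:
  fixes \<mu> :: "'g::{topological_group_add,t2_space} measure"
    and E :: "('g \<Rightarrow> complex) \<Rightarrow> complex"
  assumes "locally compact (UNIV :: 'g set)"
    and "left_haar_measure \<mu>"
    and "E \<in> right_identities_norm_one \<mu>"
  shows "\<exists>\<tau>. trivolution_onto (Linf0_dual_alg \<mu>) {arens \<mu> E F | F. F \<in> Linf0_dual \<mu>} \<tau>"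
proof -
  interpret haar_group \<mu> using assms(1,2) by unfold_locales
  have "right_identity E" "dual_norm \<mu> E = 1"
    using assms(3) by (auto simp: right_identity_def right_identities_norm_one_def)
  then show ?thesis by (intro exI[of _ "\<lambda>F. arens \<mu> E (star F)"] trivolution_exists)
qed

end
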